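(* Let $L_1,\dots,L_M\in\mathbb{N}$ and $q_1,\dots,q_M\in\mathbb{R}[x]$ with $\deg q_j<2L_j$, $q_j(0)=0$, and let $P(x,y)=\prod_{j=1}^M(y+q_j(x)+ix^{2L_j})$. Let $A=\tfrac12(P+\bar P)$, $B=\tfrac1{2i}(P-\bar P)$, and fix $t\in\mathbb{R}$. Then locally $A+tB$ has $M$ smooth branches $y=a_j(x;t)$, $j=1,\dots,M$, through $(0,0)$ with $a_j(\cdot;t)\in\mathbb{R}\{x\}$, and for $Q\in\mathbb{C}\{x,y\}$: $Q/P\in L^2_{loc}$ if and only if for each $j=1,\dots,M$, $$2\,\mathrm{Ord}\bigl(Q(x,a_j(x;t))\bigr)\ge\mathrm{Ord}\Bigl(B(x,a_j(x;t))\bigl(A_y(x,a_j(x;t))+tB_y(x,a_j(x;t))\bigr)\Bigr).$$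
   Context: $\bar P(x,y)=\overline{P(\bar x,\bar y)}$; subscript $y$ denotes $\partial/\partial y$. $\mathbb{C}\{x,y\}$ are convergent power series at the origin, $\mathbb{R}\{x\}$ convergent real-coefficient series in $x$. Ord is order of vanishing at $0$. $f\in L^{2}_{loc}$ means $f\in L^2(U)$ (Lebesgue measure) for some neighborhood $U$ of $(0,0)$ in $\mathbb{R}^2$. *)

theory Defs
  imports "HOL-Analysis.Analysis" "HOL-Computational_Algebra.Polynomial" "HOL-Library.Extended_Nat"
begin

definition Pfun :: "nat \<Rightarrow> (nat \<Rightarrow> nat) \<Rightarrow> (nat \<Rightarrow> real poly) \<Rightarrow> complex \<Rightarrow> complex \<Rightarrow> complex" where
  "Pfun M L q x y = (\<Prod>j<M. y + poly (map_poly of_real (q j)) x + \<i> * x ^ (2 * L j))"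

definition conj_fun :: "(complex \<Rightarrow> complex \<Rightarrow> complex) \<Rightarrow> complex \<Rightarrow> complex \<Rightarrow> complex" where
  "conj_fun F x y = cnj (F (cnj x) (cnj y))"

definition Apart :: "(complex \<Rightarrow> complex \<Rightarrow> complex) \<Rightarrow> complex \<Rightarrow> complex \<Rightarrow> complex" where
  "Apart F x y = (F x y + conj_fun F x y) / 2"

definition Bpart :: "(complex \<Rightarrow> complex \<Rightarrow> complex) \<Rightarrow> complex \<Rightarrow> complex \<Rightarrow> complex" where
  "Bpart F x y = (F x y - conj_fun F x y) / (2 * \<i>)"

definition partial_y :: "(complex \<Rightarrow> complex \<Rightarrow> complex) \<Rightarrow> complex \<Rightarrow> complex \<Rightarrow> complex" where
  "partial_y F x y = deriv (\<lambda>w. F x w) y"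

definition real_ps_rep :: "(nat \<Rightarrow> 'a::real_normed_vector) \<Rightarrow> (real \<Rightarrow> 'a) \<Rightarrow> bool" where
  "real_ps_rep c f \<longleftrightarrow> (\<exists>r>0. \<forall>x. \<bar>x\<bar> < r \<longrightarrow> ((\<lambda>n. x ^ n *\<^sub>R c n) sums f x))"

definition real_conv_series :: "(real \<Rightarrow> real) \<Rightarrow> bool" where
  "real_conv_series f \<longleftrightarrow> (\<exists>c. real_ps_rep c f)"

text \<open>Ord: order of vanishing at 0 of a germ given by a convergent power series,
  i.e. the least index of a nonzero coefficient (infinity for the zero germ).\<close>
definition ord0 :: "(real \<Rightarrow> 'a::real_normed_vector) \<Rightarrow> enat" where
  "ord0 f = Inf {enat n | n. \<exists>c. real_ps_rep c f \<and> c n \<noteq> 0}"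

definition conv_ps2 :: "(complex \<Rightarrow> complex \<Rightarrow> complex) \<Rightarrow> bool" where
  "conv_ps2 Q \<longleftrightarrow> (\<exists>r>0. \<exists>c :: nat \<Rightarrow> nat \<Rightarrow> complex. \<forall>x y. norm x < r \<and> norm y < r \<longrightarrow>
      ((\<lambda>(m, n). c m n * x ^ m * y ^ n) has_sum Q x y) UNIV)"

definition L2_loc :: "(real \<times> real \<Rightarrow> complex) \<Rightarrow> bool" where
  "L2_loc f \<longleftrightarrow> (\<exists>U. open U \<and> (0, 0) \<in> U \<and> set_borel_measurable lborel U f \<and>
      set_integrable lborel U (\<lambda>z. (cmod (f z))\<^sup>2))"

definition has_branches :: "nat \<Rightarrow> (complex \<Rightarrow> complex \<Rightarrow> complex) \<Rightarrow> (nat \<Rightarrow> real \<Rightarrow> real) \<Rightarrow> bool" where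
  "has_branches M F a \<longleftrightarrow>
     (\<forall>j<M. real_conv_series (a j) \<and> a j 0 = 0) \<and>
     (\<exists>r>0. \<forall>x y. \<bar>x\<bar> < r \<longrightarrow>
        F (of_real x) (of_real y) = (\<Prod>j<M. of_real (y - a j x)))"

end

theory Submission
  imports Defs "HOL-Complex_Analysis.Complex_Analysis" "HOL-Probability.Sinc_Integral"
    "HOL-Computational_Algebra.Fundamental_Theorem_Algebra"
begin

text \<open>
  Fix a real \<open>x \<noteq> 0\<close>. All zeros of \<open>P(x, \<cdot>)\<close> lie in the open lower half-plane, so by Hermite--Biehler
  \<open>A + tB\<close> has \<open>M\<close> distinct real zeros \<open>a\<^sub>j(x)\<close>, and closing contours in the half-planes gives, for every
  polynomial \<open>R\<close> of degree less than \<open>M\<close>, the quadrature formula of the de Branges space of \<open>P(x, \<cdot>)\<close>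
  \<open>\<integral> |R / P|\<^sup>2 dy = \<pi> \<Sum>\<^sub>j |R(a\<^sub>j)|\<^sup>2 / (B (A\<^sub>y + t B\<^sub>y))(a\<^sub>j)\<close>.
  Newton interpolation at the \<open>a\<^sub>j(x)\<close> writes \<open>Q = R + (A + tB) h\<close> with \<open>h\<close> bounded. As
  \<open>|A + tB| \<le> (1 + t\<^sup>2)\<^sup>1\<^sup>/\<^sup>2 |P|\<close> on the real plane, \<open>Q / P\<close> is locally square integrable iff \<open>R / P\<close> is, that is,
  iff all quotients \<open>|Q(x, a\<^sub>j)|\<^sup>2 / (B (A\<^sub>y + t B\<^sub>y))(x, a\<^sub>j)\<close> are integrable in \<open>x\<close> near 0. Each of them behaves
  like an integer power of \<open>|x|\<close>, which is integrable iff the exponent is nonnegative.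

  The branches are analytic by Rellich's theorem on hyperbolic polynomials. One root is found at a time:
  a Tschirnhaus shift removes the subleading coefficient, real-rootedness on both sides of \<open>x = 0\<close>
  forces the first slope \<open>k\<close> of the Newton polygon to be an integer, and after the blow-up \<open>y = x\<^sup>k z\<close>
  the roots at \<open>x = 0\<close> are no longer all equal, so the multiplicity drops.
\<close>

section \<open>Germs of real-analytic functions and of polynomials with such coefficients\<close>

text \<open>The difficulty is uniformity in \<open>x\<close>. All branches and all zeros of
  \<open>P\<close> meet at the origin, so Lagrange interpolation at the branches has denominators
  tending to 0. Newton's divided differences are bounded instead by the maximum modulus principle,
  with a constant that depends only on \<open>M\<close>, a radius and a bound for \<open>Q\<close>.
  The quadrature formula lives on the whole line while \<open>Q / P\<close> is known only near 0;
  but once the zeros of P(x, .) have modulus at most \<open>\<eta> / 2\<close>, \<open>R / P\<close>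
  decays like 1/|y| beyond \<open>\<eta>\<close>, uniformly in \<open>x\<close>. So slice integral
  and quadrature sum bound each other up to factors 2 and a constant independent of
  \<open>x\<close>, and Tonelli leaves a question in one variable. Simplicity of the roots and
  positivity of the weights come out of the contour integrals: for the cofactor of a root they
  equate a positive integral with a positive multiple of the ratio of the two factors of the weight.
  Germs are complex functions, analytic at 0 and real on the real axis, so that factoring out powers
  and taking uniform limits are steps of complex analysis.\<close>

definition real_germ :: "(complex \<Rightarrow> complex) \<Rightarrow> bool" where
  "real_germ f \<longleftrightarrow> f analytic_on {0} \<and> (\<forall>\<^sub>F x in nhds 0. f (complex_of_real x) \<in> \<real>)"

lemma eventually_nhds_of_real:
  "\<forall>\<^sub>F z in nhds (0::complex). Pr z \<Longrightarrow> \<forall>\<^sub>F x in nhds (0::real). Pr (of_real x)"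
proof -
  assume "\<forall>\<^sub>F z in nhds (0::complex). Pr z"
  moreover have "filterlim complex_of_real (nhds 0) (nhds 0)"
    using tendsto_of_real[OF filterlim_ident, of "0::real"] by simp
  ultimately show ?thesis by (auto simp: filterlim_iff)
qed

lemma real_germ_const: "c \<in> \<real> \<Longrightarrow> real_germ (\<lambda>_. c)"
  by (simp add: real_germ_def)

lemma real_germ_ident: "real_germ (\<lambda>x. x)"
  by (simp add: real_germ_def)

lemma real_germ_add: "real_germ f \<Longrightarrow> real_germ g \<Longrightarrow> real_germ (\<lambda>x. f x + g x)"
  unfolding real_germ_def by (auto intro!: analytic_intros elim: eventually_elim2)

lemma real_germ_mult: "real_germ f \<Longrightarrow> real_germ g \<Longrightarrow> real_germ (\<lambda>x. f x * g x)"
  unfolding real_germ_def by (auto intro!: analytic_intros elim: eventually_elim2)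

lemma real_germ_uminus: "real_germ f \<Longrightarrow> real_germ (\<lambda>x. - f x)"
  using real_germ_mult[OF real_germ_const[of "-1"]] by simp

lemma real_germ_power: "real_germ f \<Longrightarrow> real_germ (\<lambda>x. f x ^ n)"
  by (induction n) (auto intro: real_germ_mult real_germ_const)

lemma real_germ_sum: "(\<And>i. i \<in> A \<Longrightarrow> real_germ (f i)) \<Longrightarrow> real_germ (\<lambda>x. \<Sum>i\<in>A. f i x)"
  by (induction A rule: infinite_finite_induct) (auto intro: real_germ_add real_germ_const)

lemma real_germ_tendsto: "real_germ f \<Longrightarrow> (f \<longlongrightarrow> f 0) (nhds 0)"
  unfolding real_germ_def
  by (metis analytic_at_imp_isCont isCont_def tendsto_at_iff_tendsto_nhds)

lemma real_germ_at_0: "real_germ f \<Longrightarrow> f 0 \<in> \<real>"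
  unfolding real_germ_def using eventually_nhds_x_imp_x by fastforce

text \<open>Every exponent in the proof is read off from this dichotomy: those of the Newton polygon
  in \<open>analytic_root\<close> and the orders in \<open>germ_ratio_bounded\<close>.\<close>

lemma analytic_germ_cases:
  fixes b :: "complex \<Rightarrow> complex"
  assumes "b analytic_on {0}"
  shows "(\<forall>\<^sub>F x in nhds 0. b x = 0) \<or>
    (\<exists>n u. u analytic_on {0} \<and> u 0 \<noteq> 0 \<and> (\<forall>\<^sub>F x in nhds 0. b x = x ^ n * u x))"
proof -
  obtain r where r: "r > 0" "b holomorphic_on ball 0 r"
    using assms by (auto simp: analytic_on_def)
  have ev: "\<forall>\<^sub>F x in nhds 0. x \<in> ball (0::complex) s" if "s > 0" for s
    using that by (intro eventually_nhds_in_open) auto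
  consider "b 0 \<noteq> 0" | "b 0 = 0" "b constant_on ball 0 r" | "b 0 = 0" "\<not> b constant_on ball 0 r" by blast
  then show ?thesis
  proof cases
    case 1
    then show ?thesis using assms by (intro disjI2 exI[of _ 0] exI[of _ b]) auto
  next
    case 2
    then have "\<forall>x\<in>ball 0 r. b x = 0"
      using r(1) unfolding constant_on_def by (metis centre_in_ball)
    then show ?thesis using ev[OF r(1)] by (auto elim!: eventually_mono)
  next
    case 3
    obtain g s n where g: "0 < s" "g holomorphic_on ball 0 s"
      "\<And>w. w \<in> ball 0 s \<Longrightarrow> b w = (w - 0) ^ n * g w" "\<And>w. w \<in> ball 0 s \<Longrightarrow> g w \<noteq> 0"
      using holomorphic_factor_zero_nonconstant[OF r(2) open_ball connected_ball _ 3] r(1)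
      by (metis centre_in_ball)
    have "g analytic_on {0}"
      using g(1,2) by (auto simp: analytic_on_def)
    moreover have "\<forall>\<^sub>F x in nhds 0. b x = x ^ n * g x"
      using ev[OF g(1)] by eventually_elim (use g(3) in auto)
    moreover have "g 0 \<noteq> 0" using g(1,4) by auto
    ultimately show ?thesis by blast
  qed
qed

text \<open>Off 0 the unit is a quotient of real numbers; its value at 0 is real because the reals
  are closed.\<close>

lemma real_germ_divide_power:
  assumes b: "real_germ b" and u: "u analytic_on {0}" and eq: "\<forall>\<^sub>F x in nhds 0. b x = x ^ n * u x"
  shows "real_germ u"
proof -
  have ev: "\<forall>\<^sub>F x in nhds (0::real). x \<noteq> 0 \<longrightarrow> u (of_real x) \<in> \<real>"
  proof -
    have "\<forall>\<^sub>F x in nhds (0::real). b (of_real x) \<in> \<real>" using b by (simp add: real_germ_def)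
    moreover have "\<forall>\<^sub>F x in nhds (0::real). b (of_real x) = of_real x ^ n * u (of_real x)"
      by (rule eventually_nhds_of_real[OF eq])
    ultimately show ?thesis
    proof eventually_elim
      case (elim x)
      show ?case
      proof
        assume "x \<noteq> 0"
        then have "u (of_real x) = b (of_real x) / of_real (x ^ n)" using elim by simp
        then show "u (of_real x) \<in> \<real>" using elim(1) by simp
      qed
    qed
  qed
  have u0: "u 0 \<in> \<real>"
  proof (rule Lim_in_closed_set[of \<real> "\<lambda>x::real. u (of_real x)" "at 0"])
    show "\<forall>\<^sub>F x in at (0::real). u (of_real x) \<in> \<real>"
      using ev by (simp add: eventually_at_filter)
    have "isCont u 0" using u by (rule analytic_at_imp_isCont)
    then have "(u \<longlongrightarrow> u 0) (nhds 0)" by (simp add: isCont_def tendsto_at_iff_tendsto_nhds)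
    then show "((\<lambda>x::real. u (of_real x)) \<longlongrightarrow> u 0) (at 0)"
      by (rule filterlim_compose) (auto intro!: tendsto_eq_intros)
  qed (auto simp: closed_complex_Reals)
  have "\<forall>\<^sub>F x in nhds (0::real). u (of_real x) \<in> \<real>"
    using ev by (rule eventually_mono) (metis of_real_0 u0)
  then show ?thesis using u by (simp add: real_germ_def)
qed

text \<open>The degree may vary with \<open>x\<close>, since leading coefficients may vanish at
  single points. The uniform bound turns evaluation into a sum of fixed length, to which the closure
  properties of germs apply.\<close>

definition poly_germ :: "(complex \<Rightarrow> complex poly) \<Rightarrow> bool" where
  "poly_germ F \<longleftrightarrow> (\<forall>i. real_germ (\<lambda>x. coeff (F x) i)) \<and> (\<exists>N. \<forall>x. degree (F x) \<le> N)"

lemma poly_germI: "(\<And>i. real_germ (\<lambda>x. coeff (F x) i)) \<Longrightarrow> (\<And>x. degree (F x) \<le> N) \<Longrightarrow> poly_germ F"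
  by (auto simp: poly_germ_def)

lemma poly_germ_coeff: "poly_germ F \<Longrightarrow> real_germ (\<lambda>x. coeff (F x) i)"
  by (auto simp: poly_germ_def)

lemma poly_germ_degree: "poly_germ F \<Longrightarrow> \<exists>N. \<forall>x. degree (F x) \<le> N"
  by (auto simp: poly_germ_def)

lemma poly_as_sum_le: "degree p \<le> N \<Longrightarrow> poly p (x::complex) = (\<Sum>i\<le>N. coeff p i * x ^ i)"
  unfolding poly_altdef by (rule sum.mono_neutral_left) (auto simp: coeff_eq_0)

lemma real_germ_poly:
  assumes "poly_germ F" "real_germ g"
  shows "real_germ (\<lambda>x. poly (F x) (g x))"
proof -
  obtain N where "\<And>x. degree (F x) \<le> N" using poly_germ_degree[OF assms(1)] by blast
  then have "(\<lambda>x. poly (F x) (g x)) = (\<lambda>x. \<Sum>i\<le>N. coeff (F x) i * g x ^ i)"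
    using poly_as_sum_le by blast
  then show ?thesis
    using assms by (simp add: real_germ_sum real_germ_mult real_germ_power poly_germ_coeff)
qed

lemma poly_germ_add: "poly_germ F \<Longrightarrow> poly_germ G \<Longrightarrow> poly_germ (\<lambda>x. F x + G x)"
  unfolding poly_germ_def
  by (auto intro!: real_germ_add) (metis degree_add_le max.coboundedI1 max.coboundedI2)

lemma poly_germ_pCons: "real_germ f \<Longrightarrow> poly_germ G \<Longrightarrow> poly_germ (\<lambda>x. pCons (f x) (G x))"
proof -
  assume f: "real_germ f" and G: "poly_germ G"
  then obtain N where "\<And>x. degree (G x) \<le> N" by (auto simp: poly_germ_def)
  then have "degree (pCons (f x) (G x)) \<le> Suc N" for x
    using degree_pCons_le[of "f x" "G x"] le_trans by blast
  moreover have "real_germ (\<lambda>x. coeff (pCons (f x) (G x)) i)" for i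
    using f G by (cases i) (auto simp: poly_germ_def)
  ultimately show ?thesis by (rule poly_germI[rotated])
qed

lemma poly_germ_0: "poly_germ (\<lambda>x. 0)"
  by (rule poly_germI[where N = 0]) (auto intro: real_germ_const)

lemma poly_germ_mult: "poly_germ F \<Longrightarrow> poly_germ G \<Longrightarrow> poly_germ (\<lambda>x. F x * G x)"
proof -
  assume F: "poly_germ F" and G: "poly_germ G"
  obtain N N' where N: "\<And>x. degree (F x) \<le> N" "\<And>x. degree (G x) \<le> N'"
    using F G by (auto simp: poly_germ_def)
  have "degree (F x * G x) \<le> N + N'" for x
    using degree_mult_le[of "F x" "G x"] N[of x] by linarith
  moreover have "real_germ (\<lambda>x. coeff (F x * G x) i)" for i
    unfolding coeff_mult using F G by (intro real_germ_sum real_germ_mult poly_germ_coeff)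
  ultimately show ?thesis by (rule poly_germI[rotated])
qed

lemma poly_germ_sum: "(\<And>i. i \<in> A \<Longrightarrow> poly_germ (f i)) \<Longrightarrow> poly_germ (\<lambda>x. \<Sum>i\<in>A. f i x)"
  by (induction A rule: infinite_finite_induct) (auto intro: poly_germ_add poly_germ_0)

lemma poly_germ_smult: "real_germ f \<Longrightarrow> poly_germ G \<Longrightarrow> poly_germ (\<lambda>x. smult (f x) (G x))"
  using poly_germ_mult[OF poly_germ_pCons[OF _ poly_germ_0], of f G] by simp

lemma poly_germ_monom: "real_germ f \<Longrightarrow> poly_germ (\<lambda>x. monom (f x) n)"
proof (rule poly_germI[where N = n])
  show "real_germ (\<lambda>x. coeff (monom (f x) n) i)" if "real_germ f" for i
    using that by (cases "n = i") (auto intro: real_germ_const)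
qed (simp_all add: degree_monom_le)

lemma poly_germ_power: "poly_germ F \<Longrightarrow> poly_germ (\<lambda>x. F x ^ n)"
  by (induction n)
     (auto intro!: poly_germ_mult poly_germ_pCons poly_germ_0 real_germ_const simp: one_pCons)

lemma poly_germ_shift:
  assumes F: "poly_germ F" and g: "real_germ g"
  shows "poly_germ (\<lambda>x. pcompose (F x) [:g x, 1:])"
proof -
  obtain N where N: "\<And>x. degree (F x) \<le> N" using F by (auto simp: poly_germ_def)
  have "pcompose (F x) [:g x, 1:] = (\<Sum>i\<le>N. smult (coeff (F x) i) ([:g x, 1:] ^ i))" for x
    by (rule poly_eq_poly_eq_iff[THEN iffD1])
       (auto simp: poly_pcompose poly_as_sum_le[OF N] poly_sum)
  then show ?thesis
    by (simp add: poly_germ_sum poly_germ_smult poly_germ_coeff[OF F] poly_germ_power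
        poly_germ_pCons g poly_germ_0 real_germ_const)
qed

lemma poly_germ_pderiv: "poly_germ F \<Longrightarrow> poly_germ (\<lambda>x. pderiv (F x))"
proof -
  assume F: "poly_germ F"
  then obtain N where N: "\<And>x. degree (F x) \<le> N" by (auto simp: poly_germ_def)
  show ?thesis
  proof (rule poly_germI[where N = N])
    show "degree (pderiv (F x)) \<le> N" for x
      using N[of x] by (simp add: degree_pderiv)
    show "real_germ (\<lambda>x. coeff (pderiv (F x)) i)" for i
      unfolding coeff_pderiv using F by (intro real_germ_mult real_germ_const poly_germ_coeff) auto
  qed
qed

lemma poly_germ_higher_pderiv: "poly_germ F \<Longrightarrow> poly_germ (\<lambda>x. (pderiv ^^ n) (F x))"
  by (induction n) (auto intro: poly_germ_pderiv)

text \<open>Taylor's formula. Through it a shift that kills the coefficient of index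
  \<open>m - 1\<close> is the same as a root of the derivative of order
  \<open>m - 1\<close>.\<close>

lemma coeff_pcompose_shift:
  fixes p :: "complex poly"
  shows "fact i * coeff (pcompose p [:c, 1:]) i = poly ((pderiv ^^ i) p) c"
proof -
  have "(pderiv ^^ i) (pcompose p [:c, 1:]) = pcompose ((pderiv ^^ i) p) [:c, 1:]"
    by (induction i) (simp_all add: pderiv_pcompose pderiv_pCons)
  then have "coeff ((pderiv ^^ i) (pcompose p [:c, 1:])) 0 = poly ((pderiv ^^ i) p) c"
    by (simp add: coeff_pcompose_0)
  then show ?thesis
    by (simp add: coeff_higher_pderiv pochhammer_fact)
qed

text \<open>Horner's scheme: the quotient has as coefficients the values at \<open>c\<close> of the
  tails of \<open>p\<close>. They are polynomial in \<open>c\<close> and the coefficients of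
  \<open>p\<close>, hence again germs.\<close>

lemma coeff_synthetic_div:
  fixes p :: "complex poly"
  shows "coeff (synthetic_div p c) i = poly (poly_shift (Suc i) p) c"
proof (induction p arbitrary: i)
  case (pCons a p)
  have *: "poly_shift (Suc k) (pCons a p) = poly_shift k p" for k
    by (rule poly_eqI) (simp add: coeff_poly_shift)
  show ?case
  proof (cases i)
    case 0
    then show ?thesis by (simp add: *)
  next
    case (Suc k)
    then show ?thesis using pCons.IH[of k] by (simp add: *)
  qed
qed simp

lemma poly_germ_synthetic_div:
  assumes F: "poly_germ F" and g: "real_germ g"
  shows "poly_germ (\<lambda>x. synthetic_div (F x) (g x))"
proof -
  obtain N where N: "\<And>x. degree (F x) \<le> N" using F by (auto simp: poly_germ_def)
  show ?thesis
  proof (rule poly_germI[where N = N])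
    show "degree (synthetic_div (F x) (g x)) \<le> N" for x
      using N[of x] by (simp add: degree_synthetic_div)
    have "poly_germ (\<lambda>x. poly_shift k (F x))" for k
    proof (rule poly_germI[where N = N])
      show "degree (poly_shift k (F x)) \<le> N" for x
        using N[of x] by (intro degree_le) (auto simp: coeff_poly_shift intro!: coeff_eq_0)
    qed (simp add: coeff_poly_shift poly_germ_coeff[OF F])
    then show "real_germ (\<lambda>x. coeff (synthetic_div (F x) (g x)) i)" for i
      unfolding coeff_synthetic_div by (intro real_germ_poly g)
  qed
qed

lemma poly_germ_isCont:
  assumes F: "poly_germ F"
  shows "isCont (\<lambda>v. poly (F (fst v)) (snd v)) (0, 0)"
proof -
  obtain N where N: "\<And>x. degree (F x) \<le> N" using poly_germ_degree[OF F] by blast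
  have "isCont (\<lambda>x. coeff (F x) i) (fst (0::complex, 0::complex))" for i
    using poly_germ_coeff[OF F, of i] unfolding real_germ_def by (simp add: analytic_at_imp_isCont)
  then have c: "isCont (\<lambda>v. coeff (F (fst v)) i) (0::complex, 0::complex)" for i
    by (rule isCont_o2[OF isCont_fst[OF continuous_ident]])
  have "isCont (\<lambda>v. \<Sum>i\<le>N. coeff (F (fst v)) i * snd v ^ i) (0::complex, 0::complex)"
    by (intro continuous_intros c)
  then show ?thesis by (simp add: poly_as_sum_le[OF N])
qed

text \<open>The simple root is the fixed point of the chord iteration \<open>z \<mapsto> z - F(x, z) / F\<^sub>z(0, 0)\<close>,
  whose iterates are holomorphic in \<open>x\<close> and converge uniformly.\<close>
lemma simple_root_germ:
  assumes F: "poly_germ F" and c0: "coeff (F 0) 0 = 0" and c1: "coeff (F 0) 1 \<noteq> 0"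
  shows "\<exists>g. real_germ g \<and> g 0 = 0 \<and> (\<forall>\<^sub>F x in nhds 0. poly (F x) (g x) = 0)"
proof -
  define b where "b = coeff (F 0) 1"
  have b: "b \<noteq> 0" "b \<in> \<real>"
    using c1 real_germ_at_0[OF poly_germ_coeff[OF F, of 1]] by (auto simp: b_def)
  define T where "T x z = z - poly (F x) z / b" for x z
  define D where "D x z = 1 - poly (pderiv (F x)) z / b" for x z
  have dT: "(T x has_field_derivative D x z) (at z within A)" for x z A
    unfolding T_def D_def using b by (auto intro!: derivative_eq_intros)
  have "poly (pderiv (F 0)) 0 = b" by (simp add: poly_0_coeff_0 coeff_pderiv b_def)
  \<comment> \<open>The chord slope is the derivative at the origin, so \<open>T\<close> has
    derivative 0 there and, by continuity, derivative below 1/2 nearby.\<close>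
  then have "D 0 0 = 0" using b by (simp add: D_def)
  moreover have "isCont (\<lambda>v. D (fst v) (snd v)) (0, 0)"
    unfolding D_def using b by (intro continuous_intros poly_germ_isCont poly_germ_pderiv F) auto
  ultimately have "\<exists>d>0. \<forall>v. dist v (0, 0) < d \<longrightarrow> dist (D (fst v) (snd v)) 0 < 1/2"
    unfolding continuous_at_eps_delta by (metis fst_conv half_gt_zero_iff snd_conv zero_less_one)
  then obtain d where d: "d > 0" "\<And>x z. norm (x, z) < d \<Longrightarrow> norm (D x z) < 1/2"
    by (metis dist_0_norm dist_commute fst_conv snd_conv zero_prod_def)
  \<comment> \<open>With |x| below \<open>\<rho>\<close> and |z| at most \<open>\<rho>\<close> the
    pair stays well inside the ball of radius \<open>d\<close>.\<close>
  define \<rho> where "\<rho> = d / 4"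
  have \<rho>: "\<rho> > 0" using d by (simp add: \<rho>_def)
  have "(\<lambda>x. poly (F x) 0) analytic_on {0}" "poly (F 0) 0 = 0"
    using real_germ_poly[OF F real_germ_const[of 0]] c0 by (auto simp: real_germ_def poly_0_coeff_0)
  then have "isCont (\<lambda>x. poly (F x) 0) 0" "poly (F 0) 0 = 0" by (auto simp: analytic_at_imp_isCont)
  \<comment> \<open>This threshold gives |T x 0| at most \<open>\<rho> / 2\<close>; together with
    the contraction factor 1/2 it makes \<open>T x\<close> map the disc of radius
    \<open>\<rho>\<close> into itself.\<close>
  then have "\<exists>s>0. \<forall>x. dist x 0 < s \<longrightarrow> dist (poly (F x) 0) 0 < \<rho> / 2 * norm b"
    unfolding continuous_at_eps_delta using \<rho> b by (metis half_gt_zero_iff mult_pos_pos zero_less_norm_iff)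
  then obtain s where s: "s > 0" "\<And>x. norm x < s \<Longrightarrow> norm (poly (F x) 0) < \<rho> / 2 * norm b"
    by auto
  obtain N where N: "\<And>x. degree (F x) \<le> N" using poly_germ_degree[OF F] by blast
  have "\<exists>R>0. \<forall>i\<le>N. (\<lambda>x. coeff (F x) i) holomorphic_on ball 0 R"
  proof -
    have "\<exists>R>0. (\<lambda>x. coeff (F x) i) holomorphic_on ball 0 R" for i
      using poly_germ_coeff[OF F, of i] by (auto simp: real_germ_def analytic_on_def)
    then obtain R where R: "\<And>i. R i > 0" "\<And>i. (\<lambda>x. coeff (F x) i) holomorphic_on ball 0 (R i)" by metis
    let ?R = "Min (R ` {..N})"
    have "?R > 0" using R by (subst Min_gr_iff) auto
    moreover have "(\<lambda>x. coeff (F x) i) holomorphic_on ball 0 ?R" if "i \<le> N" for i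
      using that by (intro holomorphic_on_subset[OF R(2)[of i]] subset_ball) auto
    ultimately show ?thesis by blast
  qed
  then obtain R where R: "R > 0" "\<And>i. i \<le> N \<Longrightarrow> (\<lambda>x. coeff (F x) i) holomorphic_on ball 0 R"
    by blast
  define r where "r = min \<rho> (min s R) / 2"
  have r: "r > 0" "r < \<rho>" "r < s" "r < R" using \<rho> s R by (auto simp: r_def)
  have contr: "norm (T x z - T x w) \<le> 1/2 * norm (z - w)"
    if "norm x \<le> r" "norm z \<le> \<rho>" "norm w \<le> \<rho>" for x z w
  proof (rule field_differentiable_bound[of "cball 0 \<rho>" "T x" "D x"])
    fix z :: complex assume "z \<in> cball 0 \<rho>"
    then have "norm (x, z) < d"
      using norm_Pair_le[of x z] that(1) r(2) d(1) by (simp add: \<rho>_def)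
    then show "norm (D x z) \<le> 1/2" using d(2) less_imp_le by blast
  qed (use dT that in auto)
  have self: "norm (T x z) \<le> \<rho>" if "norm x \<le> r" "norm z \<le> \<rho>" for x z
  proof -
    have "norm (T x 0) \<le> \<rho> / 2"
      using s(2)[of x] that(1) r(3) b(1) by (simp add: T_def norm_divide field_simps)
    moreover have "norm (T x z - T x 0) \<le> 1/2 * norm (z - 0)" using contr[of x z 0] that \<rho> by simp
    moreover have "norm (T x z) \<le> norm (T x z - T x 0) + norm (T x 0)"
      using norm_triangle_ineq[of "T x z - T x 0" "T x 0"] by simp
    ultimately show ?thesis using that(2) by simp
  qed
  have fp: "\<exists>!z. z \<in> cball 0 \<rho> \<and> T x z = z" if "norm x \<le> r" for x
    using self[OF that] contr[OF that] \<rho>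
    by (intro Banach_fix[where c = "1/2"]) (auto simp: dist_norm complete_eq_closed)
  define g where "g x = (THE z. z \<in> cball 0 \<rho> \<and> T x z = z)" for x
  have g: "norm (g x) \<le> \<rho>" "T x (g x) = g x" if "norm x \<le> r" for x
    using theI'[OF fp[OF that]] by (auto simp: g_def)
  define h where "h n x = ((T x) ^^ n) 0" for n x
  have h0: "h 0 x = 0" and hS: "h (Suc n) x = T x (h n x)" for n x by (simp_all add: h_def)
  have hb: "norm (h n x) \<le> \<rho>" if "norm x \<le> r" for n x
    by (induction n) (use \<rho> self[OF that] in \<open>auto simp: h0 hS\<close>)
  have hg: "norm (h n x - g x) \<le> \<rho> * (1/2) ^ n" if "norm x \<le> r" for n x
  proof (induction n)
    case 0
    then show ?case using g(1)[OF that] by (simp add: h0)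
  next
    case (Suc n)
    have "norm (h (Suc n) x - g x) = norm (T x (h n x) - T x (g x))" by (simp add: hS g(2)[OF that])
    also have "\<dots> \<le> 1/2 * norm (h n x - g x)" by (intro contr that hb g)
    finally show ?case using Suc by simp
  qed
  have hhol: "h n holomorphic_on ball 0 R" for n
  proof (induction n)
    case 0
    then show ?case by (simp add: h_def)
  next
    case (Suc n)
    have "h (Suc n) = (\<lambda>x. h n x - (\<Sum>i\<le>N. coeff (F x) i * h n x ^ i) / b)"
      by (simp add: fun_eq_iff hS T_def poly_as_sum_le[OF N])
    then show ?case using b(1) by (auto intro!: holomorphic_intros Suc R(2))
  qed
  have lim: "(\<lambda>n. \<rho> * (1/2) ^ n) \<longlonglongrightarrow> 0"
    by (rule tendsto_mult_right_zero) (rule LIMSEQ_power_zero, simp)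
  have ul: "uniform_limit (cball 0 r) h g sequentially"
  proof (rule uniform_limitI)
    fix e :: real assume "e > 0"
    then have "\<forall>\<^sub>F n in sequentially. \<rho> * (1/2) ^ n < e"
      using order_tendstoD(2)[OF lim] by blast
    then show "\<forall>\<^sub>F n in sequentially. \<forall>x\<in>cball 0 r. dist (h n x) (g x) < e"
    proof eventually_elim
      case (elim n)
      show ?case
      proof
        fix x :: complex assume "x \<in> cball 0 r"
        then have "norm (h n x - g x) \<le> \<rho> * (1/2) ^ n" using hg by simp
        then show "dist (h n x) (g x) < e" using elim by (simp add: dist_norm)
      qed
    qed
  qed
  have "h n holomorphic_on cball 0 r" for n
    by (rule holomorphic_on_subset[OF hhol[of n]]) (use r(4) in auto)
  then have hc: "continuous_on (cball 0 r) (h n) \<and> h n holomorphic_on ball 0 r" for n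
    using holomorphic_on_imp_continuous_on holomorphic_on_subset[OF _ ball_subset_cball] by blast
  have ghol: "g holomorphic_on ball 0 r"
    by (rule holomorphic_uniform_limit[OF always_eventually[OF allI[OF hc]] ul]) simp_all
  have ev: "\<forall>\<^sub>F x in nhds 0. x \<in> ball (0::complex) r"
    using r(1) by (intro eventually_nhds_in_open) auto
  have "\<forall>\<^sub>F x in nhds (0::real). \<forall>i\<in>{..N}. coeff (F (of_real x)) i \<in> \<real>"
    using poly_germ_coeff[OF F] by (intro eventually_ball_finite) (auto simp: real_germ_def)
  moreover have "\<forall>\<^sub>F x in nhds (0::real). of_real x \<in> ball (0::complex) r"
    by (rule eventually_nhds_of_real[OF ev])
  ultimately have "\<forall>\<^sub>F x in nhds (0::real). g (of_real x) \<in> \<real>"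
  proof eventually_elim
    case (elim x)
    have hR: "h n (of_real x) \<in> \<real>" for n
    proof (induction n)
      case (Suc n)
      then show ?case unfolding hS T_def poly_as_sum_le[OF N] using elim(1) b(2)
        by (intro Reals_diff Reals_divide sum_in_Reals Reals_mult Reals_power) auto
    qed (simp add: h0)
    have "(\<lambda>n. h n (of_real x) - g (of_real x)) \<longlonglongrightarrow> 0"
      using hg[of "of_real x"] elim(2) by (intro Lim_null_comparison[OF _ lim] always_eventually) auto
    then have "(\<lambda>n. h n (of_real x)) \<longlonglongrightarrow> g (of_real x)" by (simp add: LIM_zero_iff)
    then show ?case by (rule closed_sequentially[OF closed_complex_Reals hR])
  qed
  moreover have "g analytic_on {0}" using r(1) ghol by (auto simp: analytic_on_def)
  moreover have "g 0 = 0"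
  proof -
    have "T 0 0 = 0" using \<open>poly (F 0) 0 = 0\<close> by (simp add: T_def)
    then show ?thesis
      using contr[of 0 "g 0" 0] g[of 0] r(1) \<rho> by simp
  qed
  moreover have "\<forall>\<^sub>F x in nhds 0. poly (F x) (g x) = 0"
    using ev
  proof eventually_elim
    case (elim x)
    then show ?case using g(2)[of x] b(1) by (auto simp: T_def)
  qed
  ultimately show ?thesis unfolding real_germ_def by blast
qed

section \<open>Real-rooted polynomials: limits and signs of coefficients\<close>

lemma uniform_limit_sum_finite:
  fixes f :: "'i \<Rightarrow> 'a \<Rightarrow> 'b \<Rightarrow> 'c::real_normed_vector"
  assumes "\<And>i. i \<in> I \<Longrightarrow> uniform_limit S (f i) (l i) F"
  shows "uniform_limit S (\<lambda>n x. \<Sum>i\<in>I. f i n x) (\<lambda>x. \<Sum>i\<in>I. l i x) F"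
  using assms by (induction I rule: infinite_finite_induct) (auto intro!: uniform_limit_add uniform_limit_const)

text \<open>Hurwitz's theorem in the open half-plane containing a supposed nonreal root: the
  approximants have no zero there, so a nonconstant limit has none either. Degrees are only bounded
  by \<open>N\<close>, so roots may escape to infinity.\<close>

lemma real_rooted_limit:
  fixes p :: "nat \<Rightarrow> complex poly"
  assumes deg: "\<And>n. degree (p n) \<le> N" "degree q \<le> N"
    and lim: "\<And>i. i \<le> N \<Longrightarrow> (\<lambda>n. coeff (p n) i) \<longlonglongrightarrow> coeff q i"
    and real: "\<forall>\<^sub>F n in sequentially. \<forall>z. poly (p n) z = 0 \<longrightarrow> z \<in> \<real>"
    and q: "degree q > 0" and z: "poly q z = 0"
  shows "z \<in> \<real>"
proof (rule ccontr)
  assume nr: "z \<notin> \<real>"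
  obtain n0 where n0: "\<And>n z. n \<ge> n0 \<Longrightarrow> poly (p n) z = 0 \<Longrightarrow> z \<in> \<real>"
    using real by (auto simp: eventually_sequentially)
  define S where "S = (if Im z > 0 then {w. Im w > 0} else {w. Im w < 0})"
  have S: "open S" "connected S" "z \<in> S" "S \<inter> \<real> = {}"
    using nr by (auto simp: S_def open_halfspace_Im_gt open_halfspace_Im_lt complex_is_Real_iff
        convex_halfspace_Im_gt convex_halfspace_Im_lt convex_connected)
  have "poly q z \<noteq> 0"
  proof (rule Hurwitz_no_zeros[OF S(1,2), where \<F> = "\<lambda>n. poly (p (n + n0))" and g = "poly q" and ?z0.0 = z])
    show "uniform_limit K (\<lambda>n. poly (p (n + n0))) (poly q) sequentially" if K: "compact K" "K \<subseteq> S" for K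
    proof -
      have b: "bounded ((\<lambda>w. w ^ i) ` K)" for i
        using K(1) by (intro compact_imp_bounded compact_continuous_image continuous_intros)
      have "uniform_limit K (\<lambda>n w. \<Sum>i\<le>N. coeff (p (n + n0)) i * w ^ i) (\<lambda>w. \<Sum>i\<le>N. coeff q i * w ^ i) sequentially"
      proof (intro uniform_limit_sum_finite uniform_lim_mult)
        show "uniform_limit K (\<lambda>n w. coeff (p (n + n0)) i) (\<lambda>w. coeff q i) sequentially" if "i \<in> {..N}" for i
          using LIMSEQ_ignore_initial_segment[OF lim, of i n0] that
          by (auto simp: uniform_limit_iff tendsto_iff)
        show "bounded ((\<lambda>w. coeff q i) ` K)" for i
          by (rule bounded_subset[of "{coeff q i}"]) auto
      qed (auto simp: b intro!: uniform_limit_const)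
      moreover have "poly (p (n + n0)) = (\<lambda>w. \<Sum>i\<le>N. coeff (p (n + n0)) i * w ^ i)" for n
        by (rule ext) (rule poly_as_sum_le[OF deg(1)])
      moreover have "poly q = (\<lambda>w. \<Sum>i\<le>N. coeff q i * w ^ i)"
        by (rule ext) (rule poly_as_sum_le[OF deg(2)])
      ultimately show ?thesis by (simp only:)
    qed
    show "\<not> poly q constant_on S"
    proof
      assume "poly q constant_on S"
      then have "\<And>w. w \<in> S \<Longrightarrow> poly q w = 0" using S(3) z by (metis constant_on_def)
      then have "S \<subseteq> {w. poly q w = 0}" by auto
      moreover have "finite {w. poly q w = 0}" using q by (intro poly_roots_finite) auto
      ultimately have "finite S" using finite_subset by blast
      then show False using S(1,3) finite_imp_not_open by blast
    qed
    show "poly (p (n + n0)) w \<noteq> 0" if "w \<in> S" for n w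
      using n0[of "n + n0" w] that S(4) by auto
  qed (auto intro: holomorphic_intros S)
  then show False using z by simp
qed

text \<open>Vieta for the three leading coefficients, combined with Newton's identity that twice the
  second elementary symmetric function is the squared sum minus the sum of squares. The extra factor
  y^2 in \<open>E\<close> makes all three indices meaningful for small multisets, so the induction
  can start at the empty one.\<close>

lemma coeffs_prod_linear:
  fixes A :: "complex multiset"
  defines "E \<equiv> pCons 0 (pCons 0 (\<Prod>x\<in>#A. [:- x, 1:]))"
  shows "(\<forall>k>size A + 2. coeff E k = 0) \<and> coeff E (size A + 2) = 1 \<and> coeff E (size A + 1) = - sum_mset A \<and>
    2 * coeff E (size A) = (sum_mset A)\<^sup>2 - (\<Sum>x\<in>#A. x\<^sup>2)"
  unfolding E_def
proof (induction A)
  case empty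
  then show ?case by (auto simp: coeff_pCons one_pCons split: nat.splits)
next
  case (add x A)
  define e where "e = (\<Prod>x\<in>#A. [:- x, 1:])"
  define E where "E = pCons 0 (pCons 0 e)"
  have IH: "\<And>k. k > size A + 2 \<Longrightarrow> coeff E k = 0" "coeff E (size A + 2) = 1" "coeff E (size A + 1) = - sum_mset A"
    "2 * coeff E (size A) = (sum_mset A)\<^sup>2 - (\<Sum>x\<in>#A. x\<^sup>2)"
    using add.IH by (auto simp: E_def e_def)
  define G where "G = [:- x, 1:] * E"
  have eq: "pCons 0 (pCons 0 (\<Prod>x\<in>#add_mset x A. [:- x, 1:])) = G"
    by (simp add: G_def E_def e_def algebra_simps)
  have G: "coeff G (Suc k) = coeff E k - x * coeff E (Suc k)" for k
    by (simp add: G_def)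
  have "coeff G k = 0" if "k > size (add_mset x A) + 2" for k
    using that IH(1) G by (cases k) auto
  moreover have "coeff G (size (add_mset x A) + 2) = 1"
    using IH(1)[of "size A + 3"] IH(2) by (simp add: G eval_nat_numeral)
  moreover have "coeff G (size (add_mset x A) + 1) = - sum_mset (add_mset x A)"
    using IH(2,3) by (simp add: G)
  moreover have "2 * coeff G (size (add_mset x A)) = (sum_mset (add_mset x A))\<^sup>2 - (\<Sum>x\<in>#add_mset x A. x\<^sup>2)"
    using IH(3,4) by (simp add: G power2_eq_square algebra_simps)
  ultimately show ?case unfolding eq by blast
qed

text \<open>The roots are real with sum 0, so twice the coefficient ratio is minus the sum of their
  squares. It vanishes only if all roots are 0, and then \<open>p\<close> would be a multiple of the
  monomial of degree \<open>m\<close>, against \<open>i\<close>.\<close>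

lemma real_rooted_coeff_sign:
  fixes p :: "complex poly"
  assumes deg: "degree p = m" "m \<ge> 2" and real: "\<And>z. poly p z = 0 \<Longrightarrow> z \<in> \<real>"
    and c: "coeff p (m - 1) = 0" and i: "i < m" "coeff p i \<noteq> 0"
  shows "\<exists>s<0. coeff p (m - 2) = of_real s * coeff p m"
proof -
  have "p \<noteq> 0" using deg by auto
  then obtain A where A: "size A = m" "p = smult (lead_coeff p) (\<Prod>x\<in>#A. [:- x, 1:])"
    using alg_closed_imp_factorization[of p] deg by blast
  define e where "e = (\<Prod>x\<in>#A. [:- x, 1:])"
  obtain k where k: "m = Suc (Suc k)" using deg(2) by (metis Suc_diff_Suc Suc_le_lessD numeral_2_eq_2 diff_zero less_le_trans zero_less_Suc)
  have E: "coeff e (Suc k) = - sum_mset A" "2 * coeff e k = (sum_mset A)\<^sup>2 - (\<Sum>x\<in>#A. x\<^sup>2)"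
    using coeffs_prod_linear[of A] by (auto simp: e_def A(1) k)
  have p: "p = smult (coeff p m) e" using A(2) deg(1) by (simp add: e_def)
  have lc: "coeff p m \<noteq> 0" using \<open>p \<noteq> 0\<close> deg(1) by auto
  have pc: "coeff p i = coeff p m * coeff e i" for i by (subst p) simp
  have "sum_mset A = 0" using c lc E(1) pc[of "Suc k"] by (simp add: k)
  have ar: "x \<in> \<real>" if "x \<in># A" for x
  proof (rule real)
    have "poly e x = 0" unfolding e_def using that by (auto simp: poly_prod_mset prod_mset_zero_iff)
    then show "poly p x = 0" by (subst p) simp
  qed
  define s where "s = (\<Sum>x\<in>#A. (Re x)\<^sup>2)"
  have "(\<Sum>x\<in>#A. x\<^sup>2) = (\<Sum>x\<in>#A. of_real ((Re x)\<^sup>2))"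
    using ar by (intro arg_cong[of _ _ sum_mset] image_mset_cong) (auto elim!: Reals_cases)
  also have "\<dots> = of_real s" unfolding s_def by (induction A) auto
  finally have s: "(\<Sum>x\<in>#A. x\<^sup>2) = of_real s" .
  have "\<exists>x\<in>#A. x \<noteq> 0"
  proof (rule ccontr)
    assume "\<not> (\<exists>x\<in>#A. x \<noteq> 0)"
    then have "e = (\<Prod>x\<in>#A. [:0, 1:])"
      unfolding e_def by (intro arg_cong[of _ _ prod_mset] image_mset_cong) auto
    then have "e = [:0, 1:] ^ m" by (simp add: A(1))
    then have "e = monom 1 m" by (simp add: monom_altdef)
    then show False using i pc[of i] by simp
  qed
  then obtain x where x: "x \<in># A" "x \<noteq> 0" by blast
  have "s > 0"
  proof -
    obtain C where C: "A = add_mset x C" using x(1) by (metis insert_DiffM)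
    have "(\<Sum>x\<in>#C. (Re x)\<^sup>2) \<ge> 0" by (induction C) auto
    moreover have "Re x \<noteq> 0" using ar[OF x(1)] x(2) by (auto elim!: Reals_cases)
    ultimately show ?thesis by (simp add: s_def C add_pos_nonneg)
  qed
  moreover have "coeff p (m - 2) = of_real (- s / 2) * coeff p m"
  proof -
    have "2 * coeff e k = - of_real s" using E(2) \<open>sum_mset A = 0\<close> s by simp
    then have "coeff e k = of_real (- s / 2)" by (simp add: field_simps)
    then show ?thesis using pc[of k] by (simp add: k)
  qed
  ultimately show ?thesis by (intro exI[of _ "- s / 2"]) auto
qed

section \<open>Analytic choice of the roots of hyperbolic polynomials\<close>

text \<open>The point \<open>x = 0\<close> is left out because blowing up divides by a power of
  \<open>x\<close>; \<open>hyperbolic_at_0\<close> recovers it as a limit.\<close>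

definition hyperbolic :: "(complex \<Rightarrow> complex poly) \<Rightarrow> bool" where
  "hyperbolic F \<longleftrightarrow> (\<forall>\<^sub>F x in at (0::real). \<forall>z. poly (F (of_real x)) z = 0 \<longrightarrow> z \<in> \<real>)"

lemma eventually_at_of_real:
  "\<forall>\<^sub>F z in nhds (0::complex). Pr z \<Longrightarrow> \<forall>\<^sub>F x in at (0::real). Pr (of_real x)"
  using eventually_nhds_of_real eventually_nhds_conv_at by blast

lemma hyperbolic_shift:
  assumes F: "hyperbolic F" and g: "real_germ g"
  shows "hyperbolic (\<lambda>x. pcompose (F x) [:g x, 1:])"
proof -
  have "\<forall>\<^sub>F x in at (0::real). g (of_real x) \<in> \<real>"
    using g eventually_nhds_conv_at by (auto simp: real_germ_def)
  with F show ?thesis unfolding hyperbolic_def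
  proof eventually_elim
    case (elim x)
    show ?case
    proof (intro allI impI)
      fix z assume "poly (pcompose (F (of_real x)) [:g (of_real x), 1:]) z = 0"
      then have "g (of_real x) + z \<in> \<real>" using elim(1) by (simp add: poly_pcompose)
      then show "z \<in> \<real>" using elim(2) Reals_diff by fastforce
    qed
  qed
qed

text \<open>Both one-sided rescalings \<open>x = \<plusminus>\<xi>\<^sup>D\<close>, \<open>y = \<xi>\<^sup>e z\<close> along the first edge \<open>e/D\<close> of the Newton polygon
  converge to real-rooted polynomials without subleading term. Comparing the signs of their next
  coefficients shows that the order of that coefficient is even, hence that the slope is an integer.\<close>
lemma newton_slope_integer:
  assumes F: "poly_germ F" and hyp: "hyperbolic F" and m: "coeff (F 0) m \<noteq> 0"
    and low: "\<And>i. i < m \<Longrightarrow> coeff (F 0) i = 0"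
    and sub: "\<forall>\<^sub>F x in nhds 0. coeff (F x) (m - 1) = 0"
    and I: "I = {i. i < m \<and> \<not> (\<forall>\<^sub>F x in nhds 0. coeff (F x) i = 0)}" "I \<noteq> {}"
    and u: "\<And>i. i \<in> I \<Longrightarrow> real_germ (u i)" "\<And>i. i \<in> I \<Longrightarrow> u i 0 \<noteq> 0"
      "\<And>i. i \<in> I \<Longrightarrow> \<forall>\<^sub>F x in nhds 0. coeff (F x) i = x ^ n i * u i x"
  shows "\<exists>k\<ge>1. (\<forall>i\<in>I. k * (m - i) \<le> n i) \<and> (\<exists>i\<in>I. n i = k * (m - i))"
proof -
  have finI: "finite I" unfolding I(1) by simp
  have Im: "i < m" if "i \<in> I" for i using that I(1) by simp
  have npos: "n i \<ge> 1" if i: "i \<in> I" for i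
  proof (rule ccontr)
    assume "\<not> n i \<ge> 1"
    then have "n i = 0" by simp
    then have "coeff (F 0) i = u i 0" using eventually_nhds_x_imp_x[OF u(3)[OF i]] by simp
    then show False using low[OF Im[OF i]] u(2)[OF i] by simp
  qed
  define \<sigma> where "\<sigma> i = real (n i) / real (m - i)" for i
  define i0 where "i0 = arg_min_on \<sigma> I"
  have i0: "i0 \<in> I" "\<sigma> i0 \<le> \<sigma> i" if "i \<in> I \<or> i = i0" for i
    using arg_min_if_finite[OF finI I(2), of \<sigma>] that by (auto simp: i0_def not_less)
  then have i0: "i0 \<in> I" "\<And>i. i \<in> I \<Longrightarrow> real (n i0) / real (m - i0) \<le> real (n i) / real (m - i)"
    by (auto simp: \<sigma>_def)
  define D where "D = m - i0"
  define e where "e = n i0"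
  have D: "D \<ge> 1" and e: "e \<ge> 1" using Im[OF i0(1)] npos[OF i0(1)] by (auto simp: D_def e_def)
  have slope: "e * (m - i) \<le> D * n i" if "i \<in> I" for i
  proof -
    have "real e * real (m - i) \<le> real D * real (n i)"
      using i0(2)[OF that] Im[OF that] D by (simp add: D_def e_def field_simps)
    then show ?thesis by (metis of_nat_le_iff of_nat_mult)
  qed
  obtain N0 where N0: "\<And>x. degree (F x) \<le> N0" using poly_germ_degree[OF F] by blast
  define N where "N = max N0 m"
  have N: "degree (F x) \<le> N" "m \<le> N" for x using N0[of x] by (auto simp: N_def)
  \<comment> \<open>The limits of the rescaled coefficients: \<open>s ^ n i * u i 0\<close> for
    points on the edge and 0 for points above it. The sign \<open>s\<close> tells the two sides of
    \<open>x = 0\<close> apart.\<close>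
  define w where "w s i = (if i = m then coeff (F 0) m else if i \<in> I \<and> D * n i = e * (m - i)
      then s ^ n i * u i 0 else 0)" for s :: complex and i
  define q where "q s = (\<Sum>i\<le>m. monom (w s i) i)" for s
  have cq: "coeff (q s) i = (if i \<le> m then w s i else 0)" for s i
    by (simp add: q_def coeff_sum)
  have dq: "degree (q s) = m" for s
    by (rule antisym) (auto intro!: degree_le le_degree simp: cq w_def m)
  have m1: "m - 1 \<notin> I" using sub I(1) by auto
  have mi0: "m \<ge> 2"
  proof -
    have "i0 < m" "i0 \<noteq> m - 1" using Im[OF i0(1)] m1 i0(1) by auto
    then show ?thesis by linarith
  qed
  have rr: "z \<in> \<real>" if s: "s = 1 \<or> s = -1" and z: "poly (q (of_real s)) z = 0" for s :: real and z
  proof -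
    define \<xi> where "\<xi> k = inverse (real (Suc k))" for k
    define x where "x k = s * \<xi> k ^ D" for k
    have \<xi>: "\<xi> k > 0" for k by (simp add: \<xi>_def)
    have \<xi>0: "\<xi> \<longlonglongrightarrow> 0" unfolding \<xi>_def by (rule LIMSEQ_inverse_real_of_nat)
    have \<xi>p: "(\<lambda>k. complex_of_real (\<xi> k) ^ l) \<longlonglongrightarrow> (if l = 0 then 1 else 0)" for l
      using tendsto_power[OF tendsto_of_real[OF \<xi>0, where 'a = complex], of l] by (cases l) auto
    have x0: "x \<longlonglongrightarrow> 0"
      unfolding x_def using tendsto_mult_left[OF tendsto_power[OF \<xi>0, of D], of s] D by (simp add: power_0_left)
    have xne: "x k \<noteq> 0" for k using s \<xi>[of k] by (auto simp: x_def)
    have xat: "filterlim x (at 0) sequentially"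
      using x0 xne by (auto simp: filterlim_at)
    have cx0: "(\<lambda>k. complex_of_real (x k)) \<longlonglongrightarrow> 0"
      using tendsto_of_real[OF x0, where 'a = complex] by simp
    have germ_lim: "(\<lambda>k. f (complex_of_real (x k))) \<longlonglongrightarrow> f 0" if "real_germ f" for f
      using filterlim_compose[OF real_germ_tendsto[OF that] cx0] .
    have germ_ev: "\<forall>\<^sub>F k in sequentially. Pr (complex_of_real (x k))" if "\<forall>\<^sub>F z in nhds 0. Pr z" for Pr
      using that cx0 by (auto simp: filterlim_iff)
    define p where "p k = (\<Sum>i\<le>N. monom (complex_of_real (\<xi> k) ^ (e * i) * coeff (F (of_real (x k))) i
        / complex_of_real (\<xi> k) ^ (e * m)) i)" for k
    have cp: "coeff (p k) i = (if i \<le> N then complex_of_real (\<xi> k) ^ (e * i) * coeff (F (of_real (x k))) i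
        / complex_of_real (\<xi> k) ^ (e * m) else 0)" for k i
      by (simp add: p_def coeff_sum)
    have pp: "poly (p k) z = poly (F (of_real (x k))) (of_real (\<xi> k) ^ e * z) / of_real (\<xi> k) ^ (e * m)" for k z
      unfolding poly_as_sum_le[OF N(1)] p_def poly_sum sum_divide_distrib
      by (intro sum.cong refl) (simp add: poly_monom power_mult_distrib power_mult)
    show ?thesis
    proof (rule real_rooted_limit[of p N "q (of_real s)"])
      show "degree (p k) \<le> N" for k by (intro degree_le) (auto simp: cp)
      show "degree (q (of_real s)) \<le> N" using N dq by simp
      show "degree (q (of_real s)) > 0" using dq mi0 by simp
      show "poly (q (of_real s)) z = 0" by fact
      show "\<forall>\<^sub>F k in sequentially. \<forall>z. poly (p k) z = 0 \<longrightarrow> z \<in> \<real>"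
      proof -
        have "\<forall>\<^sub>F k in sequentially. \<forall>z. poly (F (of_real (x k))) z = 0 \<longrightarrow> z \<in> \<real>"
          using hyp xat unfolding hyperbolic_def by (auto simp: filterlim_iff)
        then show ?thesis
        proof eventually_elim
          case (elim k)
          show ?case
          proof (intro allI impI)
            fix z assume "poly (p k) z = 0"
            then have "of_real (\<xi> k) ^ e * z \<in> \<real>" using elim \<xi>[of k] by (simp add: pp)
            then have "of_real (\<xi> k) ^ e * z / of_real (\<xi> k ^ e) \<in> \<real>" by (intro Reals_divide) auto
            then show "z \<in> \<real>" using \<xi>[of k] by simp
          qed
        qed
      qed
      show "(\<lambda>k. coeff (p k) i) \<longlonglongrightarrow> coeff (q (of_real s)) i" if i: "i \<le> N" for i
      proof -
        consider "i = m" | "i > m" | "i < m" "i \<notin> I" | "i \<in> I" by (cases "i \<in> I") (auto, linarith)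
        then show ?thesis
        proof cases
          case 1
          have "coeff (p k) i = coeff (F (of_real (x k))) m" for k
            using i \<xi>[of k] 1 by (simp add: cp)
          then show ?thesis using germ_lim[OF poly_germ_coeff[OF F, of m]] 1 by (simp add: cq w_def)
        next
          case 2
          have "e * i = e * (i - m) + e * m" using 2 by (simp flip: distrib_left)
          then have "coeff (p k) i = of_real (\<xi> k) ^ (e * (i - m)) * coeff (F (of_real (x k))) i" for k
            using i \<xi>[of k] by (simp add: cp power_add)
          moreover have "(\<lambda>k. of_real (\<xi> k) ^ (e * (i - m)) * coeff (F (of_real (x k))) i) \<longlonglongrightarrow> 0 * coeff (F 0) i"
            using \<xi>p[of "e * (i - m)"] e 2 by (intro tendsto_mult germ_lim poly_germ_coeff[OF F]) auto
          ultimately show ?thesis using 2 by (simp add: cq)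
        next
          case 3
          then have "\<forall>\<^sub>F k in sequentially. coeff (F (of_real (x k))) i = 0"
            using I(1) by (intro germ_ev) auto
          then have "\<forall>\<^sub>F k in sequentially. coeff (p k) i = coeff (q (of_real s)) i"
            by eventually_elim (use 3 in \<open>auto simp: cp cq w_def\<close>)
          then show ?thesis by (rule tendsto_eventually)
        next
          case 4
          then have im: "i < m" using Im by simp
          have "\<forall>\<^sub>F k in sequentially. coeff (F (of_real (x k))) i = of_real (x k) ^ n i * u i (of_real (x k))"
            using u(3)[OF 4] by (rule germ_ev)
          \<comment> \<open>By \<open>slope\<close> the truncated subtraction in the exponent is a
            genuine one, and the exponent is 0 exactly for points on the edge.\<close>
          then have ev: "\<forall>\<^sub>F k in sequentially. of_real (\<xi> k) ^ (D * n i - e * (m - i)) * (of_real s ^ n i * u i (of_real (x k))) = coeff (p k) i"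
          proof eventually_elim
            case (elim k)
            have "D * n i = (D * n i - e * (m - i)) + e * (m - i)" using slope[OF 4] by simp
            moreover have "e * m = e * (m - i) + e * i" using im by (simp flip: distrib_left)
            ultimately have *: "e * i + D * n i = (D * n i - e * (m - i)) + e * m" by linarith
            have "coeff (p k) i = of_real s ^ n i * u i (of_real (x k)) * of_real (\<xi> k) ^ (e * i + D * n i) / of_real (\<xi> k) ^ (e * m)"
              using i elim by (simp add: cp x_def power_mult_distrib power_add power_mult)
            also have "\<dots> = of_real s ^ n i * u i (of_real (x k)) * of_real (\<xi> k) ^ (D * n i - e * (m - i))"
              unfolding * power_add using \<xi>[of k] by simp
            finally show ?case by (simp add: mult_ac)
          qed
          have "(\<lambda>k. of_real (\<xi> k) ^ (D * n i - e * (m - i)) * (of_real s ^ n i * u i (of_real (x k))))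
             \<longlonglongrightarrow> (if D * n i - e * (m - i) = 0 then 1 else 0) * (of_real s ^ n i * u i 0)"
            by (intro tendsto_mult \<xi>p tendsto_const germ_lim u 4)
          moreover have "(if D * n i - e * (m - i) = 0 then 1 else 0) * (of_real s ^ n i * u i 0) = coeff (q (of_real s)) i"
            using 4 im slope[OF 4] by (auto simp: cq w_def)
          ultimately show ?thesis using Lim_transform_eventually[OF _ ev] by simp
        qed
      qed
    qed
  qed
  have sgn: "\<exists>r<0. coeff (q (of_real s)) (m - 2) = of_real r * coeff (F 0) m" if "s = 1 \<or> s = -1" for s :: real
  proof -
    have "coeff (q (of_real s)) (m - 1) = 0" using m1 mi0 by (auto simp: cq w_def)
    moreover have "coeff (q (of_real s)) i0 \<noteq> 0"
      using i0(1) Im[OF i0(1)] u(2)[OF i0(1)] that by (auto simp: cq w_def D_def e_def)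
    ultimately have "\<exists>r<0. coeff (q (of_real s)) (m - 2) = of_real r * coeff (q (of_real s)) m"
      by (intro real_rooted_coeff_sign[OF dq mi0 rr[OF that], where i = i0] Im i0(1))
    then show ?thesis by (simp add: cq w_def)
  qed
  obtain r where r: "r < 0" "coeff (q 1) (m - 2) = of_real r * coeff (F 0) m" using sgn[of 1] by auto
  obtain r' where r': "r' < 0" "coeff (q (-1)) (m - 2) = of_real r' * coeff (F 0) m" using sgn[of "-1"] by auto
  \<comment> \<open>A nonzero limit coefficient means that the point of index \<open>m - 2\<close>
    lies on the edge, whichever \<open>i0\<close> was chosen as minimiser.\<close>
  have "coeff (q 1) (m - 2) \<noteq> 0" using r m by simp
  then have I2: "m - 2 \<in> I" "D * n (m - 2) = e * 2" and c1: "coeff (q 1) (m - 2) = u (m - 2) 0"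
    using mi0 by (auto simp: cq w_def split: if_splits)
  have c2: "coeff (q (-1)) (m - 2) = (-1) ^ n (m - 2) * u (m - 2) 0"
    using I2 mi0 by (auto simp: cq w_def)
  have "even (n (m - 2))"
  proof (rule ccontr)
    assume "odd (n (m - 2))"
    then have "of_real r' * coeff (F 0) m = - (of_real r * coeff (F 0) m)" using c1 c2 r(2) r'(2) by simp
    then have "of_real r' = - complex_of_real r" using m by (metis minus_mult_left mult_cancel_right)
    then have "r' = - r" by (metis of_real_eq_iff of_real_minus)
    then show False using r r' by simp
  qed
  then obtain k where k: "n (m - 2) = 2 * k" by blast
  \<comment> \<open>The edge equation at \<open>m - 2\<close> reads
    \<open>D * (2 * k) = e * 2\<close>, so the slope \<open>e / D\<close> is the integer
    \<open>k\<close>.\<close>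
  then have ek: "e = D * k" using I2(2) by simp
  have "k \<ge> 1" using ek e by (cases k) auto
  moreover have "k * (m - i) \<le> n i" if "i \<in> I" for i
    using slope[OF that] D by (simp add: ek mult.assoc)
  moreover have "n i0 = k * (m - i0)" using ek by (simp add: e_def D_def mult.commute)
  ultimately show ?thesis using i0(1) by blast
qed

lemma pochhammer_Suc_nonzero: "pochhammer (of_nat (Suc n) :: complex) k \<noteq> 0"
  by (metis of_nat_0_neq of_nat_eq_0_iff pochhammer_of_nat pochhammer_pos less_numeral_extra(3) zero_less_Suc)

lemma hyperbolic_at_0:
  assumes F: "poly_germ F" and hyp: "hyperbolic F" and deg: "degree (F 0) > 0" and z: "poly (F 0) z = 0"
  shows "z \<in> \<real>"
proof -
  obtain N where N: "\<And>x. degree (F x) \<le> N" using poly_germ_degree[OF F] by blast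
  define x where "x k = inverse (real (Suc k))" for k
  have x0: "x \<longlonglongrightarrow> 0" unfolding x_def by (rule LIMSEQ_inverse_real_of_nat)
  have xat: "filterlim x (at 0) sequentially"
    using x0 by (auto simp: filterlim_at x_def)
  have cx0: "(\<lambda>k. complex_of_real (x k)) \<longlonglongrightarrow> 0"
    using tendsto_of_real[OF x0, where 'a = complex] by simp
  show ?thesis
  proof (rule real_rooted_limit[of "\<lambda>k. F (of_real (x k))" N "F 0"])
    show "\<forall>\<^sub>F k in sequentially. \<forall>z. poly (F (of_real (x k))) z = 0 \<longrightarrow> z \<in> \<real>"
      using hyp xat unfolding hyperbolic_def by (auto simp: filterlim_iff)
    show "(\<lambda>k. coeff (F (of_real (x k))) i) \<longlonglongrightarrow> coeff (F 0) i" for i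
      using filterlim_compose[OF real_germ_tendsto[OF poly_germ_coeff[OF F]] cx0] .
  qed (use N deg z in auto)
qed

text \<open>A shift by \<open>b\<close> lowers the sum of the roots by \<open>m * b\<close>, so it
  cannot stay 0 unless \<open>b\<close> is 0. In the proof this is the unique root of the linear
  derivative of order \<open>m - 1\<close>.\<close>

lemma subleading_shift_nonzero:
  fixes p :: "complex poly"
  assumes deg: "degree p = m" "m \<ge> 1" and c: "coeff p (m - 1) = 0" "coeff (pcompose p [:b, 1:]) (m - 1) = 0"
  shows "b = 0"
proof -
  define q where "q = (pderiv ^^ (m - 1)) p"
  have "degree q \<le> 1" using deg by (simp add: q_def degree_higher_pderiv)
  then have "poly q b = coeff q 0 + coeff q 1 * b"
    using poly_as_sum_le[of q 1 b] by simp
  moreover have "coeff q 0 = 0" using c(1) by (simp add: q_def coeff_higher_pderiv)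
  moreover have "coeff q 1 \<noteq> 0"
    unfolding q_def coeff_higher_pderiv using pochhammer_Suc_nonzero[of 1 "m - 1"] deg by auto
  moreover have "poly q b = 0" using coeff_pcompose_shift[of "m - 1" p b] c(2) by (simp add: q_def)
  ultimately show ?thesis by simp
qed

text \<open>Here \<open>m\<close> is the multiplicity of the root 0 of \<open>F 0\<close>, not a
  degree. Recentring at one root of the blown-up polynomial keeps the other roots, so the induction
  has to admit nonzero coefficients above \<open>m\<close>.\<close>

lemma analytic_root:
  assumes "poly_germ F" "hyperbolic F" "coeff (F 0) m \<noteq> 0" "\<And>i. i < m \<Longrightarrow> coeff (F 0) i = 0" "m \<ge> 1"
  shows "\<exists>g. real_germ g \<and> g 0 = 0 \<and> (\<forall>\<^sub>F x in nhds 0. poly (F x) (g x) = 0)"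
  using assms
proof (induction m arbitrary: F rule: less_induct)
  case (less m)
  note F = less.prems(1) and hyp = less.prems(2) and cm = less.prems(3) and low = less.prems(4)
    and m1 = less.prems(5)
  \<comment> \<open>Since the degree may exceed \<open>m\<close>, the Tschirnhaus shift is not an
    explicit quotient of coefficients. It is the simple root near 0 of the derivative of order
    \<open>m - 1\<close>.\<close>
  define G where "G x = (pderiv ^^ (m - 1)) (F x)" for x
  have pG: "poly_germ G" unfolding G_def by (rule poly_germ_higher_pderiv[OF F])
  have "coeff (G 0) 0 = 0" using low[of "m - 1"] m1 by (simp add: G_def coeff_higher_pderiv)
  moreover have "coeff (G 0) 1 \<noteq> 0"
    unfolding G_def coeff_higher_pderiv using pochhammer_Suc_nonzero[of 1 "m - 1"] cm m1 by auto
  ultimately obtain g where g: "real_germ g" "g 0 = 0" "\<forall>\<^sub>F x in nhds 0. poly (G x) (g x) = 0"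
    using simple_root_germ[OF pG] by blast
  define F1 where "F1 x = pcompose (F x) [:g x, 1:]" for x
  have pF1: "poly_germ F1" unfolding F1_def by (rule poly_germ_shift[OF F g(1)])
  have hF1: "hyperbolic F1" unfolding F1_def by (rule hyperbolic_shift[OF hyp g(1)])
  have F10: "F1 0 = F 0" by (simp add: F1_def g(2))
  have sub: "\<forall>\<^sub>F x in nhds 0. coeff (F1 x) (m - 1) = 0"
    using g(3)
  proof eventually_elim
    case (elim x)
    then show ?case using coeff_pcompose_shift[of "m - 1" "F x" "g x"] by (simp add: F1_def G_def)
  qed
  define I where "I = {i. i < m \<and> \<not> (\<forall>\<^sub>F x in nhds 0. coeff (F1 x) i = 0)}"
  show ?case
  proof (cases "I = {}")
    \<comment> \<open>All lower coefficients of \<open>F1\<close> vanish identically, in particular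
      the constant one, so the shift \<open>g\<close> itself is the root.\<close>
    case True
    then have "\<forall>\<^sub>F x in nhds 0. coeff (F1 x) 0 = 0" using m1 by (auto simp: I_def)
    then have "\<forall>\<^sub>F x in nhds 0. poly (F x) (g x) = 0"
      by eventually_elim (simp add: F1_def coeff_pcompose_0)
    then show ?thesis using g by blast
  next
    case False
    have "\<exists>u n. real_germ u \<and> u 0 \<noteq> 0 \<and> (\<forall>\<^sub>F x in nhds 0. coeff (F1 x) i = x ^ n * u x)" if i: "i \<in> I" for i
    proof -
      have rg: "real_germ (\<lambda>x. coeff (F1 x) i)" by (rule poly_germ_coeff[OF pF1])
      then have "(\<lambda>x. coeff (F1 x) i) analytic_on {0}" by (simp add: real_germ_def)
      then obtain n u where nu: "u analytic_on {0}" "u 0 \<noteq> 0" "\<forall>\<^sub>F x in nhds 0. coeff (F1 x) i = x ^ n * u x"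
        using analytic_germ_cases[of "\<lambda>x. coeff (F1 x) i"] i by (auto simp: I_def)
      then show ?thesis using real_germ_divide_power[OF rg nu(1,3)] by blast
    qed
    then obtain u n where un: "\<And>i. i \<in> I \<Longrightarrow> real_germ (u i)" "\<And>i. i \<in> I \<Longrightarrow> u i 0 \<noteq> 0"
      "\<And>i. i \<in> I \<Longrightarrow> \<forall>\<^sub>F x in nhds 0. coeff (F1 x) i = x ^ n i * u i x"
      by metis
    have "\<exists>k\<ge>1. (\<forall>i\<in>I. k * (m - i) \<le> n i) \<and> (\<exists>i\<in>I. n i = k * (m - i))"
      by (rule newton_slope_integer[OF pF1 hF1 _ _ sub I_def False un]) (use cm low in \<open>auto simp: F10\<close>)
    then obtain k i1 where k: "k \<ge> 1" "\<And>i. i \<in> I \<Longrightarrow> k * (m - i) \<le> n i" and i1: "i1 \<in> I" "n i1 = k * (m - i1)"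
      by blast
    have i1m: "i1 < m" using i1(1) by (simp add: I_def)
    have m1I: "m - 1 \<notin> I" using sub by (simp add: I_def)
    \<comment> \<open>The \<open>d i\<close> are the coefficients in \<open>z\<close> of F1(x, x^k
      z) / x^(k m). The defining equation is multiplied out so that it also makes sense at
      \<open>x = 0\<close>. The values at 0 record that the new polynomial has degree
      \<open>m\<close> there, no subleading term, and a further nonzero coefficient at
      \<open>i1\<close>.\<close>
    have ex_d: "\<forall>i. \<exists>d. real_germ d \<and> (\<forall>\<^sub>F x in nhds 0. x ^ (k * m) * d x = x ^ (k * i) * coeff (F1 x) i) \<and>
        (i = m \<longrightarrow> d 0 \<noteq> 0) \<and> (i > m \<longrightarrow> d 0 = 0) \<and> (i = i1 \<longrightarrow> d 0 \<noteq> 0) \<and> (i = m - 1 \<longrightarrow> d 0 = 0)" (is "\<forall>i. ?P i")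
    proof (rule allI)
      fix i
      consider "i \<ge> m" | "i < m" "i \<notin> I" | "i \<in> I" by (cases "i \<in> I") (auto simp: I_def, linarith)
      then show "?P i"
      proof cases
        case 1
        have "k * i = k * m + k * (i - m)" using 1 by (simp flip: distrib_left)
        then show ?thesis using 1 i1m k(1) cm m1
          by (intro exI[of _ "\<lambda>x. x ^ (k * (i - m)) * coeff (F1 x) i"])
             (auto simp: power_add F10 intro!: real_germ_mult real_germ_power real_germ_ident poly_germ_coeff[OF pF1])
      next
        case 2
        then have "\<forall>\<^sub>F x in nhds 0. coeff (F1 x) i = 0" by (auto simp: I_def)
        then show ?thesis using 2 i1
          by (intro exI[of _ "\<lambda>x. 0"]) (auto intro!: real_germ_const elim!: eventually_mono)
      next
        case 3
        then have im: "i < m" by (simp add: I_def)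
        have "\<forall>\<^sub>F x in nhds 0. x ^ (k * m) * (x ^ (n i - k * (m - i)) * u i x) = x ^ (k * i) * coeff (F1 x) i"
          using un(3)[OF 3]
        proof eventually_elim
          case (elim x)
          have "k * m = k * (m - i) + k * i" using im by (simp flip: distrib_left)
          then have "k * m + (n i - k * (m - i)) = k * i + n i" using k(2)[OF 3] by linarith
          then have "x ^ (k * m) * x ^ (n i - k * (m - i)) = x ^ (k * i) * x ^ n i" by (simp flip: power_add)
          then show ?case using elim by (simp flip: mult.assoc)
        qed
        then show ?thesis using 3 im m1I i1 un
          by (intro exI[of _ "\<lambda>x. x ^ (n i - k * (m - i)) * u i x"])
             (auto intro!: real_germ_mult real_germ_power real_germ_ident)
      qed
    qed
    obtain d where "\<forall>i. real_germ (d i) \<and> (\<forall>\<^sub>F x in nhds 0. x ^ (k * m) * d i x = x ^ (k * i) * coeff (F1 x) i) \<and>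
        (i = m \<longrightarrow> d i 0 \<noteq> 0) \<and> (i > m \<longrightarrow> d i 0 = 0) \<and> (i = i1 \<longrightarrow> d i 0 \<noteq> 0) \<and> (i = m - 1 \<longrightarrow> d i 0 = 0)"
      using choice[OF ex_d] by (elim exE)
    then have d: "\<And>i. real_germ (d i)"
      "\<And>i. \<forall>\<^sub>F x in nhds 0. x ^ (k * m) * d i x = x ^ (k * i) * coeff (F1 x) i"
      "d m 0 \<noteq> 0" "\<And>i. i > m \<Longrightarrow> d i 0 = 0" "d i1 0 \<noteq> 0" "d (m - 1) 0 = 0"
      by simp_all
    obtain N0 where N0: "\<And>x. degree (F1 x) \<le> N0" using poly_germ_degree[OF pF1] by blast
    define N where "N = max N0 m"
    have N: "degree (F1 x) \<le> N" "m \<le> N" for x using N0[of x] by (auto simp: N_def)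
    define F2 where "F2 x = (\<Sum>i\<le>N. monom (d i x) i)" for x
    have pF2: "poly_germ F2" unfolding F2_def by (intro poly_germ_sum poly_germ_monom d(1))
    have cF2: "coeff (F2 x) i = (if i \<le> N then d i x else 0)" for x i
      by (simp add: F2_def coeff_sum)
    have "\<forall>\<^sub>F x in nhds 0. \<forall>i\<in>{..N}. x ^ (k * m) * d i x = x ^ (k * i) * coeff (F1 x) i"
      using d(2) by (intro eventually_ball_finite) auto
    then have F21: "\<forall>\<^sub>F x in nhds 0. \<forall>z. x ^ (k * m) * poly (F2 x) z = poly (F1 x) (x ^ k * z)"
    proof eventually_elim
      case (elim x)
      show ?case
      proof
        fix z
        have "x ^ (k * m) * poly (F2 x) z = (\<Sum>i\<le>N. (x ^ (k * m) * d i x) * z ^ i)"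
          by (simp add: F2_def poly_sum poly_monom sum_distrib_left mult.assoc)
        also have "\<dots> = (\<Sum>i\<le>N. (x ^ (k * i) * coeff (F1 x) i) * z ^ i)"
          using elim by (intro sum.cong) auto
        also have "\<dots> = poly (F1 x) (x ^ k * z)"
          unfolding poly_as_sum_le[OF N(1)] by (intro sum.cong) (auto simp: power_mult power_mult_distrib)
        finally show "x ^ (k * m) * poly (F2 x) z = poly (F1 x) (x ^ k * z)" .
      qed
    qed
    have hF2: "hyperbolic F2"
    proof -
      have "\<forall>\<^sub>F x in at (0::real). x \<noteq> 0" by (simp add: eventually_at_filter)
      with hF1[unfolded hyperbolic_def] eventually_at_of_real[OF F21] show ?thesis
        unfolding hyperbolic_def
      proof eventually_elim
        case (elim x)
        show ?case
        proof (intro allI impI)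
          fix z assume "poly (F2 (of_real x)) z = 0"
          then have "of_real x ^ k * z \<in> \<real>" using elim(1) elim(2)[rule_format, of z] by simp
          then have "of_real x ^ k * z / of_real (x ^ k) \<in> \<real>" by (intro Reals_divide) auto
          then show "z \<in> \<real>" using elim(3) by simp
        qed
      qed
    qed
    have dF2: "degree (F2 0) = m"
      by (rule antisym) (auto intro!: degree_le le_degree simp: cF2 d(3,4) N(2))
    obtain c where c: "poly (F2 0) c = 0"
      using alg_closed_imp_poly_has_root[of "F2 0"] dF2 m1 by auto
    have cR: "c \<in> \<real>" by (rule hyperbolic_at_0[OF pF2 hF2 _ c]) (use dF2 m1 in auto)
    define F3 where "F3 x = pcompose (F2 x) [:c, 1:]" for x
    have pF3: "poly_germ F3" unfolding F3_def by (rule poly_germ_shift[OF pF2 real_germ_const[OF cR]])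
    have hF3: "hyperbolic F3" unfolding F3_def by (rule hyperbolic_shift[OF hF2 real_germ_const[OF cR]])
    have "degree (F3 0) = m" by (simp add: F3_def degree_pcompose dF2)
    then have c3: "coeff (F3 0) m \<noteq> 0" using m1 by (metis degree_0 leading_coeff_0_iff not_one_le_zero)
    define m' where "m' = (LEAST i. coeff (F3 0) i \<noteq> 0)"
    have m': "coeff (F3 0) m' \<noteq> 0" "m' \<le> m" "\<And>i. i < m' \<Longrightarrow> coeff (F3 0) i = 0"
      unfolding m'_def using LeastI[of "\<lambda>i. coeff (F3 0) i \<noteq> 0", OF c3] Least_le[of "\<lambda>i. coeff (F3 0) i \<noteq> 0", OF c3]
        not_less_Least by auto
    have m'1: "m' \<ge> 1"
    proof -
      have "coeff (F3 0) 0 = 0" using c by (simp add: F3_def coeff_pcompose_0)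
      then show ?thesis using m'(1) by (cases m') auto
    qed
    \<comment> \<open>If the multiplicity did not drop, all roots of \<open>F2 0\<close> would equal
      \<open>c\<close>. The missing subleading term forces \<open>c\<close> to be 0, but the
      coefficient at \<open>i1\<close> is nonzero.\<close>
    have "m' \<noteq> m"
    proof
      assume eq: "m' = m"
      have "coeff (F2 0) (m - 1) = 0" using d(6) by (simp add: cF2)
      moreover have "coeff (pcompose (F2 0) [:c, 1:]) (m - 1) = 0"
        using m'(3)[of "m - 1"] m1 eq by (simp add: F3_def)
      ultimately have "c = 0" by (rule subleading_shift_nonzero[OF dF2 m1])
      then have "coeff (F3 0) i1 \<noteq> 0" using d(5) i1m N(2) by (simp add: F3_def cF2)
      then show False using m'(3)[of i1] i1m eq by simp
    qed
    then have "m' < m" using m'(2) by simp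
    then obtain g3 where g3: "real_germ g3" "g3 0 = 0" "\<forall>\<^sub>F x in nhds 0. poly (F3 x) (g3 x) = 0"
      using less.IH[OF _ pF3 hF3 m'(1,3) m'1] by blast
    \<comment> \<open>The root found for \<open>F3\<close>, carried back through the recentring at
      \<open>c\<close>, the blow-up and the Tschirnhaus shift.\<close>
    let ?h = "\<lambda>x. g x + x ^ k * (c + g3 x)"
    have "real_germ ?h"
      by (intro real_germ_add real_germ_mult real_germ_power real_germ_ident real_germ_const g g3 cR)
    moreover have "?h 0 = 0" using k(1) g g3 by simp
    moreover have "\<forall>\<^sub>F x in nhds 0. poly (F x) (?h x) = 0"
      using g3(3) F21
    proof eventually_elim
      case (elim x)
      have "poly (F x) (?h x) = poly (F1 x) (x ^ k * (c + g3 x))" by (simp add: F1_def poly_pcompose)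
      also have "\<dots> = x ^ (k * m) * poly (F3 x) (g3 x)"
        using elim(2) by (simp add: F3_def poly_pcompose)
      finally show ?case using elim(1) by simp
    qed
    ultimately show ?thesis by blast
  qed
qed

text \<open>One analytic root is split off at a time. With \<open>F 0\<close> a pure power all roots
  start at 0, and dividing by a factor whose root also starts at 0 leaves a pure power, so the
  hypotheses pass to the quotient.\<close>

theorem rellich_factorization:
  assumes "poly_germ F" "hyperbolic F" "F 0 = monom 1 n"
    and "\<And>x. degree (F x) \<le> n" "\<And>x. coeff (F x) n = 1"
  shows "\<exists>g. (\<forall>j<n. real_germ (g j) \<and> g j 0 = 0) \<and>
    (\<forall>\<^sub>F x in nhds 0. \<forall>y. poly (F x) y = (\<Prod>j<n. y - g j x))"
  using assms
proof (induction n arbitrary: F)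
  case 0
  have "poly (F x) y = 1" for x y
    using poly_as_sum_le[OF 0(4)[of x], of y] 0(5)[of x] by simp
  then show ?case by simp
next
  case (Suc n)
  obtain g where g: "real_germ g" "g 0 = 0" "\<forall>\<^sub>F x in nhds 0. poly (F x) (g x) = 0"
    using analytic_root[OF Suc.prems(1,2), of "Suc n"] Suc.prems(3) by auto
  define G where "G x = synthetic_div (F x) (g x)" for x
  have eq: "F x = [:- g x, 1:] * G x + [:poly (F x) (g x):]" for x
    unfolding G_def by (rule synthetic_div_correct'[symmetric])
  have ev: "\<forall>\<^sub>F x in nhds 0. F x = [:- g x, 1:] * G x"
    using g(3)
  proof eventually_elim
    case (elim x)
    then show ?case by (subst eq) simp
  qed
  have dG: "degree (G x) \<le> n" for x using Suc.prems(4)[of x] by (simp add: G_def degree_synthetic_div)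
  have "coeff (F x) (Suc n) = coeff (G x) n - g x * coeff (G x) (Suc n)" for x
    by (subst eq) simp
  moreover have "coeff (G x) (Suc n) = 0" for x using dG[of x] by (simp add: coeff_eq_0)
  ultimately have cG: "coeff (G x) n = 1" for x using Suc.prems(5)[of x] by simp
  have G0: "G 0 = monom 1 n"
    using synthetic_div_unique[of "F 0" 0 "monom 1 n" 0] Suc.prems(3) by (simp add: G_def g(2) monom_Suc)
  have hG: "hyperbolic G"
    using Suc.prems(2) eventually_at_of_real[OF ev] unfolding hyperbolic_def
    by eventually_elim simp
  obtain h where h: "\<And>j. j < n \<Longrightarrow> real_germ (h j) \<and> h j 0 = 0"
    "\<forall>\<^sub>F x in nhds 0. \<forall>y. poly (G x) y = (\<Prod>j<n. y - h j x)"
    using Suc.IH[OF poly_germ_synthetic_div[OF Suc.prems(1) g(1), folded G_def] hG G0 dG cG] by blast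
  define h' where "h' = h(n := g)"
  have "\<forall>\<^sub>F x in nhds 0. \<forall>y. poly (F x) y = (\<Prod>j<Suc n. y - h' j x)"
    using ev h(2)
  proof eventually_elim
    case (elim x)
    have "(\<Prod>j<n. y - h' j x) = (\<Prod>j<n. y - h j x)" for y
      by (intro prod.cong) (auto simp: h'_def)
    then show ?case using elim by (simp add: h'_def left_diff_distrib mult.commute)
  qed
  moreover have "\<forall>j<Suc n. real_germ (h' j) \<and> h' j 0 = 0"
    using h(1) g by (auto simp: h'_def less_Suc_eq)
  ultimately show ?case by blast
qed

section \<open>Existence of the branches\<close>

lemma real_ps_rep_analytic:
  assumes "g analytic_on {0}"
  shows "real_ps_rep (\<lambda>n. (deriv ^^ n) g 0 / fact n) (\<lambda>x. g (complex_of_real x))"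
proof -
  obtain r where r: "r > 0" "g holomorphic_on ball 0 r"
    using assms by (auto simp: analytic_on_def)
  have "(\<lambda>n. x ^ n *\<^sub>R ((deriv ^^ n) g 0 / fact n)) sums g (of_real x)" if "\<bar>x\<bar> < r" for x :: real
    using holomorphic_power_series[OF r(2), of "of_real x"] that
    by (simp add: scaleR_conv_of_real mult.commute)
  then show ?thesis using r(1) by (auto simp: real_ps_rep_def)
qed

lemma real_conv_series_Re_analytic:
  assumes "g analytic_on {0}"
  shows "real_conv_series (\<lambda>x. Re (g (complex_of_real x)))"
proof -
  obtain r where r: "r > 0" "\<And>x. \<bar>x\<bar> < r \<Longrightarrow> (\<lambda>n. x ^ n *\<^sub>R ((deriv ^^ n) g 0 / fact n)) sums g (complex_of_real x)"
    using real_ps_rep_analytic[OF assms] by (auto simp: real_ps_rep_def)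
  have "(\<lambda>n. x ^ n *\<^sub>R Re ((deriv ^^ n) g 0 / fact n)) sums Re (g (complex_of_real x))" if "\<bar>x\<bar> < r" for x
    using sums_Re[OF r(2)[OF that]] by simp
  then have "real_ps_rep (\<lambda>n. Re ((deriv ^^ n) g 0 / fact n)) (\<lambda>x. Re (g (complex_of_real x)))"
    unfolding real_ps_rep_def using r(1) by (intro exI[of _ r]) simp
  then show ?thesis by (auto simp: real_conv_series_def)
qed

section \<open>Real zeros of the combination A + t B\<close>

lemma prod_less_prod:
  fixes f g :: "nat \<Rightarrow> real"
  assumes "0 < n" "\<And>i. i < n \<Longrightarrow> 0 \<le> f i" "\<And>i. i < n \<Longrightarrow> f i < g i"
  shows "(\<Prod>i<n. f i) < (\<Prod>i<n. g i)"
proof -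
  have "0 < g i" if "i < n" for i using assms(2,3)[OF that] by linarith
  then show ?thesis using assms by (intro prod_mono_strict[of 0]) (auto simp: less_imp_le)
qed

lemma norm_diff_cnj_less:
  assumes "Im z > 0" "Im w < 0"
  shows "norm (z - cnj w) < norm (z - w)"
proof -
  have "(Im z + Im w)\<^sup>2 < (Im z - Im w)\<^sup>2"
    using mult_pos_neg[OF assms] by (simp add: power2_eq_square algebra_simps)
  then show ?thesis by (simp add: cmod_def)
qed

text \<open>The two scalar coefficients are conjugate, so at a zero the two products have equal
  modulus. For \<open>z\<close> off the real axis each factor pair is strictly ordered, always in
  the same direction, because \<open>z\<close> lies on the same side as one point of each conjugate
  pair.\<close>

lemma combination_real_rooted:
  fixes zs :: "nat \<Rightarrow> complex" and t :: real
  assumes zs: "\<And>k. k < M \<Longrightarrow> Im (zs k) < 0"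
    and z: "(1 - \<i> * of_real t) * (\<Prod>k<M. z - zs k) + (1 + \<i> * of_real t) * (\<Prod>k<M. z - cnj (zs k)) = 0"
  shows "z \<in> \<real>"
proof -
  have M: "M > 0"
    using z by (cases "M = 0") (auto simp: complex_eq_iff)
  have "1 + \<i> * of_real t = cnj (1 - \<i> * of_real t)" by simp
  then have nt: "norm (1 + \<i> * of_real t) = norm (1 - \<i> * of_real t)" by (metis complex_mod_cnj)
  have "1 - \<i> * of_real t \<noteq> 0" by (simp add: complex_eq_iff)
  moreover have "norm (1 - \<i> * of_real t) * norm (\<Prod>k<M. z - zs k) = norm (1 - \<i> * of_real t) * norm (\<Prod>k<M. z - cnj (zs k))"
    using z nt by (metis add_eq_0_iff2 norm_minus_cancel norm_mult)
  ultimately have eq: "norm (\<Prod>k<M. z - zs k) = norm (\<Prod>k<M. z - cnj (zs k))" by simp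
  have "\<not> Im z > 0"
  proof
    assume "Im z > 0"
    then have "norm (\<Prod>k<M. z - cnj (zs k)) < norm (\<Prod>k<M. z - zs k)"
      unfolding prod_norm[symmetric] using M zs norm_diff_cnj_less[OF \<open>Im z > 0\<close>]
      by (intro prod_less_prod) auto
    then show False using eq by simp
  qed
  moreover have "\<not> Im z < 0"
  proof
    assume "Im z < 0"
    then have "norm (cnj z - cnj (zs k)) < norm (cnj z - zs k)" if "k < M" for k
      using zs[OF that] norm_diff_cnj_less[of "cnj z" "zs k"] by simp
    moreover have "norm (cnj z - cnj (zs k)) = norm (z - zs k)" "norm (cnj z - zs k) = norm (z - cnj (zs k))" for k
      by (metis complex_cnj_diff complex_mod_cnj, metis complex_cnj_cnj complex_cnj_diff complex_mod_cnj)
    ultimately have "norm (\<Prod>k<M. z - zs k) < norm (\<Prod>k<M. z - cnj (zs k))"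
      unfolding prod_norm[symmetric] using M by (intro prod_less_prod) auto
    then show False using eq by simp
  qed
  ultimately show ?thesis by (simp add: complex_is_Real_iff)
qed

lemma cnj_real_poly: "cnj (poly (map_poly of_real q) (cnj x)) = poly (map_poly of_real q) (x :: complex)"
  by (subst poly_cnj_real) (auto simp: coeff_map_poly)

lemma conj_Pfun:
  "conj_fun (Pfun M L q) x y = (\<Prod>j<M. y + poly (map_poly of_real (q j)) x - \<i> * x ^ (2 * L j))"
  by (simp add: conj_fun_def Pfun_def cnj_real_poly)

text \<open>Built factor by factor from (A + iB)(y + c + ie) = (A(y + c) - eB) + i(B(y + c) + eA).
  The degree information makes A + tB monic of degree \<open>M\<close> for every
  \<open>t\<close>.\<close>

lemma Pfun_split:
  "\<exists>A B. poly_germ A \<and> poly_germ B \<and>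
    (\<forall>x. degree (A x) \<le> M \<and> coeff (A x) M = 1 \<and> degree (B x) \<le> M \<and> coeff (B x) M = 0) \<and>
    (\<forall>x y. Pfun M L q x y = poly (A x) y + \<i> * poly (B x) y \<and>
      conj_fun (Pfun M L q) x y = poly (A x) y - \<i> * poly (B x) y)"
proof (induction M)
  case 0
  have "poly_germ (\<lambda>x. [:1:])" by (intro poly_germ_pCons poly_germ_0 real_germ_const) auto
  then show ?case
    by - (rule exI[of _ "\<lambda>x. [:1:]"], rule exI[of _ "\<lambda>x. 0"], auto simp: conj_fun_def Pfun_def poly_germ_0)
next
  case (Suc M)
  then obtain A B where AB: "poly_germ A" "poly_germ B"
    "\<And>x. degree (A x) \<le> M" "\<And>x. coeff (A x) M = 1" "\<And>x. degree (B x) \<le> M" "\<And>x. coeff (B x) M = 0"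
    "\<And>x y. Pfun M L q x y = poly (A x) y + \<i> * poly (B x) y"
    "\<And>x y. conj_fun (Pfun M L q) x y = poly (A x) y - \<i> * poly (B x) y"
    by blast
  define c where "c x = poly (map_poly complex_of_real (q M)) x" for x
  define e where "e x = x ^ (2 * L M)" for x :: complex
  have "poly_germ (\<lambda>x. map_poly complex_of_real (q M))"
    by (rule poly_germI[where N = "degree (map_poly complex_of_real (q M))"])
       (auto simp: coeff_map_poly intro!: real_germ_const)
  then have c: "real_germ c" unfolding c_def by (intro real_germ_poly real_germ_ident)
  have e: "real_germ e" unfolding e_def by (intro real_germ_power real_germ_ident)
  define A' where "A' x = A x * [:c x, 1:] + smult (- e x) (B x)" for x
  define B' where "B' x = B x * [:c x, 1:] + smult (e x) (A x)" for x
  have lin: "poly_germ (\<lambda>x. [:c x, 1:])" by (intro poly_germ_pCons poly_germ_0 real_germ_const c) auto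
  have dl: "degree (p * [:c x, 1:]) \<le> Suc M" if "degree p \<le> M" for p x
    using degree_mult_le[of p "[:c x, 1:]"] that by simp
  have ds: "degree (smult s p) \<le> Suc M" if "degree p \<le> M" for s and p :: "complex poly"
    using degree_smult_le[of s p] that by linarith
  have z: "coeff (A x) (Suc M) = 0" "coeff (B x) (Suc M) = 0" for x
    using AB(3,5)[of x] by (auto intro!: coeff_eq_0)
  have r1: "poly_germ A'" "poly_germ B'"
    unfolding A'_def B'_def by (intro poly_germ_add poly_germ_mult poly_germ_smult lin AB real_germ_uminus e)+
  have r2: "degree (A' x) \<le> Suc M" "degree (B' x) \<le> Suc M" for x
    unfolding A'_def B'_def by (intro degree_add_le dl ds AB)+
  have r3: "coeff (A' x) (Suc M) = 1" "coeff (B' x) (Suc M) = 0" for x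
    using AB(4,6)[of x] z[of x] by (auto simp: A'_def B'_def)
  have r4: "Pfun (Suc M) L q x y = poly (A' x) y + \<i> * poly (B' x) y" for x y
  proof -
    have "Pfun (Suc M) L q x y = Pfun M L q x y * (y + c x + \<i> * e x)"
      by (simp add: Pfun_def c_def e_def)
    then show ?thesis by (simp add: AB(7) A'_def B'_def algebra_simps)
  qed
  have r5: "conj_fun (Pfun (Suc M) L q) x y = poly (A' x) y - \<i> * poly (B' x) y" for x y
  proof -
    have "conj_fun (Pfun (Suc M) L q) x y = conj_fun (Pfun M L q) x y * (y + c x - \<i> * e x)"
      by (simp add: conj_Pfun c_def e_def)
    then show ?thesis by (simp add: AB(8) A'_def B'_def algebra_simps)
  qed
  have r6: "\<forall>x. degree (A' x) \<le> Suc M \<and> coeff (A' x) (Suc M) = 1 \<and> degree (B' x) \<le> Suc M \<and> coeff (B' x) (Suc M) = 0"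
    using r2 r3 by simp
  have r7: "\<forall>x y. Pfun (Suc M) L q x y = poly (A' x) y + \<i> * poly (B' x) y \<and>
      conj_fun (Pfun (Suc M) L q) x y = poly (A' x) y - \<i> * poly (B' x) y"
    by (intro allI conjI r4 r5)
  show ?case
    by (rule exI[of _ A'], rule exI[of _ B'], intro conjI, (rule r1 r6 r7)+)
qed

text \<open>The shape required by \<open>combination_real_rooted\<close>: for real \<open>t\<close>
  the coefficients of the function and its conjugate are conjugate numbers.\<close>

lemma combination_eq:
  "Apart F x y + of_real t * Bpart F x y =
    ((1 - \<i> * of_real t) * F x y + (1 + \<i> * of_real t) * conj_fun F x y) / 2"
proof -
  have e: "(a - b) / (2 * \<i>) = - \<i> * (a - b) / 2" for a b by (simp add: divide_simps)
  show ?thesis unfolding Apart_def Bpart_def e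
    by (simp add: algebra_simps add_divide_distrib diff_divide_distrib)
qed

definition Pzero :: "(nat \<Rightarrow> nat) \<Rightarrow> (nat \<Rightarrow> real poly) \<Rightarrow> real \<Rightarrow> nat \<Rightarrow> complex" where
  "Pzero L q x k = - of_real (poly (q k) x) - \<i> * of_real (x ^ (2 * L k))"

lemma poly_map_of_real: "poly (map_poly of_real p) (of_real x) = complex_of_real (poly p x)"
  by (induction p) (auto simp: map_poly_pCons)

lemma Pfun_of_real: "Pfun M L q (of_real x) y = (\<Prod>k<M. y - Pzero L q x k)"
  "conj_fun (Pfun M L q) (of_real x) y = (\<Prod>k<M. y - cnj (Pzero L q x k))"
  by (simp_all add: conj_Pfun Pfun_def Pzero_def poly_map_of_real algebra_simps)

text \<open>The exponent \<open>2 * L k\<close> is even, so the zeros of P(x, .) lie in the lower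
  half-plane on both sides of \<open>x = 0\<close>.\<close>

lemma Im_Pzero: "x \<noteq> 0 \<Longrightarrow> Im (Pzero L q x k) < 0"
  using zero_less_power[of "x\<^sup>2" "L k"] by (simp add: Pzero_def power_mult flip: of_real_power)

lemma exists_branches:
  assumes L: "\<forall>j<M. L j \<ge> 1" and q: "\<forall>j<M. poly (q j) 0 = 0"
  shows "\<exists>a. has_branches M (\<lambda>x y. Apart (Pfun M L q) x y + of_real t * Bpart (Pfun M L q) x y) a"
proof -
  obtain A B where AB: "poly_germ A" "poly_germ B"
    "\<And>x. degree (A x) \<le> M" "\<And>x. coeff (A x) M = 1" "\<And>x. degree (B x) \<le> M" "\<And>x. coeff (B x) M = 0"
    "\<And>x y. Pfun M L q x y = poly (A x) y + \<i> * poly (B x) y"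
    "\<And>x y. conj_fun (Pfun M L q) x y = poly (A x) y - \<i> * poly (B x) y"
    using Pfun_split[of M L q] by blast
  define F where "F x = A x + smult (of_real t) (B x)" for x
  have F: "poly (F x) y = Apart (Pfun M L q) x y + of_real t * Bpart (Pfun M L q) x y" for x y
    by (simp add: F_def Apart_def Bpart_def AB(7,8))
  have "poly_germ F" unfolding F_def by (intro poly_germ_add poly_germ_smult AB real_germ_const) auto
  moreover have "degree (F x) \<le> M" for x
    unfolding F_def by (intro degree_add_le AB order_trans[OF degree_smult_le])
  moreover have "coeff (F x) M = 1" for x by (simp add: F_def AB)
  moreover have "F 0 = monom 1 M"
  proof (rule poly_eq_poly_eq_iff[THEN iffD1], rule ext)
    fix y
    have "poly (map_poly complex_of_real (q j)) 0 = 0" "(0::complex) ^ (2 * L j) = 0" if "j < M" for j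
      using L q that poly_map_of_real[of "q j" 0] by (auto simp: power_0_left)
    then have "Pfun M L q 0 y = (\<Prod>j<M. y)" "conj_fun (Pfun M L q) 0 y = (\<Prod>j<M. y)"
      unfolding conj_Pfun Pfun_def by (intro prod.cong; simp)+
    then show "poly (F 0) y = poly (monom 1 M) y"
      by (simp add: F Apart_def Bpart_def poly_monom)
  qed
  moreover have "hyperbolic F"
  proof -
    have "\<forall>\<^sub>F x in at (0::real). x \<noteq> 0" by (simp add: eventually_at_filter)
    then show ?thesis unfolding hyperbolic_def
    proof eventually_elim
      case (elim x)
      show ?case
      proof (intro allI impI)
        fix z assume "poly (F (of_real x)) z = 0"
        then have "(1 - \<i> * of_real t) * (\<Prod>k<M. z - Pzero L q x k) + (1 + \<i> * of_real t) * (\<Prod>k<M. z - cnj (Pzero L q x k)) = 0"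
          by (simp add: F combination_eq Pfun_of_real)
        then show "z \<in> \<real>" using combination_real_rooted Im_Pzero[OF elim] by blast
      qed
    qed
  qed
  ultimately obtain g where g: "\<And>j. j < M \<Longrightarrow> real_germ (g j)" "\<And>j. j < M \<Longrightarrow> g j 0 = 0"
    "\<forall>\<^sub>F x in nhds 0. \<forall>y. poly (F x) y = (\<Prod>j<M. y - g j x)"
    using rellich_factorization[of F M] by blast
  define a where "a j x = Re (g j (complex_of_real x))" for j x
  have "real_conv_series (a j) \<and> a j 0 = 0" if "j < M" for j
    unfolding a_def using real_conv_series_Re_analytic[of "g j"] g(1,2)[OF that] by (simp add: real_germ_def)
  moreover have "\<forall>\<^sub>F x in nhds (0::real). \<forall>y::real. poly (F (of_real x)) (of_real y) = (\<Prod>j<M. of_real (y - a j x))"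
  proof -
    have "\<forall>\<^sub>F x in nhds (0::real). \<forall>j\<in>{..<M}. g j (of_real x) \<in> \<real>"
      using g(1) by (intro eventually_ball_finite) (auto simp: real_germ_def)
    with eventually_nhds_of_real[OF g(3)] show ?thesis
    proof eventually_elim
      case (elim x)
      have "g j (of_real x) = of_real (a j x)" if "j < M" for j
        using elim(2) that by (auto simp: a_def)
      then show ?case using elim(1) by (auto intro!: prod.cong)
    qed
  qed
  then have "\<exists>r>0. \<forall>x y. \<bar>x\<bar> < r \<longrightarrow> poly (F (of_real x)) (of_real y) = (\<Prod>j<M. of_real (y - a j x))"
    unfolding eventually_nhds_metric by (simp add: dist_real_def)
  ultimately have "has_branches M (\<lambda>x y. poly (F x) y) a"
    unfolding has_branches_def by simp
  then have "has_branches M (\<lambda>x y. Apart (Pfun M L q) x y + of_real t * Bpart (Pfun M L q) x y) a"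
    unfolding F .
  then show ?thesis by (rule exI[of _ a])
qed

section \<open>Orders of vanishing and Newton interpolation\<close>

text \<open>Makes \<open>ord0\<close>, which is defined through some representing series, computable
  from any single one. Real and imaginary parts of the difference are real power series vanishing on
  an interval, and a nonzero one would have isolated zeros.\<close>

lemma real_ps_rep_unique:
  fixes c d :: "nat \<Rightarrow> complex"
  assumes c: "real_ps_rep c f" and d: "real_ps_rep d g" and eq: "\<forall>\<^sub>F x in nhds 0. f x = g x"
  shows "c = d"
proof -
  obtain r1 where r1: "r1 > 0" "\<And>x. \<bar>x\<bar> < r1 \<Longrightarrow> (\<lambda>n. x ^ n *\<^sub>R c n) sums f x"
    using c by (auto simp: real_ps_rep_def)
  obtain r2 where r2: "r2 > 0" "\<And>x. \<bar>x\<bar> < r2 \<Longrightarrow> (\<lambda>n. x ^ n *\<^sub>R d n) sums g x"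
    using d by (auto simp: real_ps_rep_def)
  obtain r3 where r3: "r3 > 0" "\<And>x. \<bar>x\<bar> < r3 \<Longrightarrow> f x = g x"
    using eq unfolding eventually_nhds_metric by (auto simp: dist_real_def)
  define r where "r = min r1 (min r2 r3)"
  have r: "r > 0" using r1 r2 r3 by (simp add: r_def)
  have s: "(\<lambda>n. x ^ n *\<^sub>R (c n - d n)) sums 0" if "\<bar>x\<bar> < r" for x
    using sums_diff[OF r1(2)[of x] r2(2)[of x]] r3(2)[of x] that by (simp add: r_def scaleR_diff_right)
  have zero: "b n = 0" if b: "\<And>x. \<bar>x\<bar> < r \<Longrightarrow> (\<lambda>n. b n * x ^ n) sums 0" for b :: "nat \<Rightarrow> real" and n
  proof (rule ccontr)
    assume nz: "b n \<noteq> 0"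
    have "b 0 = 0" using b[of 0] r by simp
    then have "n > 0" using nz by (cases n) auto
    show False
    proof (rule powser_0_nonzero[of r 0 b "\<lambda>_. 0" n])
      fix s :: real assume s: "0 < s" "\<And>z::real. z \<in> cball 0 s - {0} \<Longrightarrow> (0::real) \<noteq> 0"
      then show False using s(2)[of s] by simp
    qed (use r b nz \<open>n > 0\<close> in auto)
  qed
  have "Re (c n - d n) = 0" "Im (c n - d n) = 0" for n
  proof -
    have "(\<lambda>n. Re (c n - d n) * x ^ n) sums 0" "(\<lambda>n. Im (c n - d n) * x ^ n) sums 0" if "\<bar>x\<bar> < r" for x
      using sums_Re[OF s[OF that]] sums_Im[OF s[OF that]] by (simp_all add: mult.commute)
    then show "Re (c n - d n) = 0" "Im (c n - d n) = 0"
      using zero[of "\<lambda>n. Re (c n - d n)"] zero[of "\<lambda>n. Im (c n - d n)"] by auto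
  qed
  then show ?thesis by (auto simp: complex_eq_iff)
qed

lemma ord0_cong:
  fixes f g :: "real \<Rightarrow> complex"
  assumes "\<forall>\<^sub>F x in nhds 0. f x = g x"
  shows "ord0 f = ord0 g"
proof -
  have *: "real_ps_rep c g" if rep: "real_ps_rep c f" and eq: "\<forall>\<^sub>F x in nhds 0. f x = g x" for c and f g :: "real \<Rightarrow> complex"
  proof -
    obtain r where r: "r > 0" "\<And>x. \<bar>x\<bar> < r \<Longrightarrow> (\<lambda>n. x ^ n *\<^sub>R c n) sums f x"
      using rep by (auto simp: real_ps_rep_def)
    obtain s where s: "s > 0" "\<And>x. \<bar>x\<bar> < s \<Longrightarrow> f x = g x"
      using eq unfolding eventually_nhds_metric by (auto simp: dist_real_def)
    show ?thesis unfolding real_ps_rep_def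
      by (intro exI[of _ "min r s"]) (use r s in \<open>auto simp: s(2)[symmetric]\<close>)
  qed
  have "\<forall>\<^sub>F x in nhds 0. g x = f x" using assms by eventually_elim simp
  then have "real_ps_rep c f \<longleftrightarrow> real_ps_rep c g" for c using *[of c f g] *[of c g f] assms by blast
  then show ?thesis by (simp add: ord0_def)
qed

lemma ord0_eq_enat:
  fixes f :: "real \<Rightarrow> complex"
  assumes u: "u analytic_on {0}" "u 0 \<noteq> 0" and f: "\<forall>\<^sub>F x in nhds 0. f x = of_real x ^ n * u (of_real x)"
  shows "ord0 f = enat n"
proof -
  define d where "d k = (deriv ^^ k) u 0 / fact k" for k
  define c where "c k = (if k < n then 0 else d (k - n))" for k
  obtain r where r: "r > 0" "\<And>x. \<bar>x\<bar> < r \<Longrightarrow> (\<lambda>k. x ^ k *\<^sub>R d k) sums u (of_real x)"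
    using real_ps_rep_analytic[OF u(1)] by (auto simp: real_ps_rep_def d_def)
  obtain s where s: "s > 0" "\<And>x. \<bar>x\<bar> < s \<Longrightarrow> f x = of_real x ^ n * u (of_real x)"
    using f unfolding eventually_nhds_metric by (auto simp: dist_real_def)
  have rep: "real_ps_rep c f"
    unfolding real_ps_rep_def
  proof (intro exI[of _ "min r s"] conjI allI impI)
    fix x :: real assume x: "\<bar>x\<bar> < min r s"
    have "(\<lambda>k. x ^ n *\<^sub>R (x ^ k *\<^sub>R d k)) sums (x ^ n *\<^sub>R u (of_real x))"
      using x by (intro sums_scaleR_right r) auto
    then have "(\<lambda>k. x ^ (k + n) *\<^sub>R c (k + n)) sums (x ^ n *\<^sub>R u (of_real x))"
      by (simp add: c_def power_add mult.commute)
    moreover have "x ^ n *\<^sub>R u (of_real x) = f x" using s(2)[of x] x by (simp add: scaleR_conv_of_real)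
    ultimately show "(\<lambda>k. x ^ k *\<^sub>R c k) sums f x"
      using sums_iff_shift[of "\<lambda>k. x ^ k *\<^sub>R c k" n "f x"] by (simp add: c_def)
  qed (use r(1) s(1) in auto)
  have "c n \<noteq> 0" using u(2) by (simp add: c_def d_def)
  show ?thesis
    unfolding ord0_def
  proof (rule antisym)
    show "Inf {enat n |n. \<exists>c. real_ps_rep c f \<and> c n \<noteq> 0} \<le> enat n"
      using rep \<open>c n \<noteq> 0\<close> by (intro Inf_lower) blast
    show "enat n \<le> Inf {enat n |n. \<exists>c. real_ps_rep c f \<and> c n \<noteq> 0}"
    proof (rule Inf_greatest)
      fix y assume "y \<in> {enat n |n. \<exists>c. real_ps_rep c f \<and> c n \<noteq> 0}"
      then obtain k c' where k: "y = enat k" "real_ps_rep c' f" "c' k \<noteq> 0" by blast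
      have "c' = c" by (rule real_ps_rep_unique[OF k(2) rep]) simp
      then have "\<not> k < n" using k(3) by (auto simp: c_def)
      then show "enat n \<le> y" using k(1) by simp
    qed
  qed
qed

lemma ord0_eq_infinity:
  fixes f :: "real \<Rightarrow> complex"
  assumes "\<forall>\<^sub>F x in nhds 0. f x = 0"
  shows "ord0 f = \<infinity>"
proof -
  have "real_ps_rep (\<lambda>_. 0::complex) (\<lambda>_. 0)" by (auto simp: real_ps_rep_def intro!: exI[of _ 1])
  then have "c = (\<lambda>_. 0)" if "real_ps_rep c f" for c
    using real_ps_rep_unique[OF that _ assms] by blast
  then have "{enat n |n. \<exists>c. real_ps_rep c f \<and> c n \<noteq> 0} = {}" by fastforce
  then show ?thesis by (simp only: ord0_def Inf_empty top_enat_def)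
qed

lemma analytic_extension:
  fixes a :: "real \<Rightarrow> real"
  assumes "real_conv_series a"
  shows "\<exists>g. g analytic_on {0} \<and> (\<forall>\<^sub>F x in nhds 0. g (of_real x) = of_real (a x))"
proof -
  obtain c r where r: "r > 0" "\<And>x. \<bar>x\<bar> < r \<Longrightarrow> (\<lambda>n. x ^ n *\<^sub>R c n) sums a x"
    using assms by (auto simp: real_conv_series_def real_ps_rep_def)
  define g where "g z = (\<Sum>n. complex_of_real (c n) * z ^ n)" for z
  have "(\<lambda>n. complex_of_real (c n) * (z - 0) ^ n) sums g z" if "z \<in> ball 0 r" for z
  proof -
    \<comment> \<open>A real number strictly between |z| and \<open>r\<close>; convergence there
      gives convergence at \<open>z\<close>.\<close>
    define x where "x = (norm z + r) / 2"
    have "\<bar>x\<bar> < r" "norm z < \<bar>x\<bar>" using that r(1) by (auto simp: x_def)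
    then have x: "\<bar>x\<bar> < r" "norm z < norm (complex_of_real x)" by (simp_all only: norm_of_real)
    have "(\<lambda>n. complex_of_real (x ^ n *\<^sub>R c n)) sums of_real (a x)"
      by (intro sums_of_real r x)
    then have "summable (\<lambda>n. complex_of_real (c n) * of_real x ^ n)"
      by (simp add: sums_iff mult.commute)
    from powser_inside[OF this x(2)] show ?thesis
      by (simp add: g_def summable_sums)
  qed
  then have "g holomorphic_on ball 0 r" by (rule power_series_holomorphic)
  then have "g analytic_on {0}" using r(1) by (auto simp: analytic_on_def)
  moreover have "g (of_real x) = of_real (a x)" if "\<bar>x\<bar> < r" for x
  proof -
    have "(\<lambda>n. complex_of_real (x ^ n *\<^sub>R c n)) sums of_real (a x)"
      by (intro sums_of_real r that)
    then show ?thesis by (simp add: g_def sums_iff mult.commute)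
  qed
  then have "\<forall>\<^sub>F x in nhds 0. g (of_real x) = of_real (a x)"
    unfolding eventually_nhds_metric using r(1) by (auto simp: dist_real_def)
  ultimately show ?thesis by blast
qed

text \<open>On a circle of radius between 3r/4 and \<open>r\<close> the numerator is at most 2K and
  the denominator at least r/4; the maximum principle carries the quotient inside. The circle can be
  taken arbitrarily close to the boundary, so the same \<open>r\<close> serves at each stage of the
  interpolation.\<close>

lemma divided_difference_bound:
  assumes hol: "f holomorphic_on ball 0 r" and K: "\<And>z. z \<in> ball 0 r \<Longrightarrow> norm (f z) \<le> K"
    and a: "norm a < r / 2" and y: "y \<in> ball 0 r"
  shows "norm (if y = a then deriv f a else (f y - f a) / (y - a)) \<le> 8 * K / r"
proof -
  let ?g = "\<lambda>z. if z = a then deriv f a else (f z - f a) / (z - a)"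
  have r: "r > 0" using a norm_ge_zero[of a] by linarith
  have ab: "a \<in> ball 0 r" using a r by simp
  have g: "?g holomorphic_on ball 0 r"
    using pole_lemma_open[OF hol open_ball] .
  define \<rho> where "\<rho> = (max (norm y) (3 * r / 4) + r) / 2"
  have \<rho>: "norm y < \<rho>" "3 * r / 4 < \<rho>" "\<rho> < r" using y r by (auto simp: \<rho>_def)
  show ?thesis
  proof (rule maximum_modulus_frontier[of ?g "cball 0 \<rho>"])
    show "?g holomorphic_on interior (cball 0 \<rho>)"
      using \<rho> by (intro holomorphic_on_subset[OF g]) auto
    show "continuous_on (closure (cball 0 \<rho>)) ?g"
      using \<rho> by (intro holomorphic_on_imp_continuous_on holomorphic_on_subset[OF g]) auto
    fix z :: complex assume "z \<in> frontier (cball 0 \<rho>)"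
    then have z: "norm z = \<rho>" by simp
    then have "z \<in> ball 0 r" using \<rho> by simp
    have "norm (z - a) \<ge> r / 4" using norm_triangle_ineq2[of z a] z \<rho> a by linarith
    moreover have "norm (f z - f a) \<le> 2 * K"
      using norm_triangle_ineq4[of "f z" "f a"] K[OF \<open>z \<in> ball 0 r\<close>] K[OF ab] by linarith
    moreover have "K \<ge> 0" using K[OF ab] norm_ge_zero[of "f a"] by linarith
    ultimately have "norm (f z - f a) / norm (z - a) \<le> 2 * K / (r / 4)"
      using r by (intro frac_le) auto
    moreover have "z \<noteq> a" using z \<rho> a r by auto
    ultimately show "norm (?g z) \<le> 8 * K / r" by (simp add: norm_divide)
  qed (use \<rho> in auto)
qed

text \<open>The growth condition says that |R| is at most C(1 + |y|)^(M-1), multiplied out to be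
  correct for \<open>M = 0\<close> too, where \<open>R = 0\<close>. The last condition is the bound
  on the cofactor \<open>h\<close> in f = R + h * prod(y - a_j), stated without naming
  \<open>h\<close>.\<close>

definition newton_interpolant ::
  "nat \<Rightarrow> real \<Rightarrow> real \<Rightarrow> (complex \<Rightarrow> complex) \<Rightarrow> (nat \<Rightarrow> complex) \<Rightarrow> complex poly \<Rightarrow> bool" where
  "newton_interpolant M r C f a R \<longleftrightarrow> (degree R < M \<or> R = 0) \<and> (\<forall>j<M. poly R (a j) = f (a j)) \<and>
    (\<forall>y. (1 + norm y) * norm (poly R y) \<le> C * (1 + norm y) ^ M) \<and>
    (\<forall>y\<in>ball 0 r. norm (f y - poly R y) \<le> C * (\<Prod>j<M. norm (y - a j)))"

lemma newton_interpolantD: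
  assumes "newton_interpolant M r C f a R"
  shows "degree R < M \<or> R = 0" "\<And>j. j < M \<Longrightarrow> poly R (a j) = f (a j)"
    "\<And>y. (1 + norm y) * norm (poly R y) \<le> C * (1 + norm y) ^ M"
    "\<And>y. y \<in> ball 0 r \<Longrightarrow> norm (f y - poly R y) \<le> C * (\<Prod>j<M. norm (y - a j))"
  using assms unfolding newton_interpolant_def by blast+

text \<open>\<open>C\<close> is fixed before \<open>f\<close> and the nodes, which may come
  arbitrarily close or coincide. Induction on the nodes: write f = f(\<alpha>) + (z - \<alpha>) g
  and interpolate the divided difference \<open>g\<close>, whose bound is \<open>8 * K / r\<close>,
  at the remaining ones.\<close>

lemma newton_interpolation:
  fixes r K :: real
  assumes "r > 0" "K \<ge> 0"
  shows "\<exists>C\<ge>0. \<forall>f a. f holomorphic_on ball 0 r \<longrightarrow> (\<forall>z\<in>ball 0 r. norm (f z) \<le> K) \<longrightarrow>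
    (\<forall>j<M. norm (a j) < r / 2) \<longrightarrow> (\<exists>R. newton_interpolant M r C f a R)"
  using assms(2)
proof (induction M arbitrary: K)
  case 0
  show ?case using 0 by (intro exI[of _ K]) (auto intro!: exI[of _ 0] simp: newton_interpolant_def)
next
  case (Suc M)
  have "8 * K / r \<ge> 0" using Suc.prems assms(1) by simp
  from Suc.IH[OF this] obtain C where C: "C \<ge> 0" and
    IH: "\<And>f a. \<lbrakk>f holomorphic_on ball 0 r; \<forall>z\<in>ball 0 r. norm (f z) \<le> 8 * K / r; \<forall>j<M. norm (a j) < r / 2\<rbrakk> \<Longrightarrow> \<exists>R. newton_interpolant M r C f a R"
    by (elim exE conjE) (rule that, assumption, simp)
  \<comment> \<open>The constant term of the new interpolant contributes \<open>K\<close>; the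
    factor \<open>y - \<alpha>\<close> is at most (1 + r)(1 + |y|) and multiplies a polynomial
    controlled by \<open>C\<close>.\<close>
  define C' where "C' = K + (1 + r) * C"
  have C': "C' \<ge> C" "C' \<ge> 0"
    using C Suc.prems assms(1) by (auto simp: C'_def algebra_simps add_nonneg_nonneg)
  show ?case
  proof (intro exI[of _ C'] conjI allI impI C')
    fix f :: "complex \<Rightarrow> complex" and a :: "nat \<Rightarrow> complex"
    assume f: "f holomorphic_on ball 0 r" "\<forall>z\<in>ball 0 r. norm (f z) \<le> K" and a: "\<forall>j<Suc M. norm (a j) < r / 2"
    define \<alpha> where "\<alpha> = a M"
    have \<alpha>: "norm \<alpha> < r / 2" "\<alpha> \<in> ball 0 r" using a assms(1) by (auto simp: \<alpha>_def less_Suc_eq)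
    define g where "g z = (if z = \<alpha> then deriv f \<alpha> else (f z - f \<alpha>) / (z - \<alpha>))" for z
    have fg: "f z = f \<alpha> + (z - \<alpha>) * g z" for z by (simp add: g_def)
    have g1: "g holomorphic_on ball 0 r"
      unfolding g_def by (rule pole_lemma_open[OF f(1) open_ball])
    have g2: "\<forall>z\<in>ball 0 r. norm (g z) \<le> 8 * K / r"
      unfolding g_def using divided_difference_bound[OF f(1) _ \<alpha>(1), of K] f(2) by blast
    have "\<forall>j<M. norm (a j) < r / 2" using a by simp
    from IH[OF g1 g2 this] obtain R where "newton_interpolant M r C g a R" by (elim exE)
    note R = newton_interpolantD[OF this]
    define R1 where "R1 = [:f \<alpha>:] + [:- \<alpha>, 1:] * R"
    have pR: "poly R1 y = f \<alpha> + (y - \<alpha>) * poly R y" for y by (simp add: R1_def algebra_simps)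
    have "degree R1 < Suc M"
    proof (cases "R = 0")
      case False
      then have "degree ([:- \<alpha>, 1:] * R) = Suc (degree R)" by (subst degree_mult_eq) auto
      then show ?thesis using R(1) False degree_add_le_max[of "[:f \<alpha>:]" "[:- \<alpha>, 1:] * R"] by (simp add: R1_def)
    qed (simp add: R1_def)
    moreover have "poly R1 (a j) = f (a j)" if "j < Suc M" for j
      using that R(2)[of j] fg[of "a j"] by (cases "j = M") (auto simp: pR \<alpha>_def)
    moreover have "(1 + norm y) * norm (poly R1 y) \<le> C' * (1 + norm y) ^ Suc M" for y
    proof -
      have n1: "1 \<le> (1 + norm y) ^ M" by (intro one_le_power) simp
      have "norm (poly R1 y) \<le> norm (f \<alpha>) + norm (y - \<alpha>) * norm (poly R y)"
        unfolding pR by (metis norm_mult norm_triangle_ineq)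
      then have "(1 + norm y) * norm (poly R1 y) \<le> (1 + norm y) * (norm (f \<alpha>) + norm (y - \<alpha>) * norm (poly R y))"
        by (intro mult_left_mono) auto
      also have "\<dots> = (1 + norm y) * norm (f \<alpha>) + norm (y - \<alpha>) * ((1 + norm y) * norm (poly R y))"
        by (simp add: algebra_simps)
      also have "\<dots> \<le> (1 + norm y) * (K * (1 + norm y) ^ M) + ((1 + r) * (1 + norm y)) * (C * (1 + norm y) ^ M)"
      proof -
        have "norm (f \<alpha>) \<le> K * 1" using f(2) \<alpha>(2) by simp
        also have "\<dots> \<le> K * (1 + norm y) ^ M" using n1 Suc.prems by (intro mult_left_mono) auto
        finally have e1: "norm (f \<alpha>) \<le> K * (1 + norm y) ^ M" .
        have "norm (y - \<alpha>) \<le> norm y + r" using norm_triangle_ineq4[of y \<alpha>] \<alpha>(1) assms(1) by linarith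
        also have "\<dots> \<le> (1 + r) * (1 + norm y)" using assms(1) by (simp add: algebra_simps)
        finally have e2: "norm (y - \<alpha>) \<le> (1 + r) * (1 + norm y)" .
        show ?thesis
          by (rule add_mono[OF mult_left_mono[OF e1] mult_mono[OF e2 R(3)]]) (use assms(1) in auto)
      qed
      also have "\<dots> = C' * (1 + norm y) ^ Suc M" by (simp add: C'_def algebra_simps)
      finally show ?thesis .
    qed
    moreover have "norm (f y - poly R1 y) \<le> C' * (\<Prod>j<Suc M. norm (y - a j))" if y: "y \<in> ball 0 r" for y
    proof -
      have "f y - poly R1 y = (y - \<alpha>) * (g y - poly R y)"
        unfolding pR by (subst fg) (simp add: algebra_simps)
      then have "norm (f y - poly R1 y) = norm (y - \<alpha>) * norm (g y - poly R y)" by (simp add: norm_mult)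
      also have "\<dots> \<le> norm (y - \<alpha>) * (C * (\<Prod>j<M. norm (y - a j)))"
        using R(4)[OF y] by (intro mult_left_mono) auto
      also have "\<dots> = C * (\<Prod>j<Suc M. norm (y - a j))" by (simp add: \<alpha>_def)
      also have "\<dots> \<le> C' * (\<Prod>j<Suc M. norm (y - a j))"
        using C'(1) by (intro mult_right_mono prod_nonneg) auto
      finally show ?thesis .
    qed
    ultimately show "\<exists>R. newton_interpolant (Suc M) r C' f a R"
      unfolding newton_interpolant_def
      by (intro exI[of _ R1]) blast
  qed
qed

section \<open>A quadrature formula on the real line\<close>

lemma poly_growth:
  fixes S :: "complex poly"
  assumes "degree S \<le> N"
  shows "\<exists>K\<ge>0. \<forall>z. norm (poly S z) \<le> K * (1 + norm z) ^ N"
proof (intro exI conjI allI)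
  let ?K = "\<Sum>i\<le>degree S. norm (coeff S i)"
  show "?K \<ge> 0" by (simp add: sum_nonneg)
  fix z
  have "norm (poly S z) \<le> (\<Sum>i\<le>degree S. norm (coeff S i * z ^ i))"
    unfolding poly_altdef by (rule norm_sum)
  also have "\<dots> \<le> (\<Sum>i\<le>degree S. norm (coeff S i) * (1 + norm z) ^ N)"
  proof (rule sum_mono)
    fix i assume i: "i \<in> {..degree S}"
    have "norm z ^ i \<le> (1 + norm z) ^ i" by (intro power_mono) auto
    also have "\<dots> \<le> (1 + norm z) ^ N" using i assms by (intro power_increasing) auto
    finally show "norm (coeff S i * z ^ i) \<le> norm (coeff S i) * (1 + norm z) ^ N"
      by (simp add: norm_mult norm_power mult_left_mono)
  qed
  finally show "norm (poly S z) \<le> ?K * (1 + norm z) ^ N"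
    by (simp add: sum_distrib_right)
qed

text \<open>By the triangle inequality 1 + |z| is at most (1 + |w|) + |z - w|, and the constant 1 +
  |w| is absorbed because |z - w| is at least the distance of \<open>w\<close> from the real
  axis.\<close>

lemma dist_lower_half_plane:
  fixes w :: complex
  assumes "Im w < 0"
  shows "\<exists>c>0. \<forall>z. Im z \<ge> 0 \<longrightarrow> c * (1 + norm z) \<le> norm (z - w)"
proof -
  define d where "d = - Im w"
  define k where "k = (1 + norm w) / d + 1"
  have d: "d > 0" using assms d_def by simp
  have k: "k > 0" using d by (auto simp: k_def intro!: add_nonneg_pos divide_nonneg_pos)
  have "1 / k * (1 + norm z) \<le> norm (z - w)" if z: "Im z \<ge> 0" for z
  proof -
  have dz: "d \<le> norm (z - w)"
    using abs_Im_le_cmod[of "z - w"] z by (simp add: d_def)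
  have "1 + norm z \<le> (1 + norm w) + norm (z - w)"
    using norm_triangle_ineq[of w "z - w"] by simp
  also have "(1 + norm w) \<le> (1 + norm w) / d * norm (z - w)"
  proof -
    have "(1 + norm w) * d \<le> (1 + norm w) * norm (z - w)"
      using dz by (intro mult_left_mono) auto
    then show ?thesis using d by (simp add: field_simps)
  qed
  finally have "1 + norm z \<le> k * norm (z - w)" by (simp add: k_def algebra_simps)
  then show "1 / k * (1 + norm z) \<le> norm (z - w)" using k by (simp add: field_simps)
  qed
  then show ?thesis using k by (intro exI[of _ "1 / k"]) simp
qed

lemma integrable_inverse_1_plus_square_lborel:
  "integrable lborel (\<lambda>x::real. inverse (1 + x\<^sup>2))"
  using integrable_inverse_1_plus_square by (simp add: set_integrable_def einterval_def)

lemma integral_inverse_1_plus_square: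
  "(\<integral>x. inverse (1 + x\<^sup>2) \<partial>lborel) = pi"
  using LBINT_inverse_1_plus_square
  by (simp add: interval_lebesgue_integral_def set_lebesgue_integral_def einterval_def)

lemma inverse_square_shift_le: "K \<ge> 0 \<Longrightarrow> K / (1 + \<bar>x\<bar>)\<^sup>2 \<le> K * inverse (1 + (x::real)\<^sup>2)"
  unfolding divide_inverse
  by (intro mult_left_mono le_imp_inverse_le) (auto simp: power2_eq_square algebra_simps add_pos_nonneg)

lemma integrable_quadratic_decay:
  fixes f :: "real \<Rightarrow> complex"
  assumes "continuous_on UNIV f" "K \<ge> 0" and f: "\<And>x. norm (f x) \<le> K / (1 + \<bar>x\<bar>)\<^sup>2"
  shows "integrable lborel f"
proof (rule Bochner_Integration.integrable_bound)
  show "integrable lborel (\<lambda>x. K * inverse (1 + x\<^sup>2))"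
    using integrable_inverse_1_plus_square_lborel by simp
  show "f \<in> borel_measurable lborel"
    using assms(1) by (simp add: borel_measurable_continuous_onI)
  show "AE x in lborel. norm (f x) \<le> norm (K * inverse (1 + x\<^sup>2))"
    using order_trans[OF f inverse_square_shift_le[OF assms(2)]] assms(2) by (auto simp: abs_mult)
qed

text \<open>Links the Lebesgue integral over the line with the integrals over [-n, n] that contour
  integration produces.\<close>

lemma integral_symmetric_limit:
  fixes f :: "real \<Rightarrow> complex"
  assumes f: "integrable lborel f"
  shows "(\<lambda>n. integral {- real n..real n} f) \<longlonglongrightarrow> (\<integral>x. f x \<partial>lborel)"
proof -
  have "(\<lambda>n. \<integral>x. indicator {- real n..real n} x *\<^sub>R f x \<partial>lborel) \<longlonglongrightarrow> (\<integral>x. f x \<partial>lborel)"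
  proof (rule integral_dominated_convergence)
    show "integrable lborel (\<lambda>x. norm (f x))" using f by simp
    show "AE x in lborel. (\<lambda>n. indicator {- real n..real n} x *\<^sub>R f x) \<longlonglongrightarrow> f x"
    proof (rule AE_I2, rule tendsto_eventually)
      fix x :: real
      obtain n0 where n0: "\<bar>x\<bar> \<le> real n0" using real_arch_simple by blast
      show "\<forall>\<^sub>F n in sequentially. indicator {- real n..real n} x *\<^sub>R f x = f x"
        using eventually_ge_at_top[of n0] by eventually_elim (use n0 in \<open>auto simp: indicator_def\<close>)
    qed
  qed (use f in \<open>auto simp: indicator_def\<close>)
  moreover have "(\<integral>x. indicator {- real n..real n} x *\<^sub>R f x \<partial>lborel) = integral {- real n..real n} f" for n
  proof -
    have "set_integrable lborel {- real n..real n} f"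
      unfolding set_integrable_def using f integrable_mult_indicator by (metis atLeastAtMost_borel sets_lborel)
    from set_borel_integral_eq_integral(2)[OF this] show ?thesis
      by (simp add: set_lebesgue_integral_def)
  qed
  ultimately show ?thesis by simp
qed

text \<open>Cauchy's theorem on the segment [-n, n] closed by a half circle. Quadratic decay bounds
  the arc by K pi / n.\<close>

lemma integral_upper_half_plane_eq_0:
  fixes f :: "complex \<Rightarrow> complex"
  assumes hol: "f holomorphic_on {z. Im z \<ge> 0}" and K: "K \<ge> 0"
    and bd: "\<And>z. Im z \<ge> 0 \<Longrightarrow> norm (f z) \<le> K / (1 + norm z)\<^sup>2"
  shows "integrable lborel (\<lambda>x. f (of_real x))" "(\<integral>x. f (of_real x) \<partial>lborel) = 0"
proof -
  have cont: "continuous_on UNIV (\<lambda>x. f (of_real x))"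
    by (rule continuous_on_compose2[OF holomorphic_on_imp_continuous_on[OF hol]])
       (auto intro!: continuous_intros)
  show int: "integrable lborel (\<lambda>x. f (of_real x))"
    by (rule integrable_quadratic_decay[OF cont K]) (use bd[of "of_real _"] in simp)
  have arc: "norm (integral {- real n..real n} (\<lambda>x. f (of_real x))) \<le> K * pi / real n" if n: "n > 0" for n
  proof -
    let ?l = "linepath (- of_real (real n)) (of_real (real n)) :: real \<Rightarrow> complex"
    let ?c = "part_circlepath 0 (real n) 0 pi"
    have im: "path_image ?c \<subseteq> {z. Im z \<ge> 0}"
      by (auto simp: path_image_part_circlepath' Im_exp closed_segment_eq_real_ivl sin_ge_zero)
    have "path_image ?l \<subseteq> {z. Im z \<ge> 0}"
      by (auto simp: closed_segment_def)
    then have "(f has_contour_integral 0) (?l +++ ?c)"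
      using im hol by (intro Cauchy_theorem_convex_simple[where S="{z. Im z \<ge> 0}"])
        (auto simp: convex_halfspace_Im_ge path_image_join)
    moreover have l: "f contour_integrable_on ?l"
      using \<open>path_image ?l \<subseteq> _\<close>
      by (intro contour_integrable_continuous_linepath continuous_on_subset[OF holomorphic_on_imp_continuous_on[OF hol]]) auto
    moreover have c: "f contour_integrable_on ?c"
      using im by (intro contour_integrable_continuous_part_circlepath
          continuous_on_subset[OF holomorphic_on_imp_continuous_on[OF hol]]) auto
    ultimately have "contour_integral ?l f + contour_integral ?c f = 0"
      using contour_integral_join[OF l c] by (simp add: contour_integral_unique)
    moreover have "contour_integral ?l f = integral {- real n..real n} (\<lambda>x. f (of_real x))"
      by (subst contour_integral_linepath_Reals_eq) (use n in auto)
    moreover have "norm (contour_integral ?c f) \<le> K / (real n)\<^sup>2 * real n * \<bar>pi - 0\<bar>"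
    proof (rule contour_integral_bound_part_circlepath[OF c])
      fix z assume z: "z \<in> path_image ?c"
      have "norm z = real n" using z n by (auto simp: path_image_part_circlepath' norm_mult)
      moreover have "norm (f z) \<le> K / (1 + norm z)\<^sup>2" using bd im z by auto
      moreover have "K / (1 + real n)\<^sup>2 \<le> K / (real n)\<^sup>2"
        using n K by (intro divide_left_mono power_mono) auto
      ultimately show "norm (f z) \<le> K / (real n)\<^sup>2" by auto
    qed (use K in auto)
    moreover have "K / (real n)\<^sup>2 * real n * \<bar>pi - 0\<bar> = K * pi / real n"
      using n by (simp add: power2_eq_square)
    ultimately show ?thesis
      by (metis (no_types, lifting) add_eq_0_iff2 norm_minus_cancel)
  qed
  have "(\<lambda>n. integral {- real n..real n} (\<lambda>x. f (of_real x))) \<longlonglongrightarrow> 0"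
  proof (rule Lim_null_comparison)
    show "\<forall>\<^sub>F n in sequentially. norm (integral {- real n..real n} (\<lambda>x. f (of_real x))) \<le> K * pi / real n"
      using eventually_gt_at_top[of 0] by eventually_elim (rule arc)
    show "(\<lambda>n. K * pi / real n) \<longlonglongrightarrow> 0"
      by (rule lim_const_over_n)
  qed
  then show "(\<integral>x. f (of_real x) \<partial>lborel) = 0"
    using integral_symmetric_limit[OF int] LIMSEQ_unique by blast
qed

lemma rational_decay:
  fixes S :: "complex poly" and zs :: "'i \<Rightarrow> complex"
  assumes "finite I" and zs: "\<And>k. k \<in> I \<Longrightarrow> Im (zs k) < 0" and S: "degree S + d \<le> card I"
  shows "\<exists>K\<ge>0. \<forall>z. Im z \<ge> 0 \<longrightarrow>
    norm (poly S z / (\<Prod>k\<in>I. z - zs k)) \<le> K / (1 + norm z) ^ d"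
proof -
  have "\<exists>c>0. \<forall>z. Im z \<ge> 0 \<longrightarrow> c * (1 + norm z) ^ card I \<le> norm (\<Prod>k\<in>I. z - zs k)"
    using assms(1) zs
  proof (induction I rule: finite_induct)
    case empty
    then show ?case by (auto intro!: exI[of _ 1])
  next
    case (insert i I)
    then obtain c where c: "c > 0" "\<And>z. Im z \<ge> 0 \<Longrightarrow> c * (1 + norm z) ^ card I \<le> norm (\<Prod>k\<in>I. z - zs k)"
      by auto
    obtain e where e: "e > 0" "\<And>z. Im z \<ge> 0 \<Longrightarrow> e * (1 + norm z) \<le> norm (z - zs i)"
      using dist_lower_half_plane[of "zs i"] insert.prems by blast
    show ?case
    proof (intro exI[of _ "e * c"] conjI allI impI)
      fix z :: complex assume z: "Im z \<ge> 0"
      have "(e * (1 + norm z)) * (c * (1 + norm z) ^ card I) \<le> norm (z - zs i) * norm (\<Prod>k\<in>I. z - zs k)"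
        using e c z by (intro mult_mono) auto
      then show "e * c * (1 + norm z) ^ card (insert i I) \<le> norm (\<Prod>k\<in>insert i I. z - zs k)"
        using insert.hyps by (simp add: norm_mult mult_ac)
    qed (use c(1) e(1) in simp)
  qed
  then obtain c where c: "c > 0" "\<And>z. Im z \<ge> 0 \<Longrightarrow> c * (1 + norm z) ^ card I \<le> norm (\<Prod>k\<in>I. z - zs k)"
    by auto
  obtain K where K: "K \<ge> 0" "\<And>z. norm (poly S z) \<le> K * (1 + norm z) ^ (card I - d)"
    using poly_growth[of S "card I - d"] S by (metis add_le_imp_le_diff)
  show ?thesis
  proof (intro exI[of _ "K / c"] conjI allI impI)
    fix z :: complex assume z: "Im z \<ge> 0"
    have pos: "1 + norm z > 0" by (simp add: add_pos_nonneg)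
    have "norm (poly S z / (\<Prod>k\<in>I. z - zs k)) \<le> K * (1 + norm z) ^ (card I - d) / (c * (1 + norm z) ^ card I)"
      unfolding norm_divide using K c z pos by (intro frac_le) auto
    also have "(1 + norm z) ^ card I = (1 + norm z) ^ (card I - d) * (1 + norm z) ^ d"
      using S by (simp flip: power_add)
    finally show "norm (poly S z / (\<Prod>k\<in>I. z - zs k)) \<le> K / c / (1 + norm z) ^ d"
      using pos by (simp add: field_simps)
  qed (use K(1) c(1) in simp)
qed

lemma integral_rational_lower_poles:
  fixes S :: "complex poly" and zs :: "'i \<Rightarrow> complex"
  assumes "finite I" and zs: "\<And>k. k \<in> I \<Longrightarrow> Im (zs k) < 0" and S: "degree S + 2 \<le> card I"
  shows "integrable lborel (\<lambda>x. poly S (of_real x) / (\<Prod>k\<in>I. of_real x - zs k))"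
    "(\<integral>x. poly S (of_real x) / (\<Prod>k\<in>I. of_real x - zs k) \<partial>lborel) = 0"
proof -
  have "\<exists>K\<ge>0. \<forall>z. Im z \<ge> 0 \<longrightarrow> norm (poly S z / (\<Prod>k\<in>I. z - zs k)) \<le> K / (1 + norm z)\<^sup>2"
    by (rule rational_decay) (use assms in auto)
  then obtain K where K: "K \<ge> 0" and
    bd: "\<forall>z. Im z \<ge> 0 \<longrightarrow> norm (poly S z / (\<Prod>k\<in>I. z - zs k)) \<le> K / (1 + norm z)\<^sup>2"
    by blast
  have "(\<Prod>k\<in>I. z - zs k) \<noteq> 0" if "Im z \<ge> 0" for z
    using zs assms(1) that by (force simp: prod_zero_iff)
  then have hol: "(\<lambda>z. poly S z / (\<Prod>k\<in>I. z - zs k)) holomorphic_on {z. Im z \<ge> 0}"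
    by (intro holomorphic_intros) auto
  show "integrable lborel (\<lambda>x. poly S (of_real x) / (\<Prod>k\<in>I. of_real x - zs k))"
    "(\<integral>x. poly S (of_real x) / (\<Prod>k\<in>I. of_real x - zs k) \<partial>lborel) = 0"
    by (rule integral_upper_half_plane_eq_0[OF hol K]; simp add: bd)+
qed

text \<open>This kernel is what remains in \<open>reproducing_kernel\<close> after the pole on the
  real line has been compensated; it is the source of the factor pi.\<close>

lemma integral_cauchy_shift:
  "integrable lborel (\<lambda>y. c * of_real (inverse (1 + (y - b)\<^sup>2)) :: complex)"
  "(\<integral>y. c * of_real (inverse (1 + (y - b)\<^sup>2)) \<partial>lborel) = c * of_real pi"
proof -
  have i: "integrable lborel (\<lambda>y. inverse (1 + (y - b)\<^sup>2))"
    using lborel_integrable_real_affine[OF integrable_inverse_1_plus_square_lborel, of 1 "- b"] by simp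
  then show "integrable lborel (\<lambda>y. c * of_real (inverse (1 + (y - b)\<^sup>2)) :: complex)"
    by (intro integrable_mult_right integrable_of_real)
  have "(\<integral>y. inverse (1 + (y - b)\<^sup>2) \<partial>lborel) = pi"
    using lborel_integral_real_affine[of 1 "\<lambda>y. inverse (1 + y\<^sup>2)" "- b"] integral_inverse_1_plus_square by simp
  then show "(\<integral>y. c * of_real (inverse (1 + (y - b)\<^sup>2)) \<partial>lborel) = c * of_real pi"
    by (subst integral_mult_right_zero, subst integral_complex_of_real) simp
qed

text \<open>A slice at a fixed real \<open>x\<close> off 0: \<open>zs\<close> are the zeros of P(x,
  .) and \<open>a\<close> the values of the branches, which are the zeros of A + tB.\<close>

locale stable_combination =
  fixes M :: nat and t :: real and zs :: "nat \<Rightarrow> complex" and a :: "nat \<Rightarrow> real"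
  assumes zs_lower: "\<And>k. k < M \<Longrightarrow> Im (zs k) < 0"
    and combination: "\<And>y. ((1 - \<i> * of_real t) * (\<Prod>k<M. y - zs k) +
        (1 + \<i> * of_real t) * (\<Prod>k<M. y - cnj (zs k))) / 2 = (\<Prod>k<M. y - of_real (a k))"
begin

abbreviation ra :: "nat \<Rightarrow> complex" where "ra j \<equiv> of_real (a j)"

definition P :: "complex \<Rightarrow> complex" where "P y = (\<Prod>k<M. y - zs k)"
definition Pc :: "complex \<Rightarrow> complex" where "Pc y = (\<Prod>k<M. y - cnj (zs k))"
definition B :: "complex \<Rightarrow> complex" where "B y = (P y - Pc y) / (2 * \<i>)"
text \<open>This is (A + tB) / (y - a_j), whose value at a_j is the derivative A_y + tB_y. Up to
  scalars these polynomials are both the Lagrange basis at the nodes and the reproducing kernels of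
  the de Branges space.\<close>

definition cofac :: "nat \<Rightarrow> complex poly" where "cofac j = (\<Prod>i\<in>{..<M}-{j}. [:- ra i, 1:])"

lemma poly_cofac: "poly (cofac j) y = (\<Prod>i\<in>{..<M}-{j}. y - ra i)"
  by (simp add: cofac_def poly_prod)

lemma degree_cofac: "j < M \<Longrightarrow> degree (cofac j) = M - 1"
  by (simp add: cofac_def degree_prod_eq_sum_degree)

lemma cofac_times: "j < M \<Longrightarrow> (y - ra j) * poly (cofac j) y = (\<Prod>k<M. y - ra k)"
  by (simp add: poly_cofac prod.remove[of "{..<M}" j])

lemma combination': "((1 - \<i> * of_real t) * P y + (1 + \<i> * of_real t) * Pc y) / 2 = (\<Prod>k<M. y - ra k)"
  using combination by (simp add: P_def Pc_def)

lemma Pc_real: "Pc (of_real y) = cnj (P (of_real y))"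
  by (simp add: P_def Pc_def)

lemma P_nonzero: "P (of_real y) \<noteq> 0"
proof -
  have "of_real y - zs k \<noteq> 0" if "k < M" for k
    using zs_lower[OF that] by (metis Im_complex_of_real eq_iff_diff_eq_0 less_irrefl)
  then show ?thesis by (auto simp: P_def prod_zero_iff)
qed

lemma Pc_nonzero: "Pc (of_real y) \<noteq> 0"
  by (simp add: Pc_real P_nonzero)

lemma cnj_poly_cofac: "cnj (poly (cofac j) (of_real y)) = poly (cofac j) (of_real y)"
  by (simp add: poly_cofac)

text \<open>At a zero of A + tB one has A = -tB, hence P = A + iB = (i - t)B. So \<open>B\<close>
  cannot vanish there, \<open>P\<close> having no real zero.\<close>

lemma P_at_root:
  assumes "j < M"
  shows "P (ra j) = (\<i> - of_real t) * B (ra j)"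
proof -
  have "(\<Prod>k<M. ra j - ra k) = (0::complex)"
    using assms by (auto simp: prod_zero_iff)
  then have e: "(1 - \<i> * of_real t) * P (ra j) + (1 + \<i> * of_real t) * Pc (ra j) = 0"
    using combination'[of "ra j"] by simp
  have d: "P (ra j) - Pc (ra j) = 2 * \<i> * B (ra j)"
    by (simp add: B_def)
  have "\<i> * \<i> = -1" by simp
  with e d have "2 * P (ra j) = 2 * ((\<i> - of_real t) * B (ra j))"
    by algebra
  then show ?thesis by simp
qed

lemma B_at_root_nonzero: "j < M \<Longrightarrow> B (ra j) \<noteq> 0"
  using P_at_root[of j] P_nonzero[of "a j"] by auto

lemma B_real: "B (of_real y) = of_real (Im (P (of_real y)))"
  by (simp add: B_def Pc_real complex_eq_iff)

text \<open>The function (1 + it)R/P takes the value \<open>c\<close> at a_j. Subtracting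
  \<open>c * \<i> / (y - a j + \<i>)\<close>, which has the same value there, cancels the pole of
  the quotient on the real line at the price of a pole at a_j - i. All poles are then in the lower
  half-plane and the integral is 0.\<close>

lemma half_kernel:
  fixes R :: "complex poly"
  assumes R: "degree R < M" and j: "j < M"
    and c_def: "c = poly R (ra j) / (\<i> * B (ra j))"
  shows "\<exists>h :: real \<Rightarrow> complex. integrable lborel h \<and> integral\<^sup>L lborel h = 0 \<and>
    (\<forall>y. y \<noteq> a j \<longrightarrow> h y = ((1 + \<i> * of_real t) * poly R (of_real y) / P (of_real y)
       - c * \<i> / (of_real (y - a j) + \<i>)) / of_real (y - a j))"
proof -
  define \<alpha> :: complex where "\<alpha> = ra j"
  \<comment> \<open>The numerator over the common denominator P(y)(y - \<alpha> + i). It vanishes at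
    \<open>\<alpha>\<close>, and \<open>S\<close> is \<open>N\<close> divided by that linear factor;
    with \<open>M + 1\<close> poles and degree of \<open>S\<close> below \<open>M\<close> the decay
    is quadratic.\<close>
  define N where "N = smult (1 + \<i> * of_real t) (R * [:\<i> - \<alpha>, 1:]) - smult (c * \<i>) (\<Prod>k<M. [:- zs k, 1:])"
  define S where "S = synthetic_div N \<alpha>"
  define w where "w = zs(M := \<alpha> - \<i>)"
  have polyP: "poly (\<Prod>k<M. [:- zs k, 1:]) y = P y" for y
    by (simp add: poly_prod P_def)
  \<comment> \<open>Uses i - t = i(1 + it) and \<open>P_at_root\<close>.\<close>
  have cP: "c * P \<alpha> = (1 + \<i> * of_real t) * poly R \<alpha>"
    using B_at_root_nonzero[OF j]
    by (simp add: c_def \<alpha>_def P_at_root[OF j] divide_simps) (simp add: algebra_simps)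
  have "poly N \<alpha> = 0"
    using cP by (simp add: N_def polyP algebra_simps)
  then have "N = [:- \<alpha>, 1:] * S"
    using synthetic_div_correct'[of \<alpha> N] by (simp add: S_def)
  then have NS: "poly N y = (y - \<alpha>) * poly S y" for y
    by (simp only: poly_mult) simp
  have "degree (\<Prod>k<M. [:- zs k, 1:]) \<le> M"
    using degree_prod_sum_le[of "{..<M}" "\<lambda>k. [:- zs k, 1:]"] by simp
  moreover have "degree (R * [:\<i> - \<alpha>, 1:]) \<le> M"
    using degree_mult_le[of R "[:\<i> - \<alpha>, 1:]"] R by simp
  ultimately have "degree N \<le> M"
    unfolding N_def by (intro degree_diff_le order_trans[OF degree_smult_le])
  then have dS: "degree S + 2 \<le> card {..<Suc M}"
    using j by (simp add: S_def degree_synthetic_div)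
  have w: "Im (w k) < 0" if "k \<in> {..<Suc M}" for k
    using that zs_lower by (cases "k = M") (auto simp: w_def \<alpha>_def)
  let ?h = "\<lambda>x::real. poly S (of_real x) / (\<Prod>k<Suc M. of_real x - w k)"
  have "?h y = ((1 + \<i> * of_real t) * poly R (of_real y) / P (of_real y)
       - c * \<i> / (of_real (y - a j) + \<i>)) / of_real (y - a j)" if y: "y \<noteq> a j" for y
  proof -
    have "(\<Prod>k<Suc M. of_real y - w k) = P (of_real y) * (of_real (y - a j) + \<i>)"
      by (simp add: w_def P_def \<alpha>_def algebra_simps)
    moreover have "poly S (of_real y) = poly N (of_real y) / of_real (y - a j)"
      using NS[of "of_real y"] y by (simp add: \<alpha>_def)
    moreover have "of_real (y - a j) + \<i> \<noteq> 0" by (simp add: complex_eq_iff)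
    moreover have "poly N (of_real y) = (1 + \<i> * of_real t) * poly R (of_real y) * (of_real (y - a j) + \<i>)
       - c * \<i> * P (of_real y)"
      by (simp add: N_def polyP \<alpha>_def algebra_simps)
    ultimately show ?thesis using y P_nonzero[of y]
      by (simp add: divide_simps)
  qed
  then show ?thesis
    using integral_rational_lower_poles[of "{..<Suc M}" w S, OF _ w dS] by (intro exI[of _ ?h]) auto
qed

text \<open>Substituting (T'P + T Pc)/2 for (y - a_j) times the cofactor splits the integrand into
  two halves, one over \<open>P\<close> and one over \<open>Pc\<close>. Each becomes a function with
  integral 0 after compensating its pole at a_j, and the two compensating terms add up to the Cauchy
  kernel \<open>\<i> * c / (1 + (y - a j)\<^sup>2)\<close>.\<close>

lemma reproducing_kernel:
  fixes R :: "complex poly"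
  assumes R: "degree R < M" and j: "j < M"
  shows "integrable lborel (\<lambda>y. poly R (of_real y) * poly (cofac j) (of_real y) / (P (of_real y) * Pc (of_real y)))"
    "(\<integral>y. poly R (of_real y) * poly (cofac j) (of_real y) / (P (of_real y) * Pc (of_real y)) \<partial>lborel)
      = of_real pi * poly R (ra j) / B (ra j)"
proof -
  let ?T = "1 + \<i> * of_real t" and ?T' = "1 - \<i> * of_real t"
  define c where "c = poly R (ra j) / (\<i> * B (ra j))"
  \<comment> \<open>The half over \<open>Pc\<close> has its poles in the upper half-plane. On the
    real line it is the conjugate of the half over \<open>P\<close> for the polynomial with
    conjugate coefficients.\<close>
  define R' where "R' = map_poly cnj R"
  have R': "poly R' (of_real y) = cnj (poly R (of_real y))" for y
    using poly_cnj[of R "of_real y"] by (simp add: R'_def)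
  have dR': "degree R' < M" using R by (simp add: R'_def degree_map_poly)
  obtain h where h: "integrable lborel h" "integral\<^sup>L lborel h = 0"
    "\<forall>y. y \<noteq> a j \<longrightarrow> h y = (?T * poly R (of_real y) / P (of_real y)
       - c * \<i> / (of_real (y - a j) + \<i>)) / of_real (y - a j)"
    using half_kernel[OF R j c_def] by (elim exE conjE)
  define d where "d = poly R' (ra j) / (\<i> * B (ra j))"
  obtain g where g: "integrable lborel g" "integral\<^sup>L lborel g = 0"
    "\<forall>y. y \<noteq> a j \<longrightarrow> g y = (?T * poly R' (of_real y) / P (of_real y)
       - d * \<i> / (of_real (y - a j) + \<i>)) / of_real (y - a j)"
    using half_kernel[OF dR' j d_def] by (elim exE conjE)
  have "cnj d = - c"
    by (simp add: c_def d_def R' B_real)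
  then have g': "cnj (g y) = (?T' * poly R (of_real y) / Pc (of_real y)
       - c * \<i> / (of_real (y - a j) - \<i>)) / of_real (y - a j)" if "y \<noteq> a j" for y
    using g(3) that by (simp add: R' Pc_real)
  let ?G = "\<lambda>y. poly R (of_real y) * poly (cofac j) (of_real y) / (P (of_real y) * Pc (of_real y))"
  let ?F = "\<lambda>y. 1/2 * (h y + cnj (g y)) + (\<i> * c) * of_real (inverse (1 + (y - a j)\<^sup>2))"
  have eq: "?G y = ?F y" if y: "y \<noteq> a j" for y
  proof -
    define w where "w = complex_of_real (y - a j)"
    have w: "w \<noteq> 0" "w + \<i> \<noteq> 0" "w - \<i> \<noteq> 0" "1 + w\<^sup>2 \<noteq> 0"
      using y by (auto simp: w_def complex_eq_iff power2_eq_square add_nonneg_eq_0_iff)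
    have k: "poly (cofac j) (of_real y) = (?T' * P (of_real y) + ?T * Pc (of_real y)) / 2 / w"
      using cofac_times[OF j, of "of_real y"] combination'[of "of_real y"] w(1)
      by (simp add: w_def field_simps)
    have "c * \<i> / (w + \<i>) + c * \<i> / (w - \<i>) = 2 * c * \<i> * w / (1 + w\<^sup>2)"
      using w by (simp add: divide_simps) (simp add: algebra_simps power2_eq_square)
    then have "(c * \<i> / (w + \<i>) + c * \<i> / (w - \<i>)) / w / 2 = 2 * c * \<i> * w / (1 + w\<^sup>2) / w / 2"
      by (simp only:)
    also have "\<dots> = \<i> * c * inverse (1 + w\<^sup>2)"
    proof -
      have "2 * c * \<i> * w / v / w / 2 = \<i> * c * inverse v" if "v \<noteq> 0" for v
        using w(1) that by (simp add: field_simps)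
      then show ?thesis using w(4) by blast
    qed
    finally have "(c * \<i> / (w + \<i>) + c * \<i> / (w - \<i>)) / w / 2 = \<i> * c * inverse (1 + w\<^sup>2)" .
    then have s: "1/2 * (c * \<i> / (w + \<i>) / w + c * \<i> / (w - \<i>) / w) = \<i> * c * inverse (1 + w\<^sup>2)"
      by (simp only: add_divide_distrib[symmetric]) (simp add: mult.commute[of 2 w])
    have "?G y = 1/2 * (?T * poly R (of_real y) / P (of_real y) / w + ?T' * poly R (of_real y) / Pc (of_real y) / w)"
      unfolding k using w(1) P_nonzero[of y] Pc_nonzero[of y] by (simp add: field_simps)
    also have "\<dots> = 1/2 * ((?T * poly R (of_real y) / P (of_real y) - c * \<i> / (w + \<i>)) / w
        + (?T' * poly R (of_real y) / Pc (of_real y) - c * \<i> / (w - \<i>)) / w)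
        + 1/2 * (c * \<i> / (w + \<i>) / w + c * \<i> / (w - \<i>) / w)"
      by (simp add: diff_divide_distrib add_divide_distrib ring_distribs)
    also have "\<dots> = ?F y"
      unfolding s h(3)[rule_format, OF y] g'[OF y] by (simp add: w_def)
    finally show ?thesis .
  qed
  \<comment> \<open>\<open>h\<close> and \<open>g\<close> are specified only off the removable
    singularity at \<open>a j\<close>, which is a null set.\<close>
  have ae: "AE y in lborel. ?F y = ?G y"
    using AE_lborel_singleton[of "a j"] by eventually_elim (use eq in auto)
  have contG: "continuous_on UNIV ?G"
    unfolding P_def Pc_def using P_nonzero Pc_nonzero
    by (intro continuous_intros) (simp add: P_def Pc_def)
  then have mG: "?G \<in> borel_measurable lborel" by (simp add: borel_measurable_continuous_onI)
  have iF: "integrable lborel ?F"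
    by (intro Bochner_Integration.integrable_add integrable_mult_right integral_cauchy_shift(1) h integrable_cnj g)
  have vF: "integral\<^sup>L lborel ?F = \<i> * c * of_real pi"
    using h g integral_cauchy_shift[of "\<i> * c" "a j"]
    by (simp del: of_real_inverse)
  show "integrable lborel ?G"
    using integrable_cong_AE_imp[OF iF mG] ae by (simp add: eq_commute)
  have "integral\<^sup>L lborel ?G = integral\<^sup>L lborel ?F"
    using ae by (intro integral_cong_AE mG borel_measurable_integrable[OF iF]) (auto elim: AE_mp)
  also have "\<dots> = of_real pi * poly R (ra j) / B (ra j)"
    unfolding vF by (simp add: c_def)
  finally show "integral\<^sup>L lborel ?G = of_real pi * poly R (ra j) / B (ra j)" .
qed

text \<open>Taking \<open>R\<close> to be the cofactor itself turns the integrand of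
  \<open>reproducing_kernel\<close> into |cofac/P|^2. This has a positive integral because a
  polynomial with finitely many zeros is not almost everywhere 0.\<close>

lemma cofac_over_B_pos:
  assumes j: "j < M"
  obtains r where "r > 0" "poly (cofac j) (ra j) = of_real r * B (ra j)"
proof -
  let ?k = "\<lambda>y::real. poly (cofac j) (of_real y)"
  let ?f = "\<lambda>y::real. (norm (?k y) / norm (P (of_real y)))\<^sup>2"
  have d: "degree (cofac j) < M" using j degree_cofac by simp
  have eq: "?k y * ?k y / (P (of_real y) * Pc (of_real y)) = of_real (?f y)" for y
  proof -
    have "?k y * ?k y = of_real ((norm (?k y))\<^sup>2)"
      using complex_norm_square[of "?k y"] by (simp add: cnj_poly_cofac)
    moreover have "P (of_real y) * Pc (of_real y) = of_real ((norm (P (of_real y)))\<^sup>2)"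
      using complex_norm_square[of "P (of_real y)"] by (simp add: Pc_real)
    ultimately show ?thesis by (simp add: power_divide)
  qed
  note rk = reproducing_kernel[OF d j, unfolded eq]
  have int: "integrable lborel ?f" using rk(1) by (simp only: complex_of_real_integrable_eq)
  have val: "of_real (\<integral>y. ?f y \<partial>lborel) = of_real pi * ?k (a j) / B (ra j)"
    using rk(2) by (simp only: integral_complex_of_real)
  have "(\<integral>y. ?f y \<partial>lborel) \<noteq> 0"
  proof
    assume "(\<integral>y. ?f y \<partial>lborel) = 0"
    then have "AE y in lborel. ?f y = 0"
      using integral_nonneg_eq_0_iff_AE[OF int] by simp
    then have "AE y in lborel. y \<in> a ` {..<M}"
    proof eventually_elim
      case (elim y)
      then have "?k y = 0" using P_nonzero by simp
      then show ?case by (auto simp: poly_cofac prod_zero_iff)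
    qed
    moreover have "AE y in lborel. y \<notin> a ` {..<M}"
      by (rule AE_not_in) (simp add: finite_imp_null_set_lborel)
    ultimately have "AE y in (lborel::real measure). False" by eventually_elim simp
    then show False by (simp add: trivial_limit_def[symmetric] ae_filter_eq_bot_iff)
  qed
  then have "(\<integral>y. ?f y \<partial>lborel) > 0"
    using Bochner_Integration.integral_nonneg[of lborel ?f] by (simp add: less_le)
  then show ?thesis
    using val B_at_root_nonzero[OF j]
    by (intro that[of "(\<integral>y. ?f y \<partial>lborel) / pi"]) (simp_all add: field_simps)
qed

text \<open>At a repeated root the cofactor would vanish, but it is a positive multiple of the
  nonzero number B(a_j).\<close>

lemma roots_distinct: "inj_on a {..<M}"
proof (rule inj_onI, rule ccontr)
  fix i j assume ij: "i \<in> {..<M}" "j \<in> {..<M}" "a i = a j" "i \<noteq> j"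
  then have j: "j < M" by simp
  obtain r where "r > 0" "poly (cofac j) (ra j) = of_real r * B (ra j)"
    using cofac_over_B_pos[OF j] by blast
  then have "poly (cofac j) (ra j) \<noteq> 0" using B_at_root_nonzero[OF j] by simp
  moreover have "poly (cofac j) (ra j) = 0"
    using ij by (auto simp: poly_cofac prod_zero_iff intro!: bexI[of _ i])
  ultimately show False by simp
qed

text \<open>The value of B(A_y + tB_y) at the root a_j; \<open>Re\<close> only changes the type,
  since this number is real.\<close>

definition weight :: "nat \<Rightarrow> real" where
  "weight j = Re (B (ra j) * poly (cofac j) (ra j))"

lemma weight:
  assumes j: "j < M"
  shows "weight j > 0" "B (ra j) * poly (cofac j) (ra j) = of_real (weight j)"
proof -
  obtain r where r: "r > 0" "poly (cofac j) (ra j) = of_real r * B (ra j)"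
    using cofac_over_B_pos[OF j] by blast
  define b where "b = Im (P (ra j))"
  have b: "B (ra j) = of_real b" by (simp add: b_def B_real)
  then have "b \<noteq> 0" using B_at_root_nonzero[OF j] by auto
  have w: "weight j = b * (r * b)" by (simp add: weight_def r b)
  show "weight j > 0" using w r(1) \<open>b \<noteq> 0\<close> by (auto simp: zero_less_mult_iff mult_less_0_iff)
  show "B (ra j) * poly (cofac j) (ra j) = of_real (weight j)"
    by (simp add: w r b)
qed

lemma lagrange_interpolation:
  fixes R :: "complex poly"
  assumes R: "degree R < M"
  shows "poly R y = (\<Sum>j<M. poly R (ra j) / poly (cofac j) (ra j) * poly (cofac j) y)"
proof -
  define R' where "R' = (\<Sum>j<M. smult (poly R (ra j) / poly (cofac j) (ra j)) (cofac j))"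
  have off: "poly (cofac j) (ra i) = 0" if "i < M" "i \<noteq> j" for i j
    using that by (auto simp: poly_cofac prod_zero_iff intro!: bexI[of _ i])
  have on: "poly (cofac j) (ra j) \<noteq> 0" if "j < M" for j
    using weight[OF that] by auto
  have "R = R'"
  proof (rule poly_eqI_degree[where A = "(\<lambda>j. ra j) ` {..<M}"])
    have "card ((\<lambda>j. ra j) ` {..<M}) = M"
      using roots_distinct by (subst card_image) (auto simp: inj_on_def)
    then show "degree R < card ((\<lambda>j. ra j) ` {..<M})"
      "degree R' < card ((\<lambda>j. ra j) ` {..<M})"
      using R unfolding R'_def
      by (auto intro!: degree_sum_less degree_smult_le[THEN le_less_trans] simp: degree_cofac)
  next
    fix x assume "x \<in> (\<lambda>j. ra j) ` {..<M}"
    then obtain i where i: "i < M" "x = ra i" by auto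
    have "poly R' x = (\<Sum>j<M. if j = i then poly R (ra i) else 0)"
      unfolding R'_def poly_sum i(2) using off[OF i(1)] on by (intro sum.cong) auto
    then show "poly R x = poly R' x" using i by simp
  qed
  then have "poly R y = poly R' y" by simp
  then show ?thesis by (simp add: R'_def poly_sum)
qed

text \<open>On the real line |R/P|^2 is R times its conjugate over \<open>P * Pc\<close>. Expanding
  the conjugate in the Lagrange basis leaves integrals given by \<open>reproducing_kernel\<close>.
  The case \<open>R = 0\<close> covers \<open>M = 0\<close>.\<close>

lemma quadrature:
  fixes R :: "complex poly"
  assumes "degree R < M \<or> R = 0"
  shows "integrable lborel (\<lambda>y. (norm (poly R (of_real y) / P (of_real y)))\<^sup>2)"
    "(\<integral>y. (norm (poly R (of_real y) / P (of_real y)))\<^sup>2 \<partial>lborel)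
      = pi * (\<Sum>j<M. (norm (poly R (ra j)))\<^sup>2 / weight j)"
proof -
  let ?f = "\<lambda>y. (norm (poly R (of_real y) / P (of_real y)))\<^sup>2"
  let ?c = "\<lambda>j. poly R (ra j) / poly (cofac j) (ra j)"
  have "integrable lborel ?f \<and> integral\<^sup>L lborel ?f = pi * (\<Sum>j<M. (norm (poly R (ra j)))\<^sup>2 / weight j)"
  proof (cases "R = 0")
    case False
    with assms have R: "degree R < M" by simp
    let ?G = "\<lambda>j y. cnj (?c j) * (poly R (of_real y) * poly (cofac j) (of_real y) / (P (of_real y) * Pc (of_real y)))"
    have eq: "complex_of_real (?f y) = (\<Sum>j<M. ?G j y)" for y
    proof -
      have "complex_of_real (?f y) = poly R (of_real y) * cnj (poly R (of_real y)) / (P (of_real y) * Pc (of_real y))"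
        by (simp add: norm_divide power_divide Pc_real flip: complex_norm_square of_real_power)
      also have "cnj (poly R (of_real y)) = (\<Sum>j<M. cnj (?c j) * poly (cofac j) (of_real y))"
        by (subst lagrange_interpolation[OF R]) (simp add: cnj_poly_cofac)
      finally show ?thesis
        by (simp add: sum_distrib_left sum_divide_distrib mult_ac)
    qed
    have i: "integrable lborel (\<lambda>y. \<Sum>j<M. ?G j y)"
      by (intro Bochner_Integration.integrable_sum integrable_mult_right reproducing_kernel(1) R) auto
    then have int: "integrable lborel ?f"
      unfolding eq[symmetric] complex_of_real_integrable_eq .
    have "complex_of_real (integral\<^sup>L lborel ?f) = (\<integral>y. (\<Sum>j<M. ?G j y) \<partial>lborel)"
      unfolding eq[symmetric] by (simp only: integral_complex_of_real)
    also have "\<dots> = (\<Sum>j<M. \<integral>y. ?G j y \<partial>lborel)"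
      by (intro Bochner_Integration.integral_sum integrable_mult_right reproducing_kernel(1) R) auto
    also have "\<dots> = (\<Sum>j<M. cnj (?c j) * (of_real pi * poly R (ra j) / B (ra j)))"
      using reproducing_kernel(2)[OF R] by (intro sum.cong refl) (simp only: integral_mult_right_zero lessThan_iff)
    also have "\<dots> = (\<Sum>j<M. of_real (pi * ((norm (poly R (ra j)))\<^sup>2 / weight j)))"
    proof (rule sum.cong[OF refl])
      fix j assume "j \<in> {..<M}"
      then have j: "j < M" by simp
      have "cnj (?c j) * (of_real pi * poly R (ra j) / B (ra j))
        = of_real pi * (poly R (ra j) * cnj (poly R (ra j))) / (B (ra j) * poly (cofac j) (ra j))"
        by (simp add: cnj_poly_cofac mult_ac)
      also have "\<dots> = of_real (pi * ((norm (poly R (ra j)))\<^sup>2 / weight j))"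
        unfolding weight(2)[OF j] complex_norm_square[symmetric] by simp
      finally show "cnj (?c j) * (of_real pi * poly R (ra j) / B (ra j))
        = of_real (pi * ((norm (poly R (ra j)))\<^sup>2 / weight j))" .
    qed
    finally have "complex_of_real (integral\<^sup>L lborel ?f)
        = of_real (\<Sum>j<M. pi * ((norm (poly R (ra j)))\<^sup>2 / weight j))"
      by (simp only: of_real_sum)
    then show ?thesis using int by (simp only: of_real_eq_iff sum_distrib_left)
  qed simp
  then show "integrable lborel ?f" "integral\<^sup>L lborel ?f = pi * (\<Sum>j<M. (norm (poly R (ra j)))\<^sup>2 / weight j)"
    by auto
qed

end

section \<open>Slice estimates\<close>

text \<open>Absolute convergence at (\<rho>, \<rho>) dominates the series on the closed bidisc.
  Holomorphy is stated for composition with any pair of holomorphic functions, since two kinds are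
  used: slices, with constant first component, and branches z -> (z, g z).\<close>

lemma conv_ps2_local:
  assumes "conv_ps2 Q"
  shows "\<exists>\<rho>>0. continuous_on (cball 0 \<rho> \<times> cball 0 \<rho>) (\<lambda>v. Q (fst v) (snd v)) \<and>
    (\<forall>g h s. continuous_on (cball 0 s) g \<longrightarrow> g holomorphic_on ball 0 s \<longrightarrow>
       continuous_on (cball 0 s) h \<longrightarrow> h holomorphic_on ball 0 s \<longrightarrow>
       g ` cball 0 s \<subseteq> cball 0 \<rho> \<longrightarrow> h ` cball 0 s \<subseteq> cball 0 \<rho> \<longrightarrow>
       (\<lambda>z. Q (g z) (h z)) holomorphic_on ball 0 s)"
proof -
  obtain r c where r: "r > 0" and
    hs: "\<And>x y. norm x < r \<Longrightarrow> norm y < r \<Longrightarrow> ((\<lambda>(m, n). c m n * x ^ m * y ^ n) has_sum Q x y) UNIV"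
    using assms by (auto simp: conv_ps2_def)
  define \<rho> where "\<rho> = r / 2"
  have \<rho>: "\<rho> > 0" "\<rho> < r" using r by (auto simp: \<rho>_def)
  define Y where "Y = cball (0::complex) \<rho> \<times> cball (0::complex) \<rho>"
  define S where "S X v = (\<Sum>(m, n)\<in>X. c m n * fst v ^ m * snd v ^ n)" for X and v :: "complex \<times> complex"
  have "(\<lambda>(m, n). c m n * of_real \<rho> ^ m * of_real \<rho> ^ n) summable_on UNIV"
    using hs[of "of_real \<rho>" "of_real \<rho>"] \<rho> by (auto simp: summable_on_def)
  then have "(\<lambda>k. norm ((\<lambda>(m, n). c m n * of_real \<rho> ^ m * of_real \<rho> ^ n) k)) summable_on UNIV"
    by (simp add: summable_on_iff_abs_summable_on_complex)
  then have sm: "(\<lambda>(m, n). norm (c m n) * \<rho> ^ m * \<rho> ^ n) summable_on UNIV"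
    using \<rho>(1) by (simp add: case_prod_unfold norm_mult norm_power)
  have ul: "uniform_limit Y S (\<lambda>v. Q (fst v) (snd v)) (finite_subsets_at_top UNIV)"
    unfolding S_def
  proof (rule Weierstrass_m_test_general'[where M = "\<lambda>(m, n). norm (c m n) * \<rho> ^ m * \<rho> ^ n"
        and f = "\<lambda>k v. case k of (m, n) \<Rightarrow> c m n * fst v ^ m * snd v ^ n"])
    fix k v assume "v \<in> Y"
    then have "norm (fst v) \<le> \<rho>" "norm (snd v) \<le> \<rho>" by (auto simp: Y_def)
    then show "norm (case k of (m, n) \<Rightarrow> c m n * fst v ^ m * snd v ^ n) \<le> (case k of (m, n) \<Rightarrow> norm (c m n) * \<rho> ^ m * \<rho> ^ n)"
      using \<rho>(1) by (auto simp: norm_mult norm_power split: prod.split intro!: mult_mono power_mono)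
  next
    fix v assume "v \<in> Y"
    then show "((\<lambda>k. case k of (m, n) \<Rightarrow> c m n * fst v ^ m * snd v ^ n) has_sum Q (fst v) (snd v)) UNIV"
      using hs[of "fst v" "snd v"] \<rho> by (auto simp: Y_def)
  qed (rule sm)
  have nb: "finite_subsets_at_top (UNIV :: (nat \<times> nat) set) \<noteq> bot"
    by (rule finite_subsets_at_top_neq_bot)
  have cS: "continuous_on A (S X)" for X A
    unfolding S_def by (auto intro!: continuous_intros simp: case_prod_unfold)
  have c: "continuous_on Y (\<lambda>v. Q (fst v) (snd v))"
    by (rule uniform_limit_theorem[OF _ ul nb]) (simp add: cS)
  have hol: "(\<lambda>z. Q (g z) (h z)) holomorphic_on ball 0 s"
    if gh: "continuous_on (cball 0 s) g" "g holomorphic_on ball 0 s"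
      "continuous_on (cball 0 s) h" "h holomorphic_on ball 0 s"
      "g ` cball 0 s \<subseteq> cball 0 \<rho>" "h ` cball 0 s \<subseteq> cball 0 \<rho>" for g h s
  proof -
    have "uniform_limit (cball 0 s) (\<lambda>X z. S X (g z, h z)) (\<lambda>z. Q (fst (g z, h z)) (snd (g z, h z)))
        (finite_subsets_at_top UNIV)"
      by (rule uniform_limit_compose'[OF ul]) (use gh(5,6) in \<open>auto simp: Y_def\<close>)
    then have ul': "uniform_limit (cball 0 s) (\<lambda>X z. S X (g z, h z)) (\<lambda>z. Q (g z) (h z)) (finite_subsets_at_top UNIV)"
      by simp
    have hc: "continuous_on (cball 0 s) (\<lambda>z. S X (g z, h z)) \<and> (\<lambda>z. S X (g z, h z)) holomorphic_on ball 0 s" for X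
      unfolding S_def using gh by (auto intro!: continuous_intros holomorphic_intros simp: case_prod_unfold)
    show ?thesis
      by (rule holomorphic_uniform_limit[OF always_eventually[OF allI[OF hc]] ul' nb])
  qed
  show ?thesis
    by (intro exI[of _ \<rho>] conjI allI impI \<rho>(1) c[unfolded Y_def] hol)
qed

text \<open>If the orders are \<open>k\<close> and \<open>n\<close>, the ratio is |x|^(2k-n) times a
  function with a positive limit. The exponent is an integer, so when the order inequality fails it
  is at most -1. An identically zero \<open>v\<close> has infinite order and always satisfies
  it.\<close>

lemma germ_ratio_bounded:
  assumes v: "v analytic_on {0}" and w: "w analytic_on {0}"
    and nz: "\<forall>\<^sub>F x in at (0::real). w (of_real x) \<noteq> 0"
  shows "ord0 (\<lambda>x. w (of_real x)) \<le> 2 * ord0 (\<lambda>x. v (of_real x)) \<Longrightarrow>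
      \<exists>K. \<forall>\<^sub>F x in at (0::real). (norm (v (of_real x)))\<^sup>2 / norm (w (of_real x)) \<le> K"
    and "\<not> ord0 (\<lambda>x. w (of_real x)) \<le> 2 * ord0 (\<lambda>x. v (of_real x)) \<Longrightarrow>
      \<exists>c>0. \<forall>\<^sub>F x in at (0::real). c / \<bar>x\<bar> \<le> (norm (v (of_real x)))\<^sup>2 / norm (w (of_real x))"
proof -
  have "\<not> (\<forall>\<^sub>F x in nhds 0. w x = 0)"
  proof
    assume "\<forall>\<^sub>F x in nhds 0. w x = 0"
    from eventually_at_of_real[OF this] nz have "\<forall>\<^sub>F x in at (0::real). False" by eventually_elim simp
    then show False by (simp add: eventually_False)
  qed
  then obtain n u where u: "u analytic_on {0}" "u 0 \<noteq> 0" "\<forall>\<^sub>F x in nhds 0. w x = x ^ n * u x"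
    using analytic_germ_cases[OF w] by blast
  have ow: "ord0 (\<lambda>x. w (of_real x)) = enat n"
    by (rule ord0_eq_enat[OF u(1,2)]) (rule eventually_nhds_of_real[OF u(3)])
  have ew: "\<forall>\<^sub>F x in at (0::real). w (of_real x) = of_real x ^ n * u (of_real x)"
    by (rule eventually_at_of_real[OF u(3)])
  have lim: "((\<lambda>x::real. f (of_real x)) \<longlongrightarrow> f 0) (at 0)" if "f analytic_on {0}" for f :: "complex \<Rightarrow> complex"
  proof -
    have "isCont f 0" using that by (rule analytic_at_imp_isCont)
    then have "(f \<longlongrightarrow> f 0) (nhds 0)" by (simp add: isCont_def tendsto_at_iff_tendsto_nhds)
    then show ?thesis by (rule filterlim_compose) (auto intro!: tendsto_eq_intros)
  qed
  have small: "\<forall>\<^sub>F x in at (0::real). x \<noteq> 0 \<and> \<bar>x\<bar> < 1"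
    unfolding eventually_at by (intro exI[of _ 1]) (auto simp: dist_real_def)
  have vcases: "(\<forall>\<^sub>F x in nhds 0. v x = 0) \<or>
    (\<exists>k u'. u' analytic_on {0} \<and> u' 0 \<noteq> 0 \<and> (\<forall>\<^sub>F x in nhds 0. v x = x ^ k * u' x))"
    by (rule analytic_germ_cases[OF v])
  show "\<exists>K. \<forall>\<^sub>F x in at (0::real). (norm (v (of_real x)))\<^sup>2 / norm (w (of_real x)) \<le> K"
    if le: "ord0 (\<lambda>x. w (of_real x)) \<le> 2 * ord0 (\<lambda>x. v (of_real x))"
    using vcases
  proof
    assume "\<forall>\<^sub>F x in nhds 0. v x = 0"
    from eventually_at_of_real[OF this] show ?thesis
      by (intro exI[of _ 0]) (auto elim!: eventually_mono)
  next
    assume "\<exists>k u'. u' analytic_on {0} \<and> u' 0 \<noteq> 0 \<and> (\<forall>\<^sub>F x in nhds 0. v x = x ^ k * u' x)"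
    then obtain k u' where u': "u' analytic_on {0}" "u' 0 \<noteq> 0" "\<forall>\<^sub>F x in nhds 0. v x = x ^ k * u' x" by blast
    have ov: "ord0 (\<lambda>x. v (of_real x)) = enat k"
      by (rule ord0_eq_enat[OF u'(1,2)]) (rule eventually_nhds_of_real[OF u'(3)])
    have kn: "n \<le> 2 * k"
      using le unfolding ow ov by (simp add: numeral_eq_enat)
    let ?l = "(norm (u' 0))\<^sup>2 / norm (u 0)"
    have "((\<lambda>x::real. (norm (u' (of_real x)))\<^sup>2 / norm (u (of_real x))) \<longlongrightarrow> ?l) (at 0)"
      using u(2) by (intro tendsto_intros lim u(1) u'(1)) auto
    then have "\<forall>\<^sub>F x in at (0::real). (norm (u' (of_real x)))\<^sup>2 / norm (u (of_real x)) < ?l + 1"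
      by (rule order_tendstoD) simp
    then have "\<forall>\<^sub>F x in at (0::real). (norm (v (of_real x)))\<^sup>2 / norm (w (of_real x)) \<le> ?l + 1"
      using ew eventually_at_of_real[OF u'(3)] small
    proof eventually_elim
      case (elim x)
      have "2 * k = n + (2 * k - n)" using kn by simp
      then have "\<bar>x\<bar> ^ (2 * k) = \<bar>x\<bar> ^ n * \<bar>x\<bar> ^ (2 * k - n)" by (metis power_add)
      then have "(norm (v (of_real x)))\<^sup>2 / norm (w (of_real x))
        = \<bar>x\<bar> ^ (2 * k - n) * ((norm (u' (of_real x)))\<^sup>2 / norm (u (of_real x)))"
        using elim by (simp add: norm_mult norm_power power_mult_distrib mult.commute flip: power_mult)
      also have "\<dots> \<le> 1 * ((norm (u' (of_real x)))\<^sup>2 / norm (u (of_real x)))"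
        using elim(4) by (intro mult_right_mono power_le_one) auto
      finally show ?case using elim(1) by simp
    qed
    then show ?thesis by blast
  qed
  show "\<exists>c>0. \<forall>\<^sub>F x in at (0::real). c / \<bar>x\<bar> \<le> (norm (v (of_real x)))\<^sup>2 / norm (w (of_real x))"
    if le: "\<not> ord0 (\<lambda>x. w (of_real x)) \<le> 2 * ord0 (\<lambda>x. v (of_real x))"
    using vcases
  proof
    assume "\<forall>\<^sub>F x in nhds 0. v x = 0"
    then have "ord0 (\<lambda>x. v (of_real x)) = \<infinity>"
      by (intro ord0_eq_infinity) (rule eventually_nhds_of_real)
    then show ?thesis using le by (simp add: numeral_eq_enat)
  next
    assume "\<exists>k u'. u' analytic_on {0} \<and> u' 0 \<noteq> 0 \<and> (\<forall>\<^sub>F x in nhds 0. v x = x ^ k * u' x)"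
    then obtain k u' where u': "u' analytic_on {0}" "u' 0 \<noteq> 0" "\<forall>\<^sub>F x in nhds 0. v x = x ^ k * u' x" by blast
    have ov: "ord0 (\<lambda>x. v (of_real x)) = enat k"
      by (rule ord0_eq_enat[OF u'(1,2)]) (rule eventually_nhds_of_real[OF u'(3)])
    have kn: "2 * k < n"
      using le unfolding ow ov by (simp add: numeral_eq_enat)
    let ?l = "(norm (u' 0))\<^sup>2 / norm (u 0)"
    have l: "?l > 0" using u(2) u'(2) by simp
    have "((\<lambda>x::real. (norm (u' (of_real x)))\<^sup>2 / norm (u (of_real x))) \<longlongrightarrow> ?l) (at 0)"
      using u(2) by (intro tendsto_intros lim u(1) u'(1)) auto
    then have "\<forall>\<^sub>F x in at (0::real). ?l / 2 < (norm (u' (of_real x)))\<^sup>2 / norm (u (of_real x))"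
      by (rule order_tendstoD) (use l in simp)
    then have "\<forall>\<^sub>F x in at (0::real). ?l / 2 / \<bar>x\<bar> \<le> (norm (v (of_real x)))\<^sup>2 / norm (w (of_real x))"
      using ew eventually_at_of_real[OF u'(3)] small
    proof eventually_elim
      case (elim x)
      have "n = 2 * k + (n - 2 * k)" using kn by simp
      then have "\<bar>x\<bar> ^ n = \<bar>x\<bar> ^ (2 * k) * \<bar>x\<bar> ^ (n - 2 * k)" by (metis power_add)
      then have eq: "(norm (v (of_real x)))\<^sup>2 / norm (w (of_real x))
        = ((norm (u' (of_real x)))\<^sup>2 / norm (u (of_real x))) / \<bar>x\<bar> ^ (n - 2 * k)"
        using elim by (simp add: norm_mult norm_power power_mult_distrib mult.commute flip: power_mult)
      have "\<bar>x\<bar> ^ (n - 2 * k) \<le> \<bar>x\<bar> ^ 1" using elim(4) kn by (intro power_decreasing) auto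
      then have dec: "\<bar>x\<bar> ^ (n - 2 * k) \<le> \<bar>x\<bar>" by simp
      show ?case unfolding eq
        by (rule frac_le[OF _ less_imp_le[OF elim(1)] _ dec]) (use elim(4) in simp_all)
    qed
    then show ?thesis using l by (intro exI[of _ "?l / 2"]) simp
  qed
qed

context stable_combination
begin

lemma norm_combination_le:
  "(\<Prod>k<M. norm (of_real y - ra k)) \<le> norm (1 + \<i> * of_real t) * norm (P (of_real y))"
proof -
  have nt: "norm (1 - \<i> * of_real t) = norm (1 + \<i> * of_real t)" by (simp add: cmod_def)
  have "(\<Prod>k<M. norm (of_real y - ra k))
      = norm (((1 - \<i> * of_real t) * P (of_real y) + (1 + \<i> * of_real t) * Pc (of_real y)) / 2)"
    unfolding combination' prod_norm by simp
  also have "\<dots> = norm ((1 - \<i> * of_real t) * P (of_real y) + (1 + \<i> * of_real t) * Pc (of_real y)) / 2"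
    by (simp add: norm_divide)
  also have "\<dots> \<le> (norm ((1 - \<i> * of_real t) * P (of_real y)) + norm ((1 + \<i> * of_real t) * Pc (of_real y))) / 2"
    by (intro divide_right_mono norm_triangle_ineq) simp
  also have "\<dots> = norm (1 + \<i> * of_real t) * norm (P (of_real y))"
    by (simp add: norm_mult nt Pc_real)
  finally show ?thesis .
qed

text \<open>\<open>G\<close> is the integral of |R/P|^2 over the whole line and \<open>I\<close>
  that of |f/P|^2 over |y| < \<open>\<eta>\<close>. Inside, the difference of the two quotients is
  bounded by \<open>norm_combination_le\<close>; outside, \<open>R / P\<close> decays because the
  zeros of \<open>P\<close> are within \<open>\<eta> / 2\<close>. \<open>D\<close> depends on
  \<open>M\<close>, \<open>t\<close>, \<open>C\<close> and \<open>\<eta>\<close> only, not on the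
  slice.\<close>

lemma slice_estimate:
  fixes f :: "real \<Rightarrow> complex" and R :: "complex poly" and C \<eta> :: real
  assumes R: "degree R < M \<or> R = 0" "\<And>j. j < M \<Longrightarrow> poly R (ra j) = f (a j)"
    and grow: "\<And>y. (1 + norm y) * norm (poly R y) \<le> C * (1 + norm y) ^ M"
    and near: "\<And>y. \<bar>y\<bar> < \<eta> \<Longrightarrow> norm (f y - poly R (of_real y)) \<le> C * (\<Prod>k<M. norm (of_real y - ra k))"
    and \<eta>: "\<eta> > 0" and C: "C \<ge> 0" and small: "\<And>k. k < M \<Longrightarrow> norm (zs k) \<le> \<eta> / 2"
    and meas: "(\<lambda>y. indicator {-\<eta><..<\<eta>} y *\<^sub>R f y) \<in> borel_measurable lborel"
  defines "I \<equiv> \<integral>\<^sup>+y. indicator {-\<eta><..<\<eta>} y * ennreal ((norm (f y / P (of_real y)))\<^sup>2) \<partial>lborel"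
    and "G \<equiv> pi * (\<Sum>j<M. (norm (f (a j)))\<^sup>2 / weight j)"
    and "D \<equiv> (2 * (C * norm (1 + \<i> * of_real t))\<^sup>2 * (1 + \<eta>\<^sup>2) + (C * (2 * (1 + \<eta>) / \<eta>) ^ M)\<^sup>2) * pi"
  shows "I \<le> ennreal (2 * G + D)" "ennreal G \<le> 2 * I + ennreal D"
proof -
  let ?T = "norm (1 + \<i> * of_real t)"
  \<comment> \<open>The factor \<open>1 + \<eta>\<^sup>2\<close> lets a multiple of 1/(1 + y^2)
    dominate the constant error on |y| < \<open>\<eta>\<close>. The same kernel with
    \<open>E2\<close> dominates the outer part, and both integrate to multiples of pi.\<close>
  define E1 where "E1 = 2 * (C * ?T)\<^sup>2 * (1 + \<eta>\<^sup>2)"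
  define E2 where "E2 = (C * (2 * (1 + \<eta>) / \<eta>) ^ M)\<^sup>2"
  have E: "E1 \<ge> 0" "E2 \<ge> 0" by (auto simp: E1_def E2_def)
  have D: "D = (E1 + E2) * pi" by (simp add: D_def E1_def E2_def)
  define \<phi> where "\<phi> y = (norm (f y / P (of_real y)))\<^sup>2" for y
  define \<psi> where "\<psi> y = (norm (poly R (of_real y) / P (of_real y)))\<^sup>2" for y
  have G: "integrable lborel \<psi>" "integral\<^sup>L lborel \<psi> = G"
    using quadrature[OF R(1)] R(2) unfolding \<psi>_def G_def by auto
  have near': "norm (f y / P (of_real y) - poly R (of_real y) / P (of_real y)) \<le> C * ?T" if "\<bar>y\<bar> < \<eta>" for y
  proof -
    have "norm (f y - poly R (of_real y)) \<le> C * (?T * norm (P (of_real y)))"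
      using order_trans[OF near[OF that] mult_left_mono[OF norm_combination_le C]] .
    then show ?thesis using P_nonzero[of y] by (simp add: field_simps norm_divide flip: diff_divide_distrib)
  qed
  have sq: "(norm (z::complex))\<^sup>2 \<le> 2 * (norm w)\<^sup>2 + 2 * b\<^sup>2" if "norm (z - w) \<le> b" for z w b
  proof -
    have "norm z \<le> norm w + b" using norm_triangle_ineq[of w "z - w"] that by simp
    then have "(norm z)\<^sup>2 \<le> (norm w + b)\<^sup>2" by (intro power_mono) auto
    also have "\<dots> \<le> 2 * (norm w)\<^sup>2 + 2 * b\<^sup>2"
      using sum_squares_bound[of "norm w" b] by (simp add: power2_sum)
    finally show ?thesis .
  qed
  have E1: "2 * (C * ?T)\<^sup>2 \<le> E1 * inverse (1 + y\<^sup>2)" if "\<bar>y\<bar> < \<eta>" for y :: real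
  proof -
    have "y\<^sup>2 \<le> \<eta>\<^sup>2" using that by (metis abs_le_square_iff abs_of_pos \<eta> less_imp_le)
    then have "2 * (C * ?T)\<^sup>2 * (1 + y\<^sup>2) \<le> E1"
      unfolding E1_def by (intro mult_left_mono) auto
    moreover have "1 + y\<^sup>2 > 0" by (simp add: add_pos_nonneg)
    ultimately show ?thesis by (simp add: field_simps)
  qed
  have ind: "indicator {-\<eta><..<\<eta>} y = (if \<bar>y\<bar> < \<eta> then 1 else (0::real))" for y
    by (auto simp: indicator_def)
  have up: "indicator {-\<eta><..<\<eta>} y * \<phi> y \<le> 2 * \<psi> y + (E1 + E2) * inverse (1 + y\<^sup>2)" for y
  proof (cases "\<bar>y\<bar> < \<eta>")
    case True
    have "\<phi> y \<le> 2 * \<psi> y + 2 * (C * ?T)\<^sup>2"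
      unfolding \<phi>_def \<psi>_def by (rule sq[OF near'[OF True]])
    moreover have "E2 * inverse (1 + y\<^sup>2) \<ge> 0" using E by simp
    ultimately show ?thesis using E1[OF True] True by (simp add: ind distrib_right)
  next
    case False
    then show ?thesis using E by (simp add: ind \<psi>_def)
  qed
  have lo: "\<psi> y \<le> 2 * (indicator {-\<eta><..<\<eta>} y * \<phi> y) + (E1 + E2) * inverse (1 + y\<^sup>2)" for y
  proof (cases "\<bar>y\<bar> < \<eta>")
    case True
    have "\<psi> y \<le> 2 * \<phi> y + 2 * (C * ?T)\<^sup>2"
      unfolding \<phi>_def \<psi>_def using near'[OF True] by (intro sq) (simp add: norm_minus_commute)
    moreover have "E2 * inverse (1 + y\<^sup>2) \<ge> 0" using E by simp
    ultimately show ?thesis using E1[OF True] True by (simp add: ind distrib_right)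
  next
    case False
    then have y: "\<bar>y\<bar> \<ge> \<eta>" "\<bar>y\<bar> > 0" using \<eta> by auto
    have pos: "1 + \<bar>y\<bar> > 0" by simp
    have frac: "c / p \<le> b / s" if "p > 0" "s > 0" "s * c \<le> b * p" for b c p s :: real
      using that by (simp add: field_simps)
    have "(\<bar>y\<bar> / 2) ^ M = (\<Prod>k<M. \<bar>y\<bar> / 2)" by simp
    also have "\<dots> \<le> (\<Prod>k<M. norm (of_real y - zs k))"
    proof (rule prod_mono)
      fix k assume "k \<in> {..<M}"
      then have "norm (zs k) \<le> \<bar>y\<bar> / 2" using small[of k] y by simp
      then show "0 \<le> \<bar>y\<bar> / 2 \<and> \<bar>y\<bar> / 2 \<le> norm (of_real y - zs k)"
        using norm_triangle_ineq2[of "of_real y" "zs k"] by simp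
    qed
    finally have Pge: "(\<bar>y\<bar> / 2) ^ M \<le> norm (P (of_real y))" by (simp add: P_def prod_norm)
    \<comment> \<open>For |y| at least \<open>\<eta>\<close>, 1 is at most |y| /
      \<open>\<eta>\<close>. The factor |y| / 2 is the lower bound for each |y - z_k|, whence the
      constant in \<open>E2\<close>.\<close>
    have "1 + \<bar>y\<bar> \<le> (2 * (1 + \<eta>) / \<eta>) * (\<bar>y\<bar> / 2)"
      using y \<eta> by (simp add: field_simps)
    then have "(1 + \<bar>y\<bar>) ^ M \<le> ((2 * (1 + \<eta>) / \<eta>) * (\<bar>y\<bar> / 2)) ^ M" by (intro power_mono) auto
    also have "\<dots> \<le> (2 * (1 + \<eta>) / \<eta>) ^ M * norm (P (of_real y))"
      unfolding power_mult_distrib using Pge \<eta> by (intro mult_left_mono) auto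
    finally have "C * (1 + \<bar>y\<bar>) ^ M \<le> C * ((2 * (1 + \<eta>) / \<eta>) ^ M * norm (P (of_real y)))"
      using C by (intro mult_left_mono)
    then have bnd: "(1 + \<bar>y\<bar>) * norm (poly R (of_real y)) \<le> C * (2 * (1 + \<eta>) / \<eta>) ^ M * norm (P (of_real y))"
      using grow[of "of_real y"] by (simp add: mult.assoc)
    have "norm (poly R (of_real y) / P (of_real y)) \<le> C * (2 * (1 + \<eta>) / \<eta>) ^ M / (1 + \<bar>y\<bar>)"
      unfolding norm_divide by (rule frac[OF _ pos bnd]) (simp add: P_nonzero)
    then have "\<psi> y \<le> (C * (2 * (1 + \<eta>) / \<eta>) ^ M / (1 + \<bar>y\<bar>))\<^sup>2"
      unfolding \<psi>_def by (intro power_mono) auto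
    also have "\<dots> = E2 / (1 + \<bar>y\<bar>)\<^sup>2" unfolding E2_def by (rule power_divide)
    also have "\<dots> \<le> E2 * inverse (1 + y\<^sup>2)" by (rule inverse_square_shift_le[OF E(2)])
    finally have "\<psi> y \<le> E2 * inverse (1 + y\<^sup>2)" .
    moreover have "E1 * inverse (1 + y\<^sup>2) \<ge> 0" using E by simp
    ultimately show ?thesis using False by (simp add: ind distrib_right \<phi>_def)
  qed
  have m\<psi>: "\<psi> \<in> borel_measurable lborel" using G(1) by (rule borel_measurable_integrable)
  have nG: "(\<integral>\<^sup>+y. ennreal (\<psi> y) \<partial>lborel) = ennreal G"
    using nn_integral_eq_integral[OF G(1)] G(2) by (simp add: \<psi>_def)
  have nD: "(\<integral>\<^sup>+y. ennreal ((E1 + E2) * inverse (1 + y\<^sup>2)) \<partial>lborel) = ennreal D"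
  proof -
    have "integrable lborel (\<lambda>y::real. (E1 + E2) * inverse (1 + y\<^sup>2))"
      by (intro integrable_mult_right integrable_inverse_1_plus_square_lborel)
    from nn_integral_eq_integral[OF this] show ?thesis
      using E by (simp add: D integral_inverse_1_plus_square)
  qed
  have mf: "(\<lambda>y. indicator {-\<eta><..<\<eta>} y * \<phi> y) \<in> borel_measurable lborel"
  proof -
    have "continuous_on UNIV (\<lambda>y. P (of_real y))" unfolding P_def by (intro continuous_intros)
    then have mP: "(\<lambda>y. P (of_real y)) \<in> borel_measurable lborel" by (simp add: borel_measurable_continuous_onI)
    note [measurable] = meas mP
    have "(\<lambda>y. (norm ((indicator {-\<eta><..<\<eta>} y *\<^sub>R f y) / P (of_real y)))\<^sup>2) \<in> borel_measurable lborel"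
      by measurable
    moreover have "(norm ((indicator {-\<eta><..<\<eta>} y *\<^sub>R f y) / P (of_real y)))\<^sup>2 = indicator {-\<eta><..<\<eta>} y * \<phi> y" for y
      by (simp add: \<phi>_def indicator_def)
    ultimately show ?thesis by simp
  qed
  have I: "I = (\<integral>\<^sup>+y. ennreal (indicator {-\<eta><..<\<eta>} y * \<phi> y) \<partial>lborel)"
    unfolding I_def \<phi>_def by (intro nn_integral_cong) (simp add: indicator_def)
  have G0: "G \<ge> 0" and D0: "D \<ge> 0"
  proof -
    show "G \<ge> 0" using G(2) Bochner_Integration.integral_nonneg[of lborel \<psi>] by (simp add: \<psi>_def)
    show "D \<ge> 0" using E by (simp add: D)
  qed
  have "I \<le> (\<integral>\<^sup>+y. 2 * ennreal (\<psi> y) + ennreal ((E1 + E2) * inverse (1 + y\<^sup>2)) \<partial>lborel)"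
    unfolding I
  proof (rule nn_integral_mono)
    fix y :: real
    have "ennreal (indicator {-\<eta><..<\<eta>} y * \<phi> y) \<le> ennreal (2 * \<psi> y + (E1 + E2) * inverse (1 + y\<^sup>2))"
      using up by (rule ennreal_leI)
    also have "\<dots> = 2 * ennreal (\<psi> y) + ennreal ((E1 + E2) * inverse (1 + y\<^sup>2))"
      using E by (simp add: ennreal_plus ennreal_mult \<psi>_def)
    finally show "ennreal (indicator {-\<eta><..<\<eta>} y * \<phi> y) \<le> 2 * ennreal (\<psi> y) + ennreal ((E1 + E2) * inverse (1 + y\<^sup>2))" .
  qed
  also have "\<dots> = 2 * ennreal G + ennreal D"
    using m\<psi> by (simp add: nn_integral_add nn_integral_cmult nG nD)
  also have "\<dots> = ennreal (2 * G + D)" using G0 D0 by (simp add: ennreal_plus ennreal_mult)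
  finally show "I \<le> ennreal (2 * G + D)" .
  have "ennreal G \<le> (\<integral>\<^sup>+y. 2 * ennreal (indicator {-\<eta><..<\<eta>} y * \<phi> y) + ennreal ((E1 + E2) * inverse (1 + y\<^sup>2)) \<partial>lborel)"
    unfolding nG[symmetric]
  proof (rule nn_integral_mono)
    fix y :: real
    have "ennreal (\<psi> y) \<le> ennreal (2 * (indicator {-\<eta><..<\<eta>} y * \<phi> y) + (E1 + E2) * inverse (1 + y\<^sup>2))"
      using lo by (rule ennreal_leI)
    also have "\<dots> = 2 * ennreal (indicator {-\<eta><..<\<eta>} y * \<phi> y) + ennreal ((E1 + E2) * inverse (1 + y\<^sup>2))"
      using E by (subst ennreal_plus) (auto simp: ennreal_mult \<phi>_def)
    finally show "ennreal (\<psi> y) \<le> 2 * ennreal (indicator {-\<eta><..<\<eta>} y * \<phi> y) + ennreal ((E1 + E2) * inverse (1 + y\<^sup>2))" .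
  qed
  also have "\<dots> = 2 * I + ennreal D"
    using mf by (simp add: nn_integral_add nn_integral_cmult I nD)
  finally show "ennreal G \<le> 2 * I + ennreal D" .
qed

end

section \<open>Integrability along the branches\<close>

lemma poly_eqI_real:
  fixes p q :: "complex poly"
  assumes "\<And>y::real. poly p (of_real y) = poly q (of_real y)"
  shows "p = q"
proof (rule ccontr)
  assume "p \<noteq> q"
  then have "finite {z. poly (p - q) z = 0}" by (intro poly_roots_finite) simp
  moreover have "range complex_of_real \<subseteq> {z. poly (p - q) z = 0}" using assms by auto
  moreover have "infinite (range complex_of_real)"
    using infinite_UNIV_char_0[where 'a = real] by (simp add: finite_image_iff inj_def)
  ultimately show False using finite_subset by blast
qed

text \<open>The branches are arbitrary functions with \<open>has_branches\<close>, not those built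
  in \<open>exists_branches\<close>, because the criterion is claimed for every choice.\<close>

locale branches =
  fixes M :: nat and L :: "nat \<Rightarrow> nat" and q :: "nat \<Rightarrow> real poly" and t :: real
    and a :: "nat \<Rightarrow> real \<Rightarrow> real" and Q :: "complex \<Rightarrow> complex \<Rightarrow> complex"
  assumes L: "\<forall>j<M. L j \<ge> 1" and q0: "\<forall>j<M. poly (q j) 0 = 0"
    and br: "has_branches M (\<lambda>x y. Apart (Pfun M L q) x y + of_real t * Bpart (Pfun M L q) x y) a"
    and Q: "conv_ps2 Q"
begin

abbreviation "PP \<equiv> Pfun M L q"

definition W :: "nat \<Rightarrow> real \<Rightarrow> complex" where
  "W j x = Bpart PP (of_real x) (of_real (a j x)) *
    (partial_y (Apart PP) (of_real x) (of_real (a j x)) + of_real t * partial_y (Bpart PP) (of_real x) (of_real (a j x)))"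

abbreviation Qa :: "nat \<Rightarrow> real \<Rightarrow> complex" where "Qa j x \<equiv> Q (of_real x) (of_real (a j x))"

abbreviation ratio :: "nat \<Rightarrow> real \<Rightarrow> real" where "ratio j x \<equiv> (norm (Qa j x))\<^sup>2 / norm (W j x)"

text \<open>\<open>has_branches\<close> gives the factorisation for real \<open>y\<close> only; both
  sides are polynomials in \<open>y\<close>, so it extends to complex \<open>y\<close>.\<close>

lemma branch_combination:
  obtains r where "r > 0" "\<And>x. \<bar>x\<bar> < r \<Longrightarrow> x \<noteq> 0 \<Longrightarrow> stable_combination M t (Pzero L q x) (\<lambda>j. a j x)"
proof -
  obtain r where r: "r > 0" "\<And>x y. \<bar>x\<bar> < r \<Longrightarrow>
      Apart PP (of_real x) (of_real y) + of_real t * Bpart PP (of_real x) (of_real y) = (\<Prod>j<M. of_real (y - a j x))"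
    using br by (auto simp: has_branches_def)
  have "stable_combination M t (Pzero L q x) (\<lambda>j. a j x)" if x: "\<bar>x\<bar> < r" "x \<noteq> 0" for x
  proof
    show "Im (Pzero L q x k) < 0" for k by (rule Im_Pzero[OF x(2)])
    fix y :: complex
    define p1 where "p1 = smult (1/2) (smult (1 - \<i> * of_real t) (\<Prod>k<M. [:- Pzero L q x k, 1:])
      + smult (1 + \<i> * of_real t) (\<Prod>k<M. [:- cnj (Pzero L q x k), 1:]))"
    define p2 where "p2 = (\<Prod>k<M. [:- complex_of_real (a k x), 1:])"
    have p1: "poly p1 y = ((1 - \<i> * of_real t) * (\<Prod>k<M. y - Pzero L q x k) +
        (1 + \<i> * of_real t) * (\<Prod>k<M. y - cnj (Pzero L q x k))) / 2" for y
      by (simp add: p1_def poly_prod)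
    have p2: "poly p2 y = (\<Prod>k<M. y - of_real (a k x))" for y
      by (simp add: p2_def poly_prod)
    have "p1 = p2"
    proof (rule poly_eqI_real)
      fix y :: real
      show "poly p1 (of_real y) = poly p2 (of_real y)"
        using r(2)[OF x(1), of y] unfolding combination_eq Pfun_of_real p1 p2 by simp
    qed
    then show "((1 - \<i> * of_real t) * (\<Prod>k<M. y - Pzero L q x k) +
        (1 + \<i> * of_real t) * (\<Prod>k<M. y - cnj (Pzero L q x k))) / 2 = (\<Prod>k<M. y - of_real (a k x))"
      using p1[of y] p2[of y] by simp
  qed
  then show thesis using that r(1) by blast
qed

text \<open>The product rule for (y - a_j) times the cofactor leaves just the cofactor at a_j, so
  the derivative in the criterion is the second factor of the weight.\<close>

lemma W_eq_weight:
  assumes sc: "stable_combination M t (Pzero L q x) (\<lambda>j. a j x)" and j: "j < M"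
  shows "W j x = of_real (stable_combination.weight M (Pzero L q x) (\<lambda>j. a j x) j)"
proof -
  interpret S: stable_combination M t "Pzero L q x" "\<lambda>j. a j x" by (rule sc)
  obtain A B where AB: "\<And>x y. PP x y = poly (A x) y + \<i> * poly (B x) y"
    "\<And>x y. conj_fun PP x y = poly (A x) y - \<i> * poly (B x) y"
    using Pfun_split[of M L q] by blast
  have A: "Apart PP x = poly (A x)" and B: "Bpart PP x = poly (B x)" for x
    by (auto simp: Apart_def Bpart_def AB fun_eq_iff)
  have dp: "deriv (poly p) y = poly (pderiv p) y" for p :: "complex poly" and y
    by (rule DERIV_imp_deriv) (rule poly_DERIV)
  define F where "F = A (of_real x) + smult (of_real t) (B (of_real x))"
  have "F = [:- of_real (a j x), 1:] * S.cofac j"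
  proof (rule poly_eqI_real)
    fix y :: real
    have "poly F (of_real y) = Apart PP (of_real x) (of_real y) + of_real t * Bpart PP (of_real x) (of_real y)"
      by (simp add: F_def A B)
    also have "\<dots> = (\<Prod>k<M. of_real y - of_real (a k x))"
      unfolding combination_eq Pfun_of_real by (rule S.combination)
    also have "\<dots> = poly ([:- of_real (a j x), 1:] * S.cofac j) (of_real y)"
      using S.cofac_times[OF j, of "of_real y"] by (simp add: algebra_simps)
    finally show "poly F (of_real y) = poly ([:- of_real (a j x), 1:] * S.cofac j) (of_real y)" .
  qed
  then have "poly (pderiv F) (of_real (a j x)) = poly (S.cofac j) (of_real (a j x))"
    by (simp only: pderiv_mult) (simp add: pderiv_pCons)
  moreover have "partial_y (Apart PP) (of_real x) y + of_real t * partial_y (Bpart PP) (of_real x) y = poly (pderiv F) y" for y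
    by (simp add: partial_y_def A B dp F_def pderiv_add pderiv_smult)
  moreover have "Bpart PP (of_real x) y = S.B y" for y
    by (simp add: Bpart_def S.B_def S.P_def S.Pc_def Pfun_of_real)
  ultimately show ?thesis
    unfolding W_def using S.weight(2)[OF j] by simp
qed

lemma branch_extension:
  assumes "j < M"
  shows "\<exists>g. real_germ g \<and> g 0 = 0 \<and> (\<forall>\<^sub>F x in nhds 0. g (of_real x) = of_real (a j x))"
proof -
  have a: "real_conv_series (a j)" "a j 0 = 0" using br assms by (auto simp: has_branches_def)
  obtain g where g: "g analytic_on {0}" "\<forall>\<^sub>F x in nhds 0. g (of_real x) = of_real (a j x)"
    using analytic_extension[OF a(1)] by blast
  have "\<forall>\<^sub>F x in nhds 0. g (of_real x) \<in> \<real>" using g(2) by eventually_elim simp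
  moreover have "g 0 = 0" using eventually_nhds_x_imp_x[OF g(2)] a(2) by simp
  ultimately show ?thesis using g by (auto simp: real_germ_def)
qed

lemma W_analytic:
  assumes j: "j < M"
  shows "\<exists>w. w analytic_on {0} \<and> (\<forall>\<^sub>F x in nhds 0. W j x = w (of_real x))"
proof -
  obtain g where g: "real_germ g" "\<forall>\<^sub>F x in nhds 0. g (of_real x) = of_real (a j x)"
    using branch_extension[OF j] by blast
  obtain A B where AB: "poly_germ A" "poly_germ B" "\<And>x y. PP x y = poly (A x) y + \<i> * poly (B x) y"
    "\<And>x y. conj_fun PP x y = poly (A x) y - \<i> * poly (B x) y"
    using Pfun_split[of M L q] by blast
  have A: "Apart PP x = poly (A x)" and B: "Bpart PP x = poly (B x)" for x
    by (auto simp: Apart_def Bpart_def AB fun_eq_iff)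
  have dp: "deriv (poly p) y = poly (pderiv p) y" for p :: "complex poly" and y
    by (rule DERIV_imp_deriv) (rule poly_DERIV)
  define w where "w z = poly (B z) (g z) * (poly (pderiv (A z)) (g z) + of_real t * poly (pderiv (B z)) (g z))" for z
  have "real_germ w" unfolding w_def
    by (intro real_germ_mult real_germ_add real_germ_poly poly_germ_pderiv AB(1,2) g(1) real_germ_const) auto
  then have "w analytic_on {0}" by (simp add: real_germ_def)
  moreover have "\<forall>\<^sub>F x in nhds 0. W j x = w (of_real x)"
    using g(2) by eventually_elim (simp add: W_def w_def partial_y_def A B dp)
  ultimately show ?thesis by blast
qed

lemma Q_branch_analytic:
  assumes j: "j < M"
  shows "\<exists>v. v analytic_on {0} \<and> (\<forall>\<^sub>F x in nhds 0. Qa j x = v (of_real x))"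
proof -
  obtain g where g: "real_germ g" "g 0 = 0" "\<forall>\<^sub>F x in nhds 0. g (of_real x) = of_real (a j x)"
    using branch_extension[OF j] by blast
  obtain \<rho> where \<rho>: "\<rho> > 0" and hol: "\<And>g h s. \<lbrakk>continuous_on (cball 0 s) g; g holomorphic_on ball 0 s;
       continuous_on (cball 0 s) h; h holomorphic_on ball 0 s;
       g ` cball 0 s \<subseteq> cball 0 \<rho>; h ` cball 0 s \<subseteq> cball 0 \<rho>\<rbrakk> \<Longrightarrow>
       (\<lambda>z. Q (g z) (h z)) holomorphic_on ball 0 s"
    using conv_ps2_local[OF Q] by metis
  obtain s1 where s1: "s1 > 0" "g holomorphic_on ball 0 s1"
    using g(1) by (auto simp: real_germ_def analytic_on_def)
  have "\<forall>\<^sub>F z in nhds 0. dist (g z) (g 0) < \<rho>"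
    using real_germ_tendsto[OF g(1)] \<rho> by (auto simp: tendsto_iff)
  then obtain s2 where s2: "s2 > 0" "\<And>z. dist z 0 < s2 \<Longrightarrow> norm (g z) < \<rho>"
    using g(2) unfolding eventually_nhds_metric by auto
  define s where "s = min \<rho> (min s1 s2) / 2"
  have s: "s > 0" "s < \<rho>" "s < s1" "s < s2" using \<rho> s1 s2 by (auto simp: s_def)
  have sub: "cball 0 s \<subseteq> ball (0::complex) s1" using s by auto
  have "(\<lambda>z. Q z (g z)) holomorphic_on ball 0 s"
  proof (rule hol)
    show "continuous_on (cball 0 s) g" "g holomorphic_on ball 0 s"
      using holomorphic_on_subset[OF s1(2) sub] holomorphic_on_imp_continuous_on holomorphic_on_subset[OF _ ball_subset_cball]
      by blast+
    show "g ` cball 0 s \<subseteq> cball 0 \<rho>" using s2(2) s(4) by (fastforce simp: less_imp_le)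
    show "(\<lambda>z. z) ` cball 0 s \<subseteq> cball (0::complex) \<rho>" using s by auto
  qed (auto intro: continuous_intros holomorphic_intros)
  then have "(\<lambda>z. Q z (g z)) analytic_on {0}" using s(1) by (auto simp: analytic_on_def)
  moreover have "\<forall>\<^sub>F x in nhds 0. Qa j x = Q (of_real x) (g (of_real x))"
    using g(3) by eventually_elim simp
  ultimately show ?thesis by (intro exI[of _ "\<lambda>z. Q z (g z)"]) simp
qed

text \<open>Positivity of the weights off 0 ensures that the germ of \<open>W j\<close> is not zero,
  as \<open>germ_ratio_bounded\<close> requires.\<close>

lemma branch_ratio:
  assumes j: "j < M"
  shows "ord0 (W j) \<le> 2 * ord0 (Qa j) \<Longrightarrow>
      \<exists>K. \<forall>\<^sub>F x in at 0. ratio j x \<le> K"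
    and "\<not> ord0 (W j) \<le> 2 * ord0 (Qa j) \<Longrightarrow>
      \<exists>c>0. \<forall>\<^sub>F x in at 0. c / \<bar>x\<bar> \<le> ratio j x"
proof -
  obtain w where w: "w analytic_on {0}" "\<forall>\<^sub>F x in nhds 0. W j x = w (of_real x)"
    using W_analytic[OF j] by blast
  obtain v where v: "v analytic_on {0}" "\<forall>\<^sub>F x in nhds 0. Qa j x = v (of_real x)"
    using Q_branch_analytic[OF j] by blast
  obtain r where r: "r > 0" "\<And>x. \<bar>x\<bar> < r \<Longrightarrow> x \<noteq> 0 \<Longrightarrow> stable_combination M t (Pzero L q x) (\<lambda>j. a j x)"
    using branch_combination by blast
  have wat: "\<forall>\<^sub>F x in at 0. W j x = w (of_real x)"
    and vat: "\<forall>\<^sub>F x in at 0. Qa j x = v (of_real x)"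
    using w(2) v(2) eventually_nhds_conv_at by blast+
  have "\<forall>\<^sub>F x in at 0. \<bar>x\<bar> < r \<and> x \<noteq> 0"
    unfolding eventually_at using r(1) by (intro exI[of _ r]) (auto simp: dist_real_def)
  with wat have nz: "\<forall>\<^sub>F x in at 0. w (of_real x) \<noteq> 0"
  proof eventually_elim
    case (elim x)
    have sc: "stable_combination M t (Pzero L q x) (\<lambda>j. a j x)" using r(2) elim by blast
    show ?case using W_eq_weight[OF sc j] stable_combination.weight(1)[OF sc j] elim(1) by auto
  qed
  have ow: "ord0 (W j) = ord0 (\<lambda>x. w (of_real x))" by (rule ord0_cong[OF w(2)])
  have ov: "ord0 (Qa j) = ord0 (\<lambda>x. v (of_real x))" by (rule ord0_cong[OF v(2)])
  show "\<exists>K. \<forall>\<^sub>F x in at 0. ratio j x \<le> K"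
    if le: "ord0 (W j) \<le> 2 * ord0 (Qa j)"
  proof -
    obtain K where "\<forall>\<^sub>F x in at (0::real). (norm (v (of_real x)))\<^sup>2 / norm (w (of_real x)) \<le> K"
      using germ_ratio_bounded(1)[OF v(1) w(1) nz le[unfolded ow ov]] by blast
    then have "\<forall>\<^sub>F x in at 0. ratio j x \<le> K"
      using wat vat by eventually_elim simp
    then show ?thesis by blast
  qed
  show "\<exists>c>0. \<forall>\<^sub>F x in at 0. c / \<bar>x\<bar> \<le> ratio j x"
    if le: "\<not> ord0 (W j) \<le> 2 * ord0 (Qa j)"
  proof -
    obtain c where "c > 0" "\<forall>\<^sub>F x in at (0::real). c / \<bar>x\<bar> \<le> (norm (v (of_real x)))\<^sup>2 / norm (w (of_real x))"
      using germ_ratio_bounded(2)[OF v(1) w(1) nz le[unfolded ow ov]] by blast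
    from this(2) have "\<forall>\<^sub>F x in at 0. c / \<bar>x\<bar> \<le> ratio j x"
      using wat vat by eventually_elim simp
    then show ?thesis using \<open>c > 0\<close> by blast
  qed
qed

end

section \<open>From slices to the plane: the two implications\<close>

lemma eventually_at_0_real:
  "(\<forall>\<^sub>F x in at (0::real). Pr x) \<longleftrightarrow> (\<exists>d>0. \<forall>x. x \<noteq> 0 \<longrightarrow> \<bar>x\<bar> < d \<longrightarrow> Pr x)"
  by (simp add: eventually_at dist_real_def imp_conjL)

lemma inverse_not_nn_integrable_near_0:
  assumes "c > 0" "d > 0" "B < \<infinity>" and le: "\<And>e. 0 < e \<Longrightarrow> e < d \<Longrightarrow> (\<integral>\<^sup>+x. ennreal (c / x) * indicator {e..d} x \<partial>lborel) \<le> B"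
  shows False
proof -
  obtain b where b: "b \<ge> 0" "B = ennreal b" using assms(3) by (cases B) auto
  \<comment> \<open>Chosen so that the integral of c/x from \<open>d * exp (- N)\<close> to
    \<open>d\<close>, which is \<open>c * N\<close>, equals \<open>b + c\<close> and exceeds the
    supposed bound \<open>b\<close>.\<close>
  define N where "N = b / c + 1"
  have N: "N > 0" using assms b by (simp add: N_def add_nonneg_pos)
  define e where "e = d * exp (- N)"
  have e: "0 < e" "e < d" using assms(2) N by (auto simp: e_def)
  have "(\<integral>\<^sup>+x. ennreal (c / x) * indicator {e..d} x \<partial>lborel) = ennreal (c * ln d - c * ln e)"
  proof (rule nn_integral_FTC_Icc)
    show "(\<lambda>x. c / x) \<in> borel_measurable borel" by measurable
    fix x assume "x \<in> {e..d}"
    then show "((\<lambda>x. c * ln x) has_real_derivative c / x) (at x)" "0 \<le> c / x"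
      using e assms(1) by (auto intro!: derivative_eq_intros simp: field_simps)
  qed (use e in auto)
  also have "c * ln d - c * ln e = c * N"
    using assms(2) by (simp add: e_def ln_mult algebra_simps)
  finally have "ennreal (c * N) \<le> ennreal b" using le[OF e] b by simp
  then have "c * N \<le> b" using b by simp
  moreover have "c * N = b + c" using assms(1) by (simp add: N_def field_simps)
  ultimately show False using assms(1) by simp
qed

context branches
begin

text \<open>By \<open>quadrature\<close>, for small \<open>x\<close> off 0, the integral of |R/P|^2
  over the full line, where \<open>R\<close> interpolates Q(x, .) at the branches.\<close>

definition G :: "real \<Rightarrow> real" where
  "G x = pi * (\<Sum>j<M. ratio j x)"

definition I :: "real \<Rightarrow> real \<Rightarrow> ennreal" where
  "I \<eta> x = (\<integral>\<^sup>+y. indicator {-\<eta><..<\<eta>} y * ennreal ((norm (Q (of_real x) (of_real y) / PP (of_real x) (of_real y)))\<^sup>2) \<partial>lborel)"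

lemma branch_small:
  assumes j: "j < M" and e: "e > 0"
  shows "\<forall>\<^sub>F x in nhds 0. \<bar>a j x\<bar> < e"
proof -
  obtain g where g: "real_germ g" "g 0 = 0" "\<forall>\<^sub>F x in nhds 0. g (of_real x) = of_real (a j x)"
    using branch_extension[OF j] by blast
  have "\<forall>\<^sub>F z in nhds 0. dist (g z) (g 0) < e"
    using real_germ_tendsto[OF g(1)] e by (auto simp: tendsto_iff)
  from eventually_nhds_of_real[OF this] g(3) show ?thesis
    by eventually_elim (simp add: g(2))
qed

lemma Pzero_small:
  assumes k: "k < M" and e: "e > 0"
  shows "\<forall>\<^sub>F x in nhds 0. norm (Pzero L q x k) \<le> e"
proof -
  have "isCont (\<lambda>x. Pzero L q x k) 0" unfolding Pzero_def by (intro continuous_intros)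
  then have "((\<lambda>x. Pzero L q x k) \<longlongrightarrow> Pzero L q 0 k) (nhds 0)"
    using tendsto_at_iff_tendsto_nhds[of "\<lambda>x. Pzero L q x k" 0] by (simp add: isCont_def)
  then have "\<forall>\<^sub>F x in nhds 0. dist (Pzero L q x k) (Pzero L q 0 k) < e" using e tendstoD by blast
  moreover have "Pzero L q 0 k = 0" using L q0 k by (auto simp: Pzero_def power_0_left)
  ultimately show ?thesis by (auto elim!: eventually_mono)
qed

text \<open>\<open>D\<close> is chosen before \<open>x\<close>, so both inequalities can be
  integrated over \<open>x\<close>. The height \<open>\<eta>\<close> stays free because
  \<open>orders_if_L2\<close> has to fit the rectangle into a given neighbourhood.\<close>

lemma slice_bounds:
  "\<exists>\<rho>>0. continuous_on (cball 0 \<rho> \<times> cball 0 \<rho>) (\<lambda>v. Q (fst v) (snd v)) \<and>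
    (\<forall>\<eta>. 0 < \<eta> \<longrightarrow> \<eta> \<le> \<rho> \<longrightarrow> (\<exists>D\<ge>0. \<exists>\<delta>>0. \<delta> \<le> \<rho> \<and>
      (\<forall>x. x \<noteq> 0 \<longrightarrow> \<bar>x\<bar> < \<delta> \<longrightarrow> I \<eta> x \<le> ennreal (2 * G x + D) \<and> ennreal (G x) \<le> 2 * I \<eta> x + ennreal D)))"
proof -
  obtain \<rho> where \<rho>: "\<rho> > 0" and cont: "continuous_on (cball 0 \<rho> \<times> cball 0 \<rho>) (\<lambda>v. Q (fst v) (snd v))"
    and hol: "\<forall>g h s. continuous_on (cball 0 s) g \<longrightarrow> g holomorphic_on ball 0 s \<longrightarrow>
       continuous_on (cball 0 s) h \<longrightarrow> h holomorphic_on ball 0 s \<longrightarrow>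
       g ` cball 0 s \<subseteq> cball 0 \<rho> \<longrightarrow> h ` cball 0 s \<subseteq> cball 0 \<rho> \<longrightarrow>
       (\<lambda>z. Q (g z) (h z)) holomorphic_on ball 0 s"
    using conv_ps2_local[OF Q] by (elim exE conjE)
  have "compact ((\<lambda>v. Q (fst v) (snd v)) ` (cball 0 \<rho> \<times> cball 0 \<rho>))"
    by (intro compact_continuous_image cont compact_Times) auto
  then have "bounded ((\<lambda>v. Q (fst v) (snd v)) ` (cball 0 \<rho> \<times> cball 0 \<rho>))" by (rule compact_imp_bounded)
  then obtain K where K': "\<forall>z\<in>(\<lambda>v. Q (fst v) (snd v)) ` (cball 0 \<rho> \<times> cball 0 \<rho>). norm z \<le> K"
    by (auto simp: bounded_iff)
  have K: "norm (Q x y) \<le> K" if "norm x \<le> \<rho>" "norm y \<le> \<rho>" for x y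
    by (rule K'[rule_format]) (use that in \<open>auto intro!: image_eqI[of _ _ "(x, y)"]\<close>)
  have "norm (Q 0 0) \<le> K" using \<rho> by (intro K) auto
  then have "K \<ge> 0" using norm_ge_zero[of "Q 0 0"] by linarith
  from newton_interpolation[OF \<rho> this, of M] obtain C where C: "C \<ge> 0" and
    newton: "\<forall>f a. f holomorphic_on ball 0 \<rho> \<longrightarrow> (\<forall>z\<in>ball 0 \<rho>. norm (f z) \<le> K) \<longrightarrow>
    (\<forall>j<M. norm (a j) < \<rho> / 2) \<longrightarrow> (\<exists>R. newton_interpolant M \<rho> C f a R)"
    by (elim exE conjE)
  obtain r where r: "r > 0" "\<And>x. \<bar>x\<bar> < r \<Longrightarrow> x \<noteq> 0 \<Longrightarrow> stable_combination M t (Pzero L q x) (\<lambda>j. a j x)"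
    using branch_combination by blast
  have "\<exists>D\<ge>0. \<exists>\<delta>>0. \<delta> \<le> \<rho> \<and>
      (\<forall>x. x \<noteq> 0 \<longrightarrow> \<bar>x\<bar> < \<delta> \<longrightarrow> I \<eta> x \<le> ennreal (2 * G x + D) \<and> ennreal (G x) \<le> 2 * I \<eta> x + ennreal D)"
    if \<eta>: "0 < \<eta>" "\<eta> \<le> \<rho>" for \<eta>
  proof -
    define D where "D = (2 * (C * norm (1 + \<i> * of_real t))\<^sup>2 * (1 + \<eta>\<^sup>2) + (C * (2 * (1 + \<eta>) / \<eta>) ^ M)\<^sup>2) * pi"
    have "D \<ge> 0" by (simp add: D_def)
    have "\<forall>\<^sub>F x in nhds 0. (\<forall>j\<in>{..<M}. \<bar>a j x\<bar> < \<rho> / 2) \<and> (\<forall>k\<in>{..<M}. norm (Pzero L q x k) \<le> \<eta> / 2)"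
      by (intro eventually_conj eventually_ball_finite ballI branch_small Pzero_small) (use \<rho> \<eta> in auto)
    then obtain d where d: "d > 0" "\<And>x. \<bar>x\<bar> < d \<Longrightarrow> (\<forall>j\<in>{..<M}. \<bar>a j x\<bar> < \<rho> / 2) \<and> (\<forall>k\<in>{..<M}. norm (Pzero L q x k) \<le> \<eta> / 2)"
      unfolding eventually_nhds_metric by (auto simp: dist_real_def)
    \<comment> \<open>Below \<open>d\<close> the nodes satisfy the hypothesis of
      \<open>newton_interpolation\<close> and the zeros of P(x, .) that of
      \<open>slice_estimate\<close>; below \<open>r\<close> the slice is a
      \<open>stable_combination\<close>.\<close>
    define \<delta> where "\<delta> = min d (min r \<rho>)"
    have \<delta>: "\<delta> > 0" "\<delta> \<le> d" "\<delta> \<le> r" "\<delta> \<le> \<rho>" using d(1) r(1) \<rho> by (auto simp: \<delta>_def)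
    have "I \<eta> x \<le> ennreal (2 * G x + D) \<and> ennreal (G x) \<le> 2 * I \<eta> x + ennreal D" if x: "x \<noteq> 0" "\<bar>x\<bar> < \<delta>" for x
    proof -
      interpret S: stable_combination M t "Pzero L q x" "\<lambda>j. a j x" using r(2) x \<delta> by simp
      define f where "f = Q (of_real x)"
      have xr: "norm (complex_of_real x) \<le> \<rho>" using x \<delta> by simp
      have f1: "f holomorphic_on ball 0 \<rho>"
      proof -
        have "(\<lambda>_. complex_of_real x) ` cball 0 \<rho> \<subseteq> cball (0::complex) \<rho>" using xr by auto
        then show ?thesis
          using hol[rule_format, of \<rho> "\<lambda>_. of_real x" "\<lambda>z. z"] by (simp add: f_def)
      qed
      have f2: "\<forall>z\<in>ball 0 \<rho>. norm (f z) \<le> K" using K xr by (auto simp: f_def)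
      have as: "\<forall>j<M. norm (complex_of_real (a j x)) < \<rho> / 2" using d(2)[of x] x \<delta> by auto
      have "\<exists>R. newton_interpolant M \<rho> C f (\<lambda>j. of_real (a j x)) R"
        by (rule mp[OF mp[OF mp[OF spec[OF spec[OF newton, of f], of "\<lambda>j. complex_of_real (a j x)"] f1] f2] as])
      then obtain R where "newton_interpolant M \<rho> C f (\<lambda>j. of_real (a j x)) R" by (elim exE)
      note R = newton_interpolantD[OF this]
      have near: "norm (f (of_real y) - poly R (of_real y)) \<le> C * (\<Prod>k<M. norm (of_real y - complex_of_real (a k x)))"
        if "\<bar>y\<bar> < \<eta>" for y using that \<eta> by (intro R(4)) simp
      have small: "norm (Pzero L q x k) \<le> \<eta> / 2" if "k < M" for k using d(2)[of x] x \<delta> that by auto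
      have meas: "(\<lambda>y. indicator {-\<eta><..<\<eta>} y *\<^sub>R f (of_real y)) \<in> borel_measurable lborel"
      proof -
        have "continuous_on {-\<eta><..<\<eta>} (\<lambda>y. (\<lambda>v. Q (fst v) (snd v)) (complex_of_real x, complex_of_real y))"
          by (rule continuous_on_compose2[OF cont]) (use xr \<eta> in \<open>auto intro!: continuous_intros\<close>)
        then have "continuous_on {-\<eta><..<\<eta>} (\<lambda>y. f (of_real y))" by (simp add: f_def)
        then show ?thesis using borel_measurable_continuous_on_indicator[of "{-\<eta><..<\<eta>}"] by simp
      qed
      note est = S.slice_estimate[of R "\<lambda>y. f (of_real y)", OF R(1,2,3) near \<eta>(1) C small meas, folded D_def]
      have "(\<Sum>j<M. (norm (f (of_real (a j x))))\<^sup>2 / S.weight j) = (\<Sum>j<M. ratio j x)"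
        using S.weight(1) W_eq_weight[OF S.stable_combination_axioms]
        by (intro sum.cong) (auto simp: f_def abs_of_pos)
      then have eG: "pi * (\<Sum>j<M. (norm (f (of_real (a j x))))\<^sup>2 / S.weight j) = G x" by (simp add: G_def)
      have "S.P (of_real y) = PP (of_real x) (of_real y)" for y by (simp add: S.P_def Pfun_of_real)
      then have eI: "(\<integral>\<^sup>+y. indicator {-\<eta><..<\<eta>} y * ennreal ((norm (f (of_real y) / S.P (of_real y)))\<^sup>2) \<partial>lborel) = I \<eta> x"
        by (simp add: I_def f_def)
      show ?thesis using est unfolding eG eI by blast
    qed
    then show ?thesis using \<open>D \<ge> 0\<close> \<delta>(1,4) by blast
  qed
  then show ?thesis using \<rho> cont by blast
qed

definition F :: "real \<times> real \<Rightarrow> complex" where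
  "F = (\<lambda>(x, y). Q (of_real x) (of_real y) / PP (of_real x) (of_real y))"

definition rect :: "real \<Rightarrow> real \<Rightarrow> (real \<times> real) set" where
  "rect \<delta> \<eta> = {-\<delta><..<\<delta>} \<times> {-\<eta><..<\<eta>}"

lemma open_rect: "open (rect \<delta> \<eta>)"
  by (simp add: rect_def open_Times)

lemma rect_measurable:
  assumes cont: "continuous_on (cball 0 \<rho> \<times> cball 0 \<rho>) (\<lambda>v. Q (fst v) (snd v))" and le: "\<delta> \<le> \<rho>" "\<eta> \<le> \<rho>"
  shows "(\<lambda>z. indicator (rect \<delta> \<eta>) z *\<^sub>R F z) \<in> borel_measurable lborel"
proof -
  have "continuous_on (rect \<delta> \<eta>) (\<lambda>z. (\<lambda>v. Q (fst v) (snd v)) (complex_of_real (fst z), complex_of_real (snd z)))"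
    by (rule continuous_on_compose2[OF cont]) (use le in \<open>auto intro!: continuous_intros simp: rect_def\<close>)
  then have "continuous_on (rect \<delta> \<eta>) (\<lambda>z. Q (of_real (fst z)) (of_real (snd z)))" by simp
  then have m: "(\<lambda>z. indicator (rect \<delta> \<eta>) z *\<^sub>R Q (of_real (fst z)) (of_real (snd z))) \<in> borel_measurable lborel"
    using borel_measurable_continuous_on_indicator[of "rect \<delta> \<eta>"] open_rect by simp
  have "continuous_on UNIV (\<lambda>z::real \<times> real. PP (of_real (fst z)) (of_real (snd z)))"
    unfolding Pfun_def by (intro continuous_intros)
  then have mP: "(\<lambda>z::real \<times> real. PP (of_real (fst z)) (of_real (snd z))) \<in> borel_measurable lborel"
    by (simp add: borel_measurable_continuous_onI)
  note [measurable] = m mP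
  have "(\<lambda>z. (indicator (rect \<delta> \<eta>) z *\<^sub>R Q (of_real (fst z)) (of_real (snd z))) / PP (of_real (fst z)) (of_real (snd z)))
      \<in> borel_measurable lborel" by measurable
  moreover have "(indicator (rect \<delta> \<eta>) z *\<^sub>R Q (of_real (fst z)) (of_real (snd z))) / PP (of_real (fst z)) (of_real (snd z))
      = indicator (rect \<delta> \<eta>) z *\<^sub>R F z" for z
    by (cases "z \<in> rect \<delta> \<eta>") (simp_all add: F_def case_prod_unfold)
  ultimately show ?thesis by (simp only:)
qed

lemma rect_nn_integral:
  assumes m: "(\<lambda>z. indicator (rect \<delta> \<eta>) z *\<^sub>R F z) \<in> borel_measurable lborel"
  shows "(\<integral>\<^sup>+z. ennreal (indicator (rect \<delta> \<eta>) z * (norm (F z))\<^sup>2) \<partial>lborel) = (\<integral>\<^sup>+x. indicator {-\<delta><..<\<delta>} x * I \<eta> x \<partial>lborel)"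
    "(\<lambda>x. indicator {-\<delta><..<\<delta>} x * I \<eta> x) \<in> borel_measurable lborel"
proof -
  let ?f = "\<lambda>z. ennreal (indicator (rect \<delta> \<eta>) z * (norm (F z))\<^sup>2)"
  note [measurable] = m
  have "(\<lambda>z. ennreal ((norm (indicator (rect \<delta> \<eta>) z *\<^sub>R F z))\<^sup>2)) \<in> borel_measurable lborel" by measurable
  moreover have "ennreal ((norm (indicator (rect \<delta> \<eta>) z *\<^sub>R F z))\<^sup>2) = ?f z" for z
    by (simp add: indicator_def)
  ultimately have "?f \<in> borel_measurable lborel" by simp
  then have mf: "?f \<in> borel_measurable (lborel \<Otimes>\<^sub>M lborel)" by (simp add: lborel_prod)
  have eq: "(\<integral>\<^sup>+y. ?f (x, y) \<partial>lborel) = indicator {-\<delta><..<\<delta>} x * I \<eta> x" for x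
  proof (cases "x \<in> {-\<delta><..<\<delta>}")
    case True
    then have "?f (x, y) = indicator {-\<eta><..<\<eta>} y * ennreal ((norm (Q (of_real x) (of_real y) / PP (of_real x) (of_real y)))\<^sup>2)" for y
      by (auto simp: rect_def F_def indicator_def)
    then show ?thesis using True by (simp add: I_def)
  next
    case False
    then have "(\<integral>\<^sup>+y. ?f (x, y) \<partial>lborel) = (\<integral>\<^sup>+y. 0 \<partial>(lborel :: real measure))"
      by (intro nn_integral_cong) (auto simp: rect_def indicator_def)
    then show ?thesis using False by simp
  qed
  show "(\<integral>\<^sup>+z. ?f z \<partial>lborel) = (\<integral>\<^sup>+x. indicator {-\<delta><..<\<delta>} x * I \<eta> x \<partial>lborel)"
    using lborel.nn_integral_fst[OF mf] by (simp add: lborel_prod eq)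
  show "(\<lambda>x. indicator {-\<delta><..<\<delta>} x * I \<eta> x) \<in> borel_measurable lborel"
    using lborel.borel_measurable_nn_integral_fst[OF mf] by (simp add: eq)
qed

lemma G_term_le: "j < M \<Longrightarrow> pi * ratio j x \<le> G x"
  unfolding G_def by (intro mult_left_mono member_le_sum) auto

lemma L2_if_orders:
  assumes ord: "\<And>j. j < M \<Longrightarrow> ord0 (W j) \<le> 2 * ord0 (Qa j)"
  shows "L2_loc F"
proof -
  obtain \<rho> where \<rho>: "\<rho> > 0" "continuous_on (cball 0 \<rho> \<times> cball 0 \<rho>) (\<lambda>v. Q (fst v) (snd v))"
    and sl: "\<And>\<eta>. 0 < \<eta> \<Longrightarrow> \<eta> \<le> \<rho> \<Longrightarrow> \<exists>D\<ge>0. \<exists>\<delta>>0. \<delta> \<le> \<rho> \<and>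
      (\<forall>x. x \<noteq> 0 \<longrightarrow> \<bar>x\<bar> < \<delta> \<longrightarrow> I \<eta> x \<le> ennreal (2 * G x + D) \<and> ennreal (G x) \<le> 2 * I \<eta> x + ennreal D)"
    using slice_bounds by blast
  obtain D \<delta> where D: "D \<ge> 0" "\<delta> > 0" "\<delta> \<le> \<rho>" "\<And>x. x \<noteq> 0 \<Longrightarrow> \<bar>x\<bar> < \<delta> \<Longrightarrow> I \<rho> x \<le> ennreal (2 * G x + D)"
    using sl[OF \<rho>(1) order_refl] by blast
  have "\<exists>K. \<forall>\<^sub>F x in at 0. ratio j x \<le> K" if "j < M" for j
    using branch_ratio(1)[OF that ord[OF that]] .
  then obtain K where K: "\<And>j. j < M \<Longrightarrow> \<forall>\<^sub>F x in at 0. ratio j x \<le> K j"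
    by metis
  have "\<forall>\<^sub>F x in at 0. \<forall>j\<in>{..<M}. ratio j x \<le> K j"
    using K by (intro eventually_ball_finite) auto
  then obtain d where d: "d > 0" "\<And>x j. x \<noteq> 0 \<Longrightarrow> \<bar>x\<bar> < d \<Longrightarrow> j < M \<Longrightarrow> ratio j x \<le> K j"
    unfolding eventually_at_0_real by auto
  define \<delta>' where "\<delta>' = min \<delta> d"
  have \<delta>': "\<delta>' > 0" "\<delta>' \<le> \<delta>" "\<delta>' \<le> d" "\<delta>' \<le> \<rho>" using D d by (auto simp: \<delta>'_def)
  define V where "V = 2 * (pi * (\<Sum>j<M. K j)) + D"
  have GK: "2 * G x + D \<le> V" if "x \<noteq> 0" "\<bar>x\<bar> < \<delta>'" for x
    unfolding G_def V_def using d(2)[of x] that \<delta>' by (auto intro!: mult_left_mono sum_mono)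
  have m: "(\<lambda>z. indicator (rect \<delta>' \<rho>) z *\<^sub>R F z) \<in> borel_measurable lborel"
    by (rule rect_measurable[OF \<rho>(2)]) (use \<delta>' in auto)
  have "(\<integral>\<^sup>+x. indicator {-\<delta>'<..<\<delta>'} x * I \<rho> x \<partial>lborel) \<le> (\<integral>\<^sup>+x. ennreal V * indicator {-\<delta>'<..<\<delta>'} x \<partial>lborel)"
  proof (rule nn_integral_mono_AE)
    \<comment> \<open>The slice \<open>x = 0\<close> has to be discarded: there \<open>PP\<close>
      degenerates to y^M and the slice integral may be infinite.\<close>
    show "AE x in lborel. indicator {-\<delta>'<..<\<delta>'} x * I \<rho> x \<le> ennreal V * indicator {-\<delta>'<..<\<delta>'} x"
      using AE_lborel_singleton[of 0]
    proof eventually_elim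
      case (elim x)
      show ?case
      proof (cases "\<bar>x\<bar> < \<delta>'")
        case True
        then have "I \<rho> x \<le> ennreal V"
          using D(4)[of x] GK[of x] elim \<delta>' by (auto intro: order_trans ennreal_leI)
        then show ?thesis by (simp add: indicator_def)
      next
        case False
        then have "x \<notin> {-\<delta>'<..<\<delta>'}" by auto
        then show ?thesis by simp
      qed
    qed
  qed
  also have "\<dots> < \<infinity>" using \<delta>'(1) by (simp add: nn_integral_cmult_indicator ennreal_mult_less_top)
  finally have fin: "(\<integral>\<^sup>+z. ennreal (indicator (rect \<delta>' \<rho>) z * (norm (F z))\<^sup>2) \<partial>lborel) < \<infinity>"
    unfolding rect_nn_integral(1)[OF m] .
  note [measurable] = m
  have "(\<lambda>z. (norm (indicator (rect \<delta>' \<rho>) z *\<^sub>R F z))\<^sup>2) \<in> borel_measurable lborel" by measurable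
  moreover have "(norm (indicator (rect \<delta>' \<rho>) z *\<^sub>R F z))\<^sup>2 = indicator (rect \<delta>' \<rho>) z * (norm (F z))\<^sup>2" for z
    by (simp add: indicator_def)
  ultimately have m2: "(\<lambda>z. indicator (rect \<delta>' \<rho>) z * (norm (F z))\<^sup>2) \<in> borel_measurable lborel" by simp
  have "integrable lborel (\<lambda>z. indicator (rect \<delta>' \<rho>) z * (norm (F z))\<^sup>2)"
    by (rule integrableI_bounded[OF m2]) (use fin in \<open>simp add: abs_mult\<close>)
  then have "set_integrable lborel (rect \<delta>' \<rho>) (\<lambda>z. (norm (F z))\<^sup>2)"
    by (simp add: set_integrable_def)
  moreover have "set_borel_measurable lborel (rect \<delta>' \<rho>) F"
    using m by (simp add: set_borel_measurable_def)
  moreover have "(0, 0) \<in> rect \<delta>' \<rho>" using \<delta>'(1) \<rho>(1) by (simp add: rect_def)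
  ultimately show ?thesis
    unfolding L2_loc_def using open_rect by blast
qed

text \<open>All terms of \<open>G\<close> are nonnegative, so one offending branch alone gives a
  lower bound of the form pi c/|x|. Its integral near 0 diverges, while the lower slice estimate
  bounds it by the integral over a rectangle.\<close>

lemma orders_if_L2:
  assumes L2: "L2_loc F" and j: "j < M"
  shows "ord0 (W j) \<le> 2 * ord0 (Qa j)"
proof (rule ccontr)
  assume "\<not> ?thesis"
  from branch_ratio(2)[OF j this] obtain c d where c: "c > 0" and d: "d > 0"
    "\<And>x. x \<noteq> 0 \<Longrightarrow> \<bar>x\<bar> < d \<Longrightarrow> c / \<bar>x\<bar> \<le> ratio j x"
    unfolding eventually_at_0_real by blast
  obtain U where U: "open U" "(0, 0) \<in> U" "set_integrable lborel U (\<lambda>z. (norm (F z))\<^sup>2)"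
    using L2 unfolding L2_loc_def by blast
  obtain e where e: "e > 0" "ball (0, 0) e \<subseteq> U" using U(1,2) open_contains_ball by blast
  obtain \<rho> where \<rho>: "\<rho> > 0" "continuous_on (cball 0 \<rho> \<times> cball 0 \<rho>) (\<lambda>v. Q (fst v) (snd v))"
    and sl: "\<And>\<eta>. 0 < \<eta> \<Longrightarrow> \<eta> \<le> \<rho> \<Longrightarrow> \<exists>D\<ge>0. \<exists>\<delta>>0. \<delta> \<le> \<rho> \<and>
      (\<forall>x. x \<noteq> 0 \<longrightarrow> \<bar>x\<bar> < \<delta> \<longrightarrow> I \<eta> x \<le> ennreal (2 * G x + D) \<and> ennreal (G x) \<le> 2 * I \<eta> x + ennreal D)"
    using slice_bounds by blast
  \<comment> \<open>Half sides of at most \<open>e / 2\<close> place the rectangle inside the ball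
    of radius \<open>e\<close>, hence inside \<open>U\<close>.\<close>
  define \<eta> where "\<eta> = min \<rho> (e / 2)"
  have \<eta>: "0 < \<eta>" "\<eta> \<le> \<rho>" "\<eta> \<le> e / 2" using \<rho>(1) e(1) by (auto simp: \<eta>_def)
  obtain D \<delta>1 where D: "D \<ge> 0" "\<delta>1 > 0" "\<delta>1 \<le> \<rho>" "\<And>x. x \<noteq> 0 \<Longrightarrow> \<bar>x\<bar> < \<delta>1 \<Longrightarrow> ennreal (G x) \<le> 2 * I \<eta> x + ennreal D"
    using sl[OF \<eta>(1,2)] by blast
  define \<delta> where "\<delta> = min (min \<delta>1 d) (e / 2)"
  have \<delta>: "\<delta> > 0" "\<delta> \<le> \<delta>1" "\<delta> \<le> d" "\<delta> \<le> e / 2" "\<delta> \<le> \<rho>" using D d(1) e(1) by (auto simp: \<delta>_def)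
  have sub: "rect \<delta> \<eta> \<subseteq> U"
  proof
    fix z assume "z \<in> rect \<delta> \<eta>"
    then obtain x y where z: "z = (x, y)" "\<bar>x\<bar> < \<delta>" "\<bar>y\<bar> < \<eta>" by (auto simp: rect_def)
    have "norm (x, y) < e" using norm_Pair_le[of x y] z \<delta>(4) \<eta>(3) by simp
    then show "z \<in> U" using e(2) z(1) by (auto simp: dist_norm norm_Pair)
  qed
  have m: "(\<lambda>z. indicator (rect \<delta> \<eta>) z *\<^sub>R F z) \<in> borel_measurable lborel"
    by (rule rect_measurable[OF \<rho>(2) \<delta>(5) \<eta>(2)])
  define V where "V = (\<integral>\<^sup>+x. indicator {-\<delta><..<\<delta>} x * I \<eta> x \<partial>lborel)"
  have "V = (\<integral>\<^sup>+z. ennreal (indicator (rect \<delta> \<eta>) z * (norm (F z))\<^sup>2) \<partial>lborel)"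
    unfolding V_def rect_nn_integral(1)[OF m] ..
  also have "\<dots> \<le> (\<integral>\<^sup>+z. ennreal (norm (indicator U z *\<^sub>R (norm (F z))\<^sup>2)) \<partial>lborel)"
    using sub by (intro nn_integral_mono ennreal_leI) (auto simp: indicator_def)
  also have "\<dots> < \<infinity>" using U(3) unfolding set_integrable_def integrable_iff_bounded by simp
  finally have V: "V < \<infinity>" .
  \<comment> \<open>The inequality for \<open>G x\<close> integrated over |x| <
    \<open>\<delta>\<close>; the second term comes from the constant \<open>D\<close> over an
    interval of length \<open>2 * \<delta>\<close>.\<close>
  define B where "B = 2 * V + ennreal D * ennreal (2 * \<delta>)"
  have "B < \<infinity>" using V by (simp add: B_def ennreal_mult_less_top)
  have "(\<integral>\<^sup>+x. ennreal (pi * c / x) * indicator {e'..\<delta> / 2} x \<partial>lborel) \<le> B" if e': "0 < e'" for e'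
  proof -
    have "(\<integral>\<^sup>+x. ennreal (pi * c / x) * indicator {e'..\<delta> / 2} x \<partial>lborel)
      \<le> (\<integral>\<^sup>+x. 2 * (indicator {-\<delta><..<\<delta>} x * I \<eta> x) + ennreal D * indicator {-\<delta><..<\<delta>} x \<partial>lborel)"
    proof (rule nn_integral_mono)
      fix x :: real
      show "ennreal (pi * c / x) * indicator {e'..\<delta> / 2} x
        \<le> 2 * (indicator {-\<delta><..<\<delta>} x * I \<eta> x) + ennreal D * indicator {-\<delta><..<\<delta>} x"
      proof (cases "x \<in> {e'..\<delta> / 2}")
        case True
        then have x: "x > 0" "x < \<delta>" using e' \<delta>(1) by auto
        have "pi * c / x = pi * (c / \<bar>x\<bar>)" using x by simp
        also have "\<dots> \<le> pi * ratio j x"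
          using d(2)[of x] x \<delta>(3) by (intro mult_left_mono) auto
        also have "\<dots> \<le> G x" by (rule G_term_le[OF j])
        finally have "ennreal (pi * c / x) \<le> ennreal (G x)" by (rule ennreal_leI)
        also have "\<dots> \<le> 2 * I \<eta> x + ennreal D" using D(4)[of x] x \<delta>(2) by simp
        finally show ?thesis using True x by (simp add: indicator_def)
      qed simp
    qed
    also have "\<dots> = 2 * V + ennreal D * ennreal (2 * \<delta>)"
      using rect_nn_integral(2)[OF m] \<delta>(1)
      by (simp add: nn_integral_add nn_integral_cmult nn_integral_cmult_indicator V_def)
    finally show ?thesis by (simp add: B_def)
  qed
  then show False
    using inverse_not_nn_integrable_near_0[of "pi * c" "\<delta> / 2" B] c \<delta>(1) \<open>B < \<infinity>\<close> by simp
qed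

end

theorem theorem5p1:
  fixes M :: nat and L :: "nat \<Rightarrow> nat" and q :: "nat \<Rightarrow> real poly" and t :: real
  assumes "\<forall>j<M. L j \<ge> 1"
    and "\<forall>j<M. degree (q j) < 2 * L j"
    and "\<forall>j<M. poly (q j) 0 = 0"
  shows "(\<exists>a. has_branches M (\<lambda>x y. Apart (Pfun M L q) x y + of_real t * Bpart (Pfun M L q) x y) a) \<and>
    (\<forall>a. has_branches M (\<lambda>x y. Apart (Pfun M L q) x y + of_real t * Bpart (Pfun M L q) x y) a \<longrightarrow>
      (\<forall>Q. conv_ps2 Q \<longrightarrow>
        (L2_loc (\<lambda>(x, y). Q (of_real x) (of_real y) / Pfun M L q (of_real x) (of_real y))
         \<longleftrightarrow>
         (\<forall>j<M. 2 * ord0 (\<lambda>x. Q (of_real x) (of_real (a j x)))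
              \<ge> ord0 (\<lambda>x. Bpart (Pfun M L q) (of_real x) (of_real (a j x)) *
                    (partial_y (Apart (Pfun M L q)) (of_real x) (of_real (a j x))
                     + of_real t * partial_y (Bpart (Pfun M L q)) (of_real x) (of_real (a j x))))))))"
proof (intro conjI allI impI)
  show "\<exists>a. has_branches M (\<lambda>x y. Apart (Pfun M L q) x y + of_real t * Bpart (Pfun M L q) x y) a"
    by (rule exists_branches[OF assms(1,3)])
next
  fix a Q
  assume "has_branches M (\<lambda>x y. Apart (Pfun M L q) x y + of_real t * Bpart (Pfun M L q) x y) a"
    and "conv_ps2 Q"
  then interpret branches M L q t a Q
    using assms by unfold_locales
  have "L2_loc F \<longleftrightarrow> (\<forall>j<M. ord0 (W j) \<le> 2 * ord0 (Qa j))"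
    using L2_if_orders orders_if_L2 by blast
  then show "L2_loc (\<lambda>(x, y). Q (of_real x) (of_real y) / Pfun M L q (of_real x) (of_real y)) \<longleftrightarrow>
     (\<forall>j<M. 2 * ord0 (\<lambda>x. Q (of_real x) (of_real (a j x)))
          \<ge> ord0 (\<lambda>x. Bpart (Pfun M L q) (of_real x) (of_real (a j x)) *
                (partial_y (Apart (Pfun M L q)) (of_real x) (of_real (a j x))
                 + of_real t * partial_y (Bpart (Pfun M L q)) (of_real x) (of_real (a j x)))))"
    unfolding F_def W_def .
qed

end
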